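(* There is an absolute constant $C>0$ such that the following holds. Let $x_1,\dots,x_n\in\mathbb{R}^d$, $\gamma>0$, let each $l_j:\mathbb{R}\to\mathbb{R}$ be convex and twice differentiable, let $r:\mathbb{R}^d\to\mathbb{R}$ be convex (possibly non-smooth), let $F(w)=\frac1n\sum_{j=1}^n l_j(x_j^Tw)+\frac{\gamma}{2}\|w\|_2^2$, and let $w^\star$ be the unique minimizer of $G(w)=F(w)+r(w)$. For an iterate $w_t$ let $g_t=\nabla F(w_t)$, let $A_t\in\mathbb{R}^{n\times d}$ have $j$-th row $\sqrt{l_j''(x_j^Tw_t)}\,x_j^T$, and let $H_t=\nabla^2F(w_t)=\frac1nA_t^TA_t+\gamma I_d$. Let $\widetilde H_t=\frac1nA_t^TSS^TA_t+\gamma I_d$, where $S\in\mathbb{R}^{n\times s}$ is either a uniform sampling matrix or a ridge leverage score sampling matrix for $A_t$. Let $$ \widetilde p_t=\operatorname*{argmin}_{p\in\mathbb{R}^d}\ \tfrac12\big(p^T\widetilde H_tp-2g_t^Tp+g_t^T\widetilde H_t^{-1}g_t\big)+r(w_t-p) $$ be the exact solution of the SSPN subproblem and let $\widetilde p_t'$ be an inexact solution satisfying $$ \big\|\widetilde H_t^{1/2}(\widetilde p_t-\widetilde p_t')\big\|_2\ \le\ \frac{\varepsilon_0}{2}\big\|\widetilde H_t^{1/2}\widetilde p_t\big\|_2 $$ for some $\varepsilon_0\in(0,1)$. Consider the inexact Sub-Sampled Proximal Newton update $w_{t+1}=w_t-\widetilde p_t'$. Let $\varepsilon\in(0,\frac14)$,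 $\delta\in(0,1)$, let $d_{\mathrm{eff}}^\gamma$ and $\mu^\gamma$ denote the $\gamma$-effective dimension and row $\gamma$-ridge coherence of $A_t$, and suppose that $$ s\ge C\,\frac{\mu^\gamma d_{\mathrm{eff}}^\gamma}{\varepsilon^2}\log\frac{d_{\mathrm{eff}}^\gamma}{\delta}\ \text{ (uniform sampling)},\qquad\text{or}\qquad s\ge C\,\frac{d_{\mathrm{eff}}^\gamma}{\varepsilon^2}\log\frac{d_{\mathrm{eff}}^\gamma}{\delta}\ \text{ (ridge leverage score sampling)}. $$ (i) If all $l_j$ are quadratic (so $A_t\equiv A$, $H_t\equiv H$ are constant, and one sampling matrix $S$ is used for all iterations), and the inexactness condition holds at every iteration, then with probability at least $1-\delta$, for all $t\ge0$, $\|w_t-w^\star\|_2\le(\varepsilon+\varepsilon_0)^t\sqrt\kappa\,\|w_0-w^\star\|_2$, where $\kappa=\sigma_{\max}(H)/\sigma_{\min}(H)$. (ii) If $\|\nabla^2F(w)-\nabla^2F(w')\|_2\le L\|w-w'\|_2$ for all $w,w'\in\mathbb{R}^d$, then for given $w_t$, with probability at least $1-\delta$, $$ \|w_{t+1}-w^\star\|_2\le(\varepsilon+\varepsilon_0)\sqrt{\kappa_t}\,\|w_t-w^\star\|_2+\frac{L}{\sigma_{\min}(H_t)}\|w_t-w^\star\|_2^2,\qquad \kappa_t=\frac{\sigma_{\max}(H_t)}{\sigma_{\min}(H_t)} . $$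
   Context: For $A=[a_1^T;\dots;a_n^T]\in\mathbb{R}^{n\times d}$ and $\gamma\ge0$, the row $\gamma$-ridge leverage scores are $l_j^\gamma=a_j^T(A^TA+n\gamma I_d)^\dagger a_j$, $j=1,\dots,n$. The $\gamma$-effective dimension is $d_{\mathrm{eff}}^\gamma(A)=\sum_{j=1}^n l_j^\gamma=\sum_{k=1}^d\frac{\sigma_k^2}{\sigma_k^2+n\gamma}$, where $\sigma_1,\dots,\sigma_d$ are the singular values of $A$. The row $\gamma$-ridge coherence is $\mu^\gamma(A)=\frac{n}{d_{\mathrm{eff}}^\gamma}\max_{i}l_i^\gamma$. Sampling matrices: given probabilities $p_1,\dots,p_n$ summing to 1, independently for each column $c=1,\dots,s$ draw an index $k\in\{1,\dots,n\}$ with probability $p_k$ and let the $c$-th column of $S\in\mathbb{R}^{n\times s}$ have the single nonzero entry $1/\sqrt{s\,p_k}$ in position $k$. Uniform sampling: $p_j=1/n$. Ridge leverage score sampling for $A$: $p_j=l_j^\gamma/\sum_i l_i^\gamma$. $\sigma_{\max},\sigma_{\min}$ denote largest and smallest singular values.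
   Formalization: In both sample-size conditions log(d_eff/δ) is replaced by log(max(2, d_eff/δ)); as written the claim fails for every C when d_eff ≤ δ (the log is ≤ 0, so s = 1 is admitted) or when d_eff/δ is barely above 1. *)

theory Defs
  imports
    "HOL-Probability.Probability"
    "Jordan_Normal_Form.Matrix"
    "Jordan_Normal_Form.Char_Poly"
    "Jordan_Normal_Form.Gauss_Jordan_Elimination"
begin

text \<open>
  Vectors and matrices are those of Jordan_Normal_Form, whose dimensions are ordinary natural
  numbers: an absolute constant has to be chosen before \<open>n\<close>, \<open>d\<close> and \<open>s\<close>, which cannot be expressed
  with dimensions that are types. The rows of an \<open>n \<times> d\<close> matrix are indexed by \<open>0, \<dots>, n - 1\<close>.
\<close>

subsection \<open>Linear algebra\<close>

definition vnorm :: "real vec \<Rightarrow> real" where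
  "vnorm v = sqrt (v \<bullet> v)"

definition singular_values :: "real mat \<Rightarrow> real set" where
  "singular_values A = sqrt ` {k. eigenvalue (transpose_mat A * A) k}"

definition sigma_max :: "real mat \<Rightarrow> real" where
  "sigma_max A = Max (singular_values A)"

definition sigma_min :: "real mat \<Rightarrow> real" where
  "sigma_min A = Min (singular_values A)"

definition spectral_norm :: "real mat \<Rightarrow> real" where
  "spectral_norm A = sigma_max A"

definition is_pinv :: "real mat \<Rightarrow> real mat \<Rightarrow> bool" where
  "is_pinv A X \<longleftrightarrow>
     X \<in> carrier_mat (dim_col A) (dim_row A) \<and>
     A * X * A = A \<and> X * A * X = X \<and>
     transpose_mat (A * X) = A * X \<and> transpose_mat (X * A) = X * A"

definition pinv :: "real mat \<Rightarrow> real mat" where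
  "pinv A = (THE X. is_pinv A X)"

definition psd :: "real mat \<Rightarrow> bool" where
  "psd B \<longleftrightarrow> square_mat B \<and> transpose_mat B = B \<and>
     (\<forall>v \<in> carrier_vec (dim_row B). v \<bullet> (B *\<^sub>v v) \<ge> 0)"

definition psd_sqrt :: "real mat \<Rightarrow> real mat" where
  "psd_sqrt A = (THE B. psd B \<and> B * B = A)"

subsection \<open>Ridge leverage scores\<close>

definition ridge_lev :: "real \<Rightarrow> real mat \<Rightarrow> nat \<Rightarrow> real" where
  "ridge_lev \<gamma> A j =
     row A j \<bullet>
       (pinv (transpose_mat A * A + (real (dim_row A) * \<gamma>) \<cdot>\<^sub>m 1\<^sub>m (dim_col A)) *\<^sub>v row A j)"

definition eff_dim :: "real \<Rightarrow> real mat \<Rightarrow> real" where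
  "eff_dim \<gamma> A = (\<Sum>j<dim_row A. ridge_lev \<gamma> A j)"

definition ridge_coherence :: "real \<Rightarrow> real mat \<Rightarrow> real" where
  "ridge_coherence \<gamma> A =
     real (dim_row A) / eff_dim \<gamma> A * Max (ridge_lev \<gamma> A ` {..<dim_row A})"

subsection \<open>Sampling matrices\<close>

text \<open>
  A family of probabilities \<open>p\<^sub>0, \<dots>, p\<^bsub>n-1\<^esub>\<close> summing to 1 is a \<open>nat pmf\<close> supported in \<open>{..<n}\<close>.
  The columns of \<open>S\<close> are determined by the drawn indices \<open>k 0, \<dots>, k (s - 1)\<close>; these are
  independent with law \<open>q\<close>, so \<open>k\<close> has the product law below (\<open>k c = 0\<close> is a dummy value for
  \<open>c \<ge> s\<close>).
\<close>

definition column_draws :: "nat \<Rightarrow> nat pmf \<Rightarrow> (nat \<Rightarrow> nat) pmf" where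
  "column_draws s q = Pi_pmf {..<s} 0 (\<lambda>_. q)"

definition sampling_matrix :: "nat \<Rightarrow> nat \<Rightarrow> nat pmf \<Rightarrow> (nat \<Rightarrow> nat) \<Rightarrow> real mat" where
  "sampling_matrix n s q k =
     mat n s (\<lambda>(i, c). if i = k c then 1 / sqrt (real s * pmf q i) else 0)"

definition uniform_sampling :: "nat \<Rightarrow> nat pmf \<Rightarrow> bool" where
  "uniform_sampling n q \<longleftrightarrow> set_pmf q \<subseteq> {..<n} \<and> (\<forall>j<n. pmf q j = 1 / real n)"

text \<open>No \<open>q\<close> satisfies the next predicate if \<open>A = 0\<close>, where the scores do not define probabilities.\<close>

definition ridge_lev_sampling :: "real \<Rightarrow> real mat \<Rightarrow> nat pmf \<Rightarrow> bool" where
  "ridge_lev_sampling \<gamma> A q \<longleftrightarrow>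
     set_pmf q \<subseteq> {..<dim_row A} \<and>
     (\<forall>j<dim_row A. pmf q j = ridge_lev \<gamma> A j / (\<Sum>i<dim_row A. ridge_lev \<gamma> A i))"

text \<open>
  The logarithmic factor is \<open>ln (eff_dim / \<delta>)\<close> with its argument cut off below at 2. Without the
  cut-off it is not positive when \<open>eff_dim \<le> \<delta>\<close>; a single sampled column would then be admissible
  for every \<open>C\<close>, and the error bounds fail for such samples: take \<open>A = \<alpha> I\<^sub>2\<close> with small \<open>\<alpha>\<close>.
\<close>

definition sampling_scheme ::
    "real \<Rightarrow> real \<Rightarrow> real \<Rightarrow> real \<Rightarrow> real mat \<Rightarrow> nat \<Rightarrow> nat pmf \<Rightarrow> bool" where
  "sampling_scheme C \<gamma> \<epsilon> \<delta> A s q \<longleftrightarrow>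
     uniform_sampling (dim_row A) q \<and>
       real s \<ge> C * (ridge_coherence \<gamma> A * eff_dim \<gamma> A / \<epsilon>\<^sup>2) * ln (max 2 (eff_dim \<gamma> A / \<delta>)) \<or>
     ridge_lev_sampling \<gamma> A q \<and>
       real s \<ge> C * (eff_dim \<gamma> A / \<epsilon>\<^sup>2) * ln (max 2 (eff_dim \<gamma> A / \<delta>))"

subsection \<open>Objective function and its derivatives\<close>

definition twice_differentiable :: "(real \<Rightarrow> real) \<Rightarrow> bool" where
  "twice_differentiable f \<longleftrightarrow>
     (\<forall>z. f differentiable (at z)) \<and> (\<forall>z. deriv f differentiable (at z))"

definition quadratic :: "(real \<Rightarrow> real) \<Rightarrow> bool" where
  "quadratic f \<longleftrightarrow> (\<exists>a b c. \<forall>z. f z = a * z\<^sup>2 + b * z + c)"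

definition convex_vec :: "nat \<Rightarrow> (real vec \<Rightarrow> real) \<Rightarrow> bool" where
  "convex_vec d r \<longleftrightarrow>
     (\<forall>u \<in> carrier_vec d. \<forall>v \<in> carrier_vec d. \<forall>t \<in> {0..1}.
        r (t \<cdot>\<^sub>v u + (1 - t) \<cdot>\<^sub>v v) \<le> t * r u + (1 - t) * r v)"

definition partial :: "nat \<Rightarrow> (real vec \<Rightarrow> real) \<Rightarrow> real vec \<Rightarrow> real" where
  "partial i f w = deriv (\<lambda>h. f (w + h \<cdot>\<^sub>v unit_vec (dim_vec w) i)) 0"

definition grad :: "nat \<Rightarrow> (real vec \<Rightarrow> real) \<Rightarrow> real vec \<Rightarrow> real vec" where
  "grad d f w = vec d (\<lambda>i. partial i f w)"

definition hessian :: "nat \<Rightarrow> (real vec \<Rightarrow> real) \<Rightarrow> real vec \<Rightarrow> real mat" where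
  "hessian d f w = mat d d (\<lambda>(i, j). partial i (partial j f) w)"

definition smooth_part ::
    "nat \<Rightarrow> (nat \<Rightarrow> real vec) \<Rightarrow> (nat \<Rightarrow> real \<Rightarrow> real) \<Rightarrow> real \<Rightarrow> real vec \<Rightarrow> real" where
  "smooth_part n x l \<gamma> w = (\<Sum>j<n. l j (x j \<bullet> w)) / real n + \<gamma> / 2 * (vnorm w)\<^sup>2"

definition weighted_data ::
    "nat \<Rightarrow> nat \<Rightarrow> (nat \<Rightarrow> real vec) \<Rightarrow> (nat \<Rightarrow> real \<Rightarrow> real) \<Rightarrow> real vec \<Rightarrow> real mat" where
  "weighted_data n d x l w = mat n d (\<lambda>(j, i). sqrt (deriv (deriv (l j)) (x j \<bullet> w)) * x j $ i)"

subsection \<open>Sub-sampled proximal Newton steps\<close>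

definition sampled_hessian :: "real \<Rightarrow> real mat \<Rightarrow> real mat \<Rightarrow> real mat" where
  "sampled_hessian \<gamma> A S =
     (1 / real (dim_row A)) \<cdot>\<^sub>m (transpose_mat A * S * transpose_mat S * A) + \<gamma> \<cdot>\<^sub>m 1\<^sub>m (dim_col A)"

definition subproblem ::
    "real mat \<Rightarrow> real vec \<Rightarrow> (real vec \<Rightarrow> real) \<Rightarrow> real vec \<Rightarrow> real vec \<Rightarrow> real" where
  "subproblem Ht g r w p =
     1 / 2 * (p \<bullet> (Ht *\<^sub>v p) - 2 * (g \<bullet> p) + g \<bullet> (the (mat_inverse Ht) *\<^sub>v g)) + r (w - p)"

text \<open>
  \<open>p\<close> is the exact and \<open>p'\<close> an inexact solution. The update is a relation, since the inexactness
  condition does not determine \<open>p'\<close>. As \<open>p'\<close> may depend on the sampling matrix in any way, the updates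
  have to be quantified inside an event about the sampling matrix.
\<close>

definition sspn_update ::
    "nat \<Rightarrow> real mat \<Rightarrow> real vec \<Rightarrow> (real vec \<Rightarrow> real) \<Rightarrow> real \<Rightarrow> real vec \<Rightarrow> real vec \<Rightarrow> bool" where
  "sspn_update d Ht g r \<epsilon>\<^sub>0 w w' \<longleftrightarrow>
     (\<exists>p p'. is_arg_min (subproblem Ht g r w) (\<lambda>q. q \<in> carrier_vec d) p \<and>
        p' \<in> carrier_vec d \<and>
        vnorm (psd_sqrt Ht *\<^sub>v (p - p')) \<le> \<epsilon>\<^sub>0 / 2 * vnorm (psd_sqrt Ht *\<^sub>v p) \<and>
        w' = w - p')"

end

theory Submission
  imports Defs "Jordan_Normal_Form.Determinant"
begin

text \<open>
  Let \<open>H\<close> be the exact and \<open>Ht\<close> the sub-sampled Hessian. Everything rests on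
  \<open>\<bar>u \<bullet> Ht v - u \<bullet> H v\<bar> \<le> \<epsilon>/2 \<cdot> \<parallel>u\<parallel>\<^sub>H \<cdot> \<parallel>v\<parallel>\<^sub>H\<close> with probability at least \<open>1 - \<delta>\<close>: comparing the
  optimality conditions of the subproblem and of the minimiser then shows that a step contracts the
  \<open>H\<close>-norm of the error by \<open>\<epsilon> + \<epsilon>\<^sub>0\<close>, up to the linearisation error of the gradient. For quadratic
  losses this error vanishes and \<open>H\<close> is constant, so that the bound can be iterated.

  For the concentration, write \<open>X = (1/s) \<Sum> Z\<^sub>c - M\<close> for the whitened deviation, where the \<open>Z\<^sub>c\<close> are
  independent rank-one matrices of norm at most \<open>R\<close> with mean \<open>M\<close>, \<open>M \<le> 1\<close> and \<open>tr M\<close> the effective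
  dimension. Instead of the matrix Laplace transform we use trace moments: exchanging one draw for an
  independent copy gives \<open>E tr X\<^bsup>2p\<^esup> \<le> (2p-1) R/s \<cdot> E tr ((X + 2M) X\<^bsup>2p-2\<^esup>)\<close>, hence
  \<open>E tr X\<^bsup>2p\<^esup> \<le> (3 (2p-1) R/s)\<^sup>p tr M\<close>, and Markov's inequality is applied with \<open>p\<close> of order
  \<open>log (tr M / \<delta>)\<close>. Only the last step of the recursion meets \<open>tr M\<close>, which is why the ambient
  dimension does not enter.
\<close>

unbundle no inner_syntax

subsection \<open>Spectral theorem for real symmetric matrices\<close>

text \<open>Two obstacles shape the concentration step. The deviation \<open>X\<close> and its
  resampled copy do not commute, so a scalar inequality between powers cannot be applied to them
  directly; expanding the traces in the eigenbases of both matrices at once turns it into a sum over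
  pairs of eigenvectors with nonnegative weights, and no operator convexity enters. The two sampling
  laws are treated alike: after whitening by the inverse square root of \<open>H\<close>, both are
  instances of \<open>ridge_lev \<gamma> A j \<le> R * pmf q j\<close>, where \<open>R\<close> is
  coherence times effective dimension, or the effective dimension alone. The accuracy is
  \<epsilon>/2 because the step, including its inexact solution, loses a factor below 2 when
  \<epsilon> < 1/4. The closeness bound is bilinear since the step pairs the old error with the new
  one, and it is the only random event: on it, every update obeys the bound deterministically,
  however it depends on the sample. Iterating in the energy norm and passing to the Euclidean norm
  only once keeps the condition number out of the power.\<close>

lemma symmetric_scalar_prod:
  fixes A :: "real mat"
  assumes "A \<in> carrier_mat d d" "transpose_mat A = A" "v \<in> carrier_vec d" "w \<in> carrier_vec d"
  shows "v \<bullet> (A *\<^sub>v w) = (A *\<^sub>v v) \<bullet> w"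
  using transpose_vec_mult_scalar[of A d d w v] assms by auto

lemma scalar_prod_self_ge_0: "(v :: real vec) \<bullet> v \<ge> 0"
  by (auto simp: scalar_prod_def intro!: sum_nonneg)

lemma scalar_prod_self_eq_0:
  assumes "(v :: real vec) \<in> carrier_vec d" "v \<bullet> v = 0"
  shows "v = 0\<^sub>v d"
proof (rule eq_vecI)
  fix i assume "i < dim_vec (0\<^sub>v d :: real vec)"
  then have i: "i \<in> {0..<dim_vec v}" using assms by auto
  have "(\<Sum>i\<in>{0..<dim_vec v}. v $ i * v $ i) = 0" using assms(2) by (simp add: scalar_prod_def)
  then have "v $ i * v $ i = 0" using i by (subst (asm) sum_nonneg_eq_0_iff) auto
  then show "v $ i = 0\<^sub>v d $ i" using i assms by auto
qed (use assms in auto)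

lemma quadratic_form_sum:
  fixes A :: "real mat"
  assumes "A \<in> carrier_mat d d"
  shows "vec d f \<bullet> (A *\<^sub>v vec d f) = (\<Sum>i<d. \<Sum>j<d. f i * (A $$ (i, j) * f j))"
  using assms by (auto simp: scalar_prod_def sum_distrib_left lessThan_atLeast0 intro!: sum.cong)

text \<open>Padding the \<open>k < d\<close> vectors with zero rows gives a square matrix whose row
  \<open>k\<close> vanishes, hence a singular one; a normalised kernel vector is orthogonal to every
  \<open>u i\<close>.\<close>

lemma exists_orthogonal_vector:
  fixes u :: "nat \<Rightarrow> real vec"
  assumes "k < d" "\<And>i. i < k \<Longrightarrow> u i \<in> carrier_vec d"
  shows "\<exists>x \<in> carrier_vec d. x \<bullet> x = 1 \<and> (\<forall>i<k. u i \<bullet> x = 0)"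
proof -
  define B where "B = mat_of_rows d (map (\<lambda>i. if i < k then u i else 0\<^sub>v d) [0..<d])"
  have B: "B \<in> carrier_mat d d" by (auto simp: B_def)
  have row: "row B i = (if i < k then u i else 0\<^sub>v d)" if "i < d" for i
    using that assms by (auto simp: B_def intro!: mat_of_rows_row[THEN trans])
  have "det B = 0"
  proof -
    have "row B k = 0\<^sub>v d" using row assms by auto
    then have "\<And>j. j < d \<Longrightarrow> B $$ (k, j) = 0" using B assms(1)
      by (metis index_row(1) carrier_matD index_zero_vec(1))
    then show ?thesis using laplace_expansion_row[OF B assms(1)] by simp
  qed
  then obtain v where v: "v \<in> carrier_vec d" "v \<noteq> 0\<^sub>v d" "B *\<^sub>v v = 0\<^sub>v d"
    using det_0_iff_vec_prod_zero[OF B] by auto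
  have orth: "u i \<bullet> v = 0" if "i < k" for i
  proof -
    have "(B *\<^sub>v v) $ i = 0" using v that assms(1) by simp
    then show ?thesis using row[of i] that assms(1) B by simp
  qed
  have pos: "v \<bullet> v > 0" using scalar_prod_self_ge_0[of v] scalar_prod_self_eq_0[of v d] v by fastforce
  define x where "x = (1 / sqrt (v \<bullet> v)) \<cdot>\<^sub>v v"
  have "x \<bullet> x = 1" using v pos by (simp add: x_def)
  moreover have "u i \<bullet> x = 0" if "i < k" for i using that assms orth v by (simp add: x_def)
  ultimately show ?thesis using v by (intro bexI[of _ x]) (auto simp: x_def)
qed

text \<open>The eigenvector is a maximiser of the Rayleigh quotient on the complement of \<open>u\<close>.\<close>

lemma symmetric_next_eigenvector:
  fixes A :: "real mat" and u :: "nat \<Rightarrow> real vec"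
  assumes A: "A \<in> carrier_mat d d" and sym: "transpose_mat A = A" and k: "k < d"
    and u: "\<And>i. i < k \<Longrightarrow> u i \<in> carrier_vec d"
    and ev: "\<And>i. i < k \<Longrightarrow> A *\<^sub>v u i = lam i \<cdot>\<^sub>v u i"
  shows "\<exists>x \<in> carrier_vec d. \<exists>\<mu>. x \<bullet> x = 1 \<and> (\<forall>i<k. u i \<bullet> x = 0) \<and> A *\<^sub>v x = \<mu> \<cdot>\<^sub>v x"
proof -
  \<comment> \<open>Vectors are replaced by functions on all naturals, which carry the product
    topology. Freezing the coordinates from \<open>d\<close> on at 0 makes the box compact by
    Tychonoff's theorem.\<close>
  define box where "box = (PiE UNIV (\<lambda>i. if i < d then {-1..1} else {0}) :: (nat \<Rightarrow> real) set)"
  define K where "K = box \<inter> {f. (\<Sum>i<d. f i * f i) = 1} \<inter> (\<Inter>j\<in>{..<k}. {f. (\<Sum>i<d. u j $ i * f i) = 0})"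
  define Q where "Q f = (\<Sum>i<d. \<Sum>j<d. f i * (A $$ (i, j) * f j))" for f :: "nat \<Rightarrow> real"
  have cont: "continuous_on UNIV (\<lambda>f :: nat \<Rightarrow> real. f i)" for i by simp
  have "compactin (product_topology (\<lambda>i. euclidean) UNIV) box"
    unfolding box_def by (subst compactin_PiE) auto
  then have "compact box" by (simp add: euclidean_product_topology)
  moreover have "closed {f :: nat \<Rightarrow> real. (\<Sum>i<d. f i * f i) = 1}"
    by (intro closed_Collect_eq continuous_on_sum continuous_on_mult cont continuous_on_const)
  moreover have "closed {f :: nat \<Rightarrow> real. (\<Sum>i<d. u j $ i * f i) = 0}" for j
    by (intro closed_Collect_eq continuous_on_sum continuous_on_mult cont continuous_on_const)
  ultimately have "compact K" unfolding K_def by (intro compact_Int_closed closed_INT) auto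
  have vecK: "vec d f \<bullet> vec d f = 1 \<and> (\<forall>j<k. u j \<bullet> vec d f = 0)" if "f \<in> K" for f
    using that u by (auto simp: K_def scalar_prod_def lessThan_atLeast0)
  have Kvec: "(\<lambda>i. if i < d then x $ i else 0) \<in> K"
    if x: "x \<in> carrier_vec d" "x \<bullet> x = 1" "\<forall>i<k. u i \<bullet> x = 0" for x
  proof -
    have s: "(\<Sum>i<d. x $ i * x $ i) = 1" using x by (simp add: scalar_prod_def lessThan_atLeast0)
    have "\<bar>x $ i\<bar> \<le> 1" if "i < d" for i
    proof -
      have "x $ i * x $ i \<le> 1" unfolding s[symmetric] using that by (intro member_le_sum) auto
      then show ?thesis by (metis abs_square_le_1 power2_eq_square)
    qed
    then have "(\<lambda>i. if i < d then x $ i else 0) \<in> box" by (fastforce simp: box_def abs_le_iff)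
    then show ?thesis using s x u by (auto simp: K_def scalar_prod_def lessThan_atLeast0)
  qed
  have "K \<noteq> {}" using exists_orthogonal_vector[of k d u] k u Kvec by blast
  moreover have "continuous_on K Q" unfolding Q_def
    by (rule continuous_on_subset[of UNIV],
        intro continuous_on_sum continuous_on_mult cont continuous_on_const) auto
  ultimately obtain f where f: "f \<in> K" "\<And>g. g \<in> K \<Longrightarrow> Q g \<le> Q f"
    using continuous_attains_sup[OF \<open>compact K\<close>, of Q] by auto
  define x where "x = vec d f"
  define \<mu> where "\<mu> = Q f"
  have x: "x \<in> carrier_vec d" "x \<bullet> x = 1" "\<And>i. i < k \<Longrightarrow> u i \<bullet> x = 0"
    using vecK[OF f(1)] by (auto simp: x_def)
  have xm: "x \<bullet> (A *\<^sub>v x) = \<mu>" unfolding x_def \<mu>_def Q_def by (rule quadratic_form_sum[OF A])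
  have max1: "z \<bullet> (A *\<^sub>v z) \<le> \<mu>"
    if z: "z \<in> carrier_vec d" "z \<bullet> z = 1" "\<forall>i<k. u i \<bullet> z = 0" for z
  proof -
    have zv: "z = vec d (\<lambda>i. if i < d then z $ i else 0)" using z by auto
    have "z \<bullet> (A *\<^sub>v z) = Q (\<lambda>i. if i < d then z $ i else 0)"
      unfolding Q_def by (subst zv, subst (2) zv, rule quadratic_form_sum[OF A])
    then show ?thesis using f(2)[OF Kvec[OF z]] by (simp add: \<mu>_def)
  qed
  have max: "z \<bullet> (A *\<^sub>v z) \<le> \<mu> * (z \<bullet> z)"
    if z: "z \<in> carrier_vec d" "\<forall>i<k. u i \<bullet> z = 0" for z
  proof (cases "z \<bullet> z = 0")
    case True
    then have "z = 0\<^sub>v d" using scalar_prod_self_eq_0 z by blast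
    then show ?thesis using A True by simp
  next
    case False
    then have pos: "z \<bullet> z > 0" using scalar_prod_self_ge_0[of z] by simp
    define c where "c = 1 / sqrt (z \<bullet> z)"
    have cc: "c * c * (z \<bullet> z) = 1" using pos by (simp add: c_def)
    have "(c \<cdot>\<^sub>v z) \<bullet> (A *\<^sub>v (c \<cdot>\<^sub>v z)) \<le> \<mu>"
      using z cc u by (intro max1) (auto simp: mult.assoc)
    then have "c * c * (z \<bullet> (A *\<^sub>v z)) \<le> \<mu> * (c * c * (z \<bullet> z))"
      using z A cc by (simp add: mult_mat_vec[OF A z(1)] mult.assoc)
    moreover have "c * c > 0" using pos by (simp add: c_def)
    ultimately have "c * c * (z \<bullet> (A *\<^sub>v z)) \<le> c * c * (\<mu> * (z \<bullet> z))" by (simp add: algebra_simps)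
    then show ?thesis using \<open>c * c > 0\<close> mult_le_cancel_left_pos by blast
  qed
  \<comment> \<open>The residual is orthogonal to \<open>x\<close> and to all \<open>u i\<close>,
    because these are eigenvectors of a symmetric matrix. It is thus an admissible direction, along
    which the Rayleigh quotient at \<open>x\<close> has derivative
    \<open>2 * (y \<bullet> y)\<close>; maximality forces this to vanish.\<close>
  define y where "y = A *\<^sub>v x - \<mu> \<cdot>\<^sub>v x"
  have Ax: "A *\<^sub>v x \<in> carrier_vec d" using A x by auto
  have y: "y \<in> carrier_vec d" using Ax x by (auto simp: y_def)
  have Ay: "A *\<^sub>v y \<in> carrier_vec d" using A y by auto
  have uy: "u i \<bullet> y = 0" if "i < k" for i
  proof -
    have "u i \<bullet> (A *\<^sub>v x) = lam i * (u i \<bullet> x)"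
      using symmetric_scalar_prod[OF A sym u[OF that] x(1)] ev[OF that] u[OF that] x(1) by simp
    then show ?thesis using u[OF that] x(3)[OF that] x(1) Ax
      by (simp add: y_def scalar_prod_minus_distrib[of _ d])
  qed
  have xy: "x \<bullet> y = 0" using x xm Ax by (simp add: y_def scalar_prod_minus_distrib[of _ d])
  have yAx: "y \<bullet> (A *\<^sub>v x) = y \<bullet> y"
  proof -
    have "y \<bullet> y = y \<bullet> (A *\<^sub>v x) - \<mu> * (y \<bullet> x)"
      using x y Ax by (subst (2) y_def, simp add: scalar_prod_minus_distrib[of _ d])
    then show ?thesis using xy x(1) y comm_scalar_prod[of x d y] by simp
  qed
  have ineq: "2 * t * (y \<bullet> y) \<le> t * t * (\<mu> * (y \<bullet> y) - y \<bullet> (A *\<^sub>v y))" for t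
  proof -
    define z where "z = x + t \<cdot>\<^sub>v y"
    have z: "z \<in> carrier_vec d" using x y by (auto simp: z_def)
    have "\<forall>i<k. u i \<bullet> z = 0" using u uy x y
      by (auto simp: z_def scalar_prod_add_distrib[of _ d])
    from max[OF z this] have le: "z \<bullet> (A *\<^sub>v z) \<le> \<mu> * (z \<bullet> z)" .
    have zz: "z \<bullet> z = 1 + t * t * (y \<bullet> y)"
      using x y xy comm_scalar_prod[of x d y]
      by (simp add: z_def scalar_prod_add_distrib[of _ d] add_scalar_prod_distrib[of _ d])
    have Az: "A *\<^sub>v z = A *\<^sub>v x + t \<cdot>\<^sub>v (A *\<^sub>v y)"
      using A x y by (simp add: z_def mult_add_distrib_mat_vec[of _ d d] mult_mat_vec)
    have xAy: "x \<bullet> (A *\<^sub>v y) = y \<bullet> y"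
      using symmetric_scalar_prod[OF A sym x(1) y] yAx comm_scalar_prod[OF Ax y] by simp
    have "z \<bullet> (A *\<^sub>v z) = \<mu> + 2 * t * (y \<bullet> y) + t * t * (y \<bullet> (A *\<^sub>v y))"
      unfolding Az using x y Ax Ay xm yAx xAy
      by (simp add: z_def scalar_prod_add_distrib[of _ d] add_scalar_prod_distrib[of _ d] algebra_simps)
    then show ?thesis using le zz by (simp add: algebra_simps)
  qed
  have "y \<bullet> y = 0"
  proof (rule ccontr)
    assume "y \<bullet> y \<noteq> 0"
    then have a: "y \<bullet> y > 0" using scalar_prod_self_ge_0[of y] by simp
    \<comment> \<open>An upper bound for the second-order coefficient, made positive by the summand
      1. The step \<open>t = (y \<bullet> y) / b\<close> then turns \<open>ineq\<close> into
      \<open>2 * (y \<bullet> y) \<le> y \<bullet> y\<close>.\<close>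
    define b where "b = \<bar>\<mu> * (y \<bullet> y) - y \<bullet> (A *\<^sub>v y)\<bar> + 1"
    define t where "t = (y \<bullet> y) / b"
    have b: "b > 0" by (simp add: b_def)
    have t: "t > 0" using a b by (simp add: t_def)
    have "t * (2 * (y \<bullet> y)) \<le> t * (t * (\<mu> * (y \<bullet> y) - y \<bullet> (A *\<^sub>v y)))"
      using ineq[of t] by (simp add: algebra_simps)
    then have "2 * (y \<bullet> y) \<le> t * (\<mu> * (y \<bullet> y) - y \<bullet> (A *\<^sub>v y))" using t by simp
    also have "\<dots> \<le> t * b" using t by (intro mult_left_mono) (auto simp: b_def)
    also have "\<dots> = y \<bullet> y" using b by (simp add: t_def)
    finally show False using a by simp
  qed
  then have "y = 0\<^sub>v d" using scalar_prod_self_eq_0 y by blast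
  then have "A *\<^sub>v x = \<mu> \<cdot>\<^sub>v x"
  proof -
    assume y0: "y = 0\<^sub>v d"
    show ?thesis
    proof (rule eq_vecI)
      fix i assume "i < dim_vec (\<mu> \<cdot>\<^sub>v x)"
      then have "i < d" using x by simp
      then have "y $ i = 0" using y0 by simp
      then show "(A *\<^sub>v x) $ i = (\<mu> \<cdot>\<^sub>v x) $ i" using \<open>i < d\<close> A x by (simp add: y_def)
    qed (use A x in auto)
  qed
  then show ?thesis using x by blast
qed

definition eigenbasis :: "nat \<Rightarrow> real mat \<Rightarrow> (nat \<Rightarrow> real vec) \<Rightarrow> (nat \<Rightarrow> real) \<Rightarrow> bool" where
  "eigenbasis d A u lam \<longleftrightarrow> A \<in> carrier_mat d d \<and>
     (\<forall>i<d. u i \<in> carrier_vec d \<and> A *\<^sub>v u i = lam i \<cdot>\<^sub>v u i) \<and>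
     (\<forall>i<d. \<forall>j<d. u i \<bullet> u j = (if i = j then 1 else 0))"

theorem symmetric_eigenbasis:
  fixes A :: "real mat"
  assumes A: "A \<in> carrier_mat d d" and sym: "transpose_mat A = A"
  obtains u lam where "eigenbasis d A u lam"
proof -
  have "\<exists>u lam. (\<forall>i<k. u i \<in> carrier_vec d \<and> A *\<^sub>v u i = lam i \<cdot>\<^sub>v u i) \<and>
     (\<forall>i<k. \<forall>j<k. u i \<bullet> u j = (if i = j then 1 else 0))" if "k \<le> d" for k
    using that
  proof (induction k)
    case 0
    then show ?case by auto
  next
    case (Suc k)
    then have "\<exists>u lam. (\<forall>i<k. u i \<in> carrier_vec d \<and> A *\<^sub>v u i = lam i \<cdot>\<^sub>v u i) \<and>
      (\<forall>i<k. \<forall>j<k. u i \<bullet> u j = (if i = j then 1 else 0))" by simp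
    then obtain u lam where u: "\<And>i. i < k \<Longrightarrow> u i \<in> carrier_vec d"
      "\<And>i. i < k \<Longrightarrow> A *\<^sub>v u i = lam i \<cdot>\<^sub>v u i"
      "\<And>i j. i < k \<Longrightarrow> j < k \<Longrightarrow> u i \<bullet> u j = (if i = j then 1 else 0)" by blast
    from symmetric_next_eigenvector[of A d k u lam] A sym u(1,2) Suc.prems
    obtain x \<mu> where x: "x \<in> carrier_vec d" "x \<bullet> x = 1" "\<And>i. i < k \<Longrightarrow> u i \<bullet> x = 0"
      "A *\<^sub>v x = \<mu> \<cdot>\<^sub>v x" by auto
    have "x \<bullet> u i = 0" if "i < k" for i
      using x(3)[OF that] comm_scalar_prod[OF x(1) u(1)[OF that]] by simp
    then show ?case using u x
      by (intro exI[of _ "u(k := x)"] exI[of _ "lam(k := \<mu>)"]) (auto simp: less_Suc_eq)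
  qed
  from this[of d] A that show ?thesis unfolding eigenbasis_def by auto
qed

subsection \<open>Spectral calculus\<close>

lemma mat_eq_bilinear:
  fixes A B :: "real mat"
  assumes "A \<in> carrier_mat d d" "B \<in> carrier_mat d d"
    and "\<And>v w. v \<in> carrier_vec d \<Longrightarrow> w \<in> carrier_vec d \<Longrightarrow> v \<bullet> (A *\<^sub>v w) = v \<bullet> (B *\<^sub>v w)"
  shows "A = B"
proof (rule eq_matI)
  fix i j assume ij: "i < dim_row B" "j < dim_col B"
  have "C $$ (i, j) = unit_vec d i \<bullet> (C *\<^sub>v unit_vec d j)" if "C \<in> carrier_mat d d" for C :: "real mat"
    using that ij assms(2) by (simp add: scalar_prod_left_unit[of _ d])
  then show "A $$ (i, j) = B $$ (i, j)" using assms(3)[of "unit_vec d i" "unit_vec d j"] assms(1,2) by simp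
qed (use assms in auto)

text \<open>The completeness of \<open>d\<close> orthonormal vectors: the square matrix
  \<open>U\<close> with these rows has its transpose as right inverse, which for square matrices is
  also a left inverse.\<close>

lemma parseval:
  fixes u :: "nat \<Rightarrow> real vec"
  assumes u: "\<And>i. i < d \<Longrightarrow> u i \<in> carrier_vec d"
    and orth: "\<And>i j. i < d \<Longrightarrow> j < d \<Longrightarrow> u i \<bullet> u j = (if i = j then 1 else 0)"
    and v: "v \<in> carrier_vec d" and w: "w \<in> carrier_vec d"
  shows "v \<bullet> w = (\<Sum>i<d. (u i \<bullet> v) * (u i \<bullet> w))"
proof -
  define U where "U = mat d d (\<lambda>(i, j). u i $ j)"
  have U: "U \<in> carrier_mat d d" by (simp add: U_def)
  have row: "row U i = u i" if "i < d" for i using that u[OF that] by (intro eq_vecI) (auto simp: U_def)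
  have "U * transpose_mat U = 1\<^sub>m d"
    using U by (intro eq_matI) (auto simp: row orth)
  then have "transpose_mat U * U = 1\<^sub>m d"
    using mat_mult_left_right_inverse[OF U] U by auto
  then have "v \<bullet> w = v \<bullet> ((transpose_mat U * U) *\<^sub>v w)" using w by simp
  also have "\<dots> = v \<bullet> (transpose_mat U *\<^sub>v (U *\<^sub>v w))"
    using U w assoc_mult_mat_vec[of "transpose_mat U" d d U d w] by simp
  also have "\<dots> = (U *\<^sub>v v) \<bullet> (U *\<^sub>v w)"
    using transpose_vec_mult_scalar[of "transpose_mat U" d d "U *\<^sub>v w" v] U v w by simp
  also have "\<dots> = (\<Sum>i<d. (u i \<bullet> v) * (u i \<bullet> w))"
    using U by (auto simp: scalar_prod_def[of "U *\<^sub>v v"] lessThan_atLeast0 row intro!: sum.cong)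
  finally show ?thesis .
qed

lemma eigenbasisD:
  assumes "eigenbasis d A u lam"
  shows "A \<in> carrier_mat d d" "i < d \<Longrightarrow> u i \<in> carrier_vec d" "i < d \<Longrightarrow> A *\<^sub>v u i = lam i \<cdot>\<^sub>v u i"
    "i < d \<Longrightarrow> j < d \<Longrightarrow> u i \<bullet> u j = (if i = j then 1 else 0)"
  using assms by (auto simp: eigenbasis_def)

lemma eigenbasis_parseval:
  assumes "eigenbasis d A u lam" "v \<in> carrier_vec d" "w \<in> carrier_vec d"
  shows "v \<bullet> w = (\<Sum>i<d. (u i \<bullet> v) * (u i \<bullet> w))"
  by (rule parseval[OF eigenbasisD(2)[OF assms(1)] eigenbasisD(4)[OF assms(1)] assms(2,3)])

text \<open>The functional calculus: if \<open>u\<close> is an eigenbasis of a symmetric matrix with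
  eigenvalues \<open>lam\<close>, then \<open>f i = g (lam i)\<close> gives \<open>g\<close> of that
  matrix. Taking the basis as the argument makes products of such matrices a pointwise
  matter.\<close>

definition spectral_fun :: "nat \<Rightarrow> (nat \<Rightarrow> real vec) \<Rightarrow> (nat \<Rightarrow> real) \<Rightarrow> real mat" where
  "spectral_fun d u f = mat d d (\<lambda>(a, b). \<Sum>i<d. f i * (u i $ a * u i $ b))"

lemma spectral_fun_carrier [simp]: "spectral_fun d u f \<in> carrier_mat d d"
  by (simp add: spectral_fun_def)

lemma spectral_fun_dim [simp]: "dim_row (spectral_fun d u f) = d" "dim_col (spectral_fun d u f) = d"
  by (simp_all add: spectral_fun_def)

lemma spectral_fun_symmetric [simp]: "transpose_mat (spectral_fun d u f) = spectral_fun d u f"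
  by (intro eq_matI) (auto simp: spectral_fun_def mult.commute)

lemma spectral_fun_bilinear:
  assumes u: "\<And>i. i < d \<Longrightarrow> u i \<in> carrier_vec d" and v: "v \<in> carrier_vec d" and w: "w \<in> carrier_vec d"
  shows "v \<bullet> (spectral_fun d u f *\<^sub>v w) = (\<Sum>i<d. f i * (u i \<bullet> v) * (u i \<bullet> w))"
proof -
  have "v \<bullet> (spectral_fun d u f *\<^sub>v w)
      = (\<Sum>a<d. \<Sum>b<d. \<Sum>i<d. v $ a * (f i * (u i $ a * u i $ b)) * w $ b)"
    using v w by (auto simp: scalar_prod_def spectral_fun_def lessThan_atLeast0 sum_distrib_left
      sum_distrib_right mult.assoc intro!: sum.cong)
  also have "\<dots> = (\<Sum>a<d. \<Sum>i<d. \<Sum>b<d. v $ a * (f i * (u i $ a * u i $ b)) * w $ b)"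
    by (intro sum.cong refl sum.swap)
  also have "\<dots> = (\<Sum>i<d. \<Sum>a<d. \<Sum>b<d. v $ a * (f i * (u i $ a * u i $ b)) * w $ b)"
    by (rule sum.swap)
  also have "\<dots> = (\<Sum>i<d. f i * (u i \<bullet> v) * (u i \<bullet> w))"
    using u v w by (auto simp: scalar_prod_def lessThan_atLeast0 sum_product sum_distrib_left
      mult_ac intro!: sum.cong)
  finally show ?thesis .
qed

lemma spectral_fun_coord:
  assumes u: "\<And>i. i < d \<Longrightarrow> u i \<in> carrier_vec d"
    and orth: "\<And>i j. i < d \<Longrightarrow> j < d \<Longrightarrow> u i \<bullet> u j = (if i = j then 1 else 0)"
    and w: "w \<in> carrier_vec d" and i: "i < d"
  shows "u i \<bullet> (spectral_fun d u f *\<^sub>v w) = f i * (u i \<bullet> w)"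
proof -
  have "u i \<bullet> (spectral_fun d u f *\<^sub>v w) = (\<Sum>j<d. f j * (u j \<bullet> u i) * (u j \<bullet> w))"
    by (rule spectral_fun_bilinear[OF u u[OF i] w])
  also have "\<dots> = (\<Sum>j<d. if j = i then f i * (u i \<bullet> w) else 0)"
    using i by (intro sum.cong) (auto simp: orth)
  also have "\<dots> = f i * (u i \<bullet> w)" using i by simp
  finally show ?thesis .
qed

lemma spectral_fun_mult:
  assumes u: "\<And>i. i < d \<Longrightarrow> u i \<in> carrier_vec d"
    and orth: "\<And>i j. i < d \<Longrightarrow> j < d \<Longrightarrow> u i \<bullet> u j = (if i = j then 1 else 0)"
  shows "spectral_fun d u f * spectral_fun d u g = spectral_fun d u (\<lambda>i. f i * g i)"
proof (rule mat_eq_bilinear[of _ d])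
  fix v w :: "real vec" assume v: "v \<in> carrier_vec d" and w: "w \<in> carrier_vec d"
  have c: "spectral_fun d u g *\<^sub>v w \<in> carrier_vec d" by (rule mult_mat_vec_carrier[OF spectral_fun_carrier w])
  have "v \<bullet> ((spectral_fun d u f * spectral_fun d u g) *\<^sub>v w)
      = v \<bullet> (spectral_fun d u f *\<^sub>v (spectral_fun d u g *\<^sub>v w))"
    using w by (subst assoc_mult_mat_vec[of _ d d _ d]) auto
  also have "\<dots> = (\<Sum>i<d. f i * (u i \<bullet> v) * (u i \<bullet> (spectral_fun d u g *\<^sub>v w)))"
    by (rule spectral_fun_bilinear[OF u v c])
  also have "\<dots> = (\<Sum>i<d. (f i * g i) * (u i \<bullet> v) * (u i \<bullet> w))"
    by (intro sum.cong) (auto simp: spectral_fun_coord[OF u orth w])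
  also have "\<dots> = v \<bullet> (spectral_fun d u (\<lambda>i. f i * g i) *\<^sub>v w)"
    by (rule spectral_fun_bilinear[OF u v w, symmetric])
  finally show "v \<bullet> ((spectral_fun d u f * spectral_fun d u g) *\<^sub>v w)
    = v \<bullet> (spectral_fun d u (\<lambda>i. f i * g i) *\<^sub>v w)" .
qed (auto intro: mult_carrier_mat[of _ d d])

lemma spectral_fun_one:
  assumes u: "\<And>i. i < d \<Longrightarrow> u i \<in> carrier_vec d"
    and orth: "\<And>i j. i < d \<Longrightarrow> j < d \<Longrightarrow> u i \<bullet> u j = (if i = j then 1 else 0)"
  shows "spectral_fun d u (\<lambda>i. 1) = 1\<^sub>m d"
proof (rule mat_eq_bilinear[of _ d])
  fix v w :: "real vec" assume v: "v \<in> carrier_vec d" and w: "w \<in> carrier_vec d"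
  show "v \<bullet> (spectral_fun d u (\<lambda>i. 1) *\<^sub>v w) = v \<bullet> (1\<^sub>m d *\<^sub>v w)"
    using spectral_fun_bilinear[OF u v w, where f = "\<lambda>i. 1"] parseval[OF u orth v w] w by simp
qed auto

lemma eigenbasis_coord:
  assumes e: "eigenbasis d A u lam" and sym: "transpose_mat A = A"
    and w: "w \<in> carrier_vec d" and i: "i < d"
  shows "u i \<bullet> (A *\<^sub>v w) = lam i * (u i \<bullet> w)"
  using symmetric_scalar_prod[OF eigenbasisD(1)[OF e] sym eigenbasisD(2)[OF e i] w]
    eigenbasisD(3)[OF e i] eigenbasisD(2)[OF e i] w by simp

lemma eigenbasis_bilinear:
  assumes e: "eigenbasis d A u lam" and sym: "transpose_mat A = A"
    and v: "v \<in> carrier_vec d" and w: "w \<in> carrier_vec d"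
  shows "v \<bullet> (A *\<^sub>v w) = (\<Sum>i<d. lam i * (u i \<bullet> v) * (u i \<bullet> w))"
proof -
  have "A *\<^sub>v w \<in> carrier_vec d" using eigenbasisD(1)[OF e] w by auto
  then have "v \<bullet> (A *\<^sub>v w) = (\<Sum>i<d. (u i \<bullet> v) * (u i \<bullet> (A *\<^sub>v w)))"
    by (rule eigenbasis_parseval[OF e v])
  then show ?thesis by (auto simp: eigenbasis_coord[OF e sym w] mult_ac intro!: sum.cong)
qed

lemma eigenbasis_spectral_fun:
  assumes e: "eigenbasis d A u lam" and sym: "transpose_mat A = A"
  shows "spectral_fun d u lam = A"
proof (rule mat_eq_bilinear[of _ d])
  show "A \<in> carrier_mat d d" by (rule eigenbasisD(1)[OF e])
  fix v w :: "real vec" assume v: "v \<in> carrier_vec d" and w: "w \<in> carrier_vec d"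
  show "v \<bullet> (spectral_fun d u lam *\<^sub>v w) = v \<bullet> (A *\<^sub>v w)"
    using spectral_fun_bilinear[OF eigenbasisD(2)[OF e] v w] eigenbasis_bilinear[OF e sym v w] by simp
qed simp

subsection \<open>Positive definite matrices\<close>

lemma psd_eigen_nonneg:
  assumes "psd A" and e: "eigenbasis d A u lam" and i: "i < d"
  shows "lam i \<ge> 0"
proof -
  have "u i \<in> carrier_vec (dim_row A)" using eigenbasisD(1,2)[OF e] i by auto
  then have "u i \<bullet> (A *\<^sub>v u i) \<ge> 0" using assms(1) unfolding psd_def by blast
  then show ?thesis using eigenbasisD(2-4)[OF e] i by simp
qed

lemma psd_square_root_exists:
  assumes psd: "psd A" and A: "A \<in> carrier_mat d d"
  shows "\<exists>B. psd B \<and> B \<in> carrier_mat d d \<and> B * B = A"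
proof -
  have sym: "transpose_mat A = A" using psd by (simp add: psd_def)
  obtain u lam where e: "eigenbasis d A u lam" using symmetric_eigenbasis[OF A sym] .
  define B where "B = spectral_fun d u (\<lambda>i. sqrt (lam i))"
  have "B * B = spectral_fun d u (\<lambda>i. sqrt (lam i) * sqrt (lam i))"
    unfolding B_def by (rule spectral_fun_mult[OF eigenbasisD(2)[OF e] eigenbasisD(4)[OF e]])
  also have "\<dots> = spectral_fun d u lam"
    using psd_eigen_nonneg[OF psd e] unfolding spectral_fun_def by (intro cong_mat) auto
  also have "\<dots> = A" by (rule eigenbasis_spectral_fun[OF e sym])
  finally have "B * B = A" .
  moreover have "psd B" unfolding psd_def
  proof (intro conjI ballI)
    fix v :: "real vec" assume "v \<in> carrier_vec (dim_row B)"
    then have v: "v \<in> carrier_vec d" by (simp add: B_def)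
    have "v \<bullet> (B *\<^sub>v v) = (\<Sum>i<d. sqrt (lam i) * (u i \<bullet> v) * (u i \<bullet> v))"
      unfolding B_def by (rule spectral_fun_bilinear[OF _ v v]) (rule eigenbasisD(2)[OF e])
    then show "v \<bullet> (B *\<^sub>v v) \<ge> 0"
      using psd_eigen_nonneg[OF psd e] by (auto simp: mult.assoc intro!: sum_nonneg)
  qed (auto simp: B_def)
  ultimately show ?thesis by (intro exI[of _ B]) (auto simp: B_def)
qed

text \<open>Let \<open>x\<close> be a unit eigenvector of \<open>B - C\<close> with eigenvalue
  \<open>lam\<close>. As \<open>B x\<close> and \<open>C x\<close> have equal length,
  \<open>(B x - C x) \<bullet> (B x + C x) = 0\<close>, so \<open>lam\<close> times the sum of the
  two forms at \<open>x\<close> vanishes. If \<open>lam\<close> is nonzero, both nonnegative forms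
  vanish at \<open>x\<close>, although their difference there is \<open>lam\<close>. Uniqueness
  gives the description operator in \<open>psd_sqrt\<close> a meaning.\<close>

lemma psd_square_root_unique:
  assumes B: "psd B" and C: "psd C" and BC: "B * B = C * C" and Bd: "B \<in> carrier_mat d d" and Cd: "C \<in> carrier_mat d d"
  shows "B = C"
proof -
  have sB: "transpose_mat B = B" and sC: "transpose_mat C = C" using B C by (auto simp: psd_def)
  define D where "D = B - C"
  have D: "D \<in> carrier_mat d d" using Bd Cd by (auto simp: D_def)
  have sD: "transpose_mat D = D" using Bd Cd sB sC by (simp add: D_def transpose_minus[of _ d d])
  obtain u lam where e: "eigenbasis d D u lam" using symmetric_eigenbasis[OF D sD] .
  have "lam i = 0" if i: "i < d" for i
  proof (rule ccontr)
    assume l: "lam i \<noteq> 0"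
    let ?x = "u i"
    have x: "?x \<in> carrier_vec d" using eigenbasisD(2)[OF e i] .
    have Bx: "B *\<^sub>v ?x \<in> carrier_vec d" and Cx: "C *\<^sub>v ?x \<in> carrier_vec d" using Bd Cd x by auto
    have Dx: "B *\<^sub>v ?x - C *\<^sub>v ?x = lam i \<cdot>\<^sub>v ?x"
      using eigenbasisD(3)[OF e i] minus_mult_distrib_mat_vec[OF Bd Cd x] by (simp add: D_def)
    have "(B *\<^sub>v ?x) \<bullet> (B *\<^sub>v ?x) = ?x \<bullet> ((B * B) *\<^sub>v ?x)"
      using symmetric_scalar_prod[OF Bd sB x Bx] assoc_mult_mat_vec[OF Bd Bd x] by simp
    moreover have "(C *\<^sub>v ?x) \<bullet> (C *\<^sub>v ?x) = ?x \<bullet> ((C * C) *\<^sub>v ?x)"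
      using symmetric_scalar_prod[OF Cd sC x Cx] assoc_mult_mat_vec[OF Cd Cd x] by simp
    ultimately have eq: "(B *\<^sub>v ?x) \<bullet> (B *\<^sub>v ?x) = (C *\<^sub>v ?x) \<bullet> (C *\<^sub>v ?x)" using BC by simp
    have "(B *\<^sub>v ?x - C *\<^sub>v ?x) \<bullet> (B *\<^sub>v ?x + C *\<^sub>v ?x) = 0"
      using eq Bx Cx comm_scalar_prod[OF Bx Cx]
      by (simp add: scalar_prod_add_distrib[of _ d] minus_scalar_prod_distrib[of _ d])
    then have "lam i * (?x \<bullet> (B *\<^sub>v ?x) + ?x \<bullet> (C *\<^sub>v ?x)) = 0"
      unfolding Dx using x Bx Cx by (simp add: scalar_prod_add_distrib[of _ d] distrib_left)
    moreover have p: "?x \<bullet> (B *\<^sub>v ?x) \<ge> 0" "?x \<bullet> (C *\<^sub>v ?x) \<ge> 0" using B C Bd Cd x by (auto simp: psd_def)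
    ultimately have "?x \<bullet> (B *\<^sub>v ?x) = 0" "?x \<bullet> (C *\<^sub>v ?x) = 0" using l by auto
    then have "?x \<bullet> (lam i \<cdot>\<^sub>v ?x) = 0"
      unfolding Dx[symmetric] using x Bx Cx by (simp add: scalar_prod_minus_distrib[of _ d])
    then show False using l x eigenbasisD(4)[OF e i i] by simp
  qed
  then have "D = 0\<^sub>m d d" unfolding eigenbasis_spectral_fun[OF e sD, symmetric]
    by (intro eq_matI) (auto simp: spectral_fun_def)
  then have "B $$ (i, j) - C $$ (i, j) = 0" if "i < d" "j < d" for i j
    using that Bd Cd by (metis D_def carrier_matD index_minus_mat(1) index_zero_mat(1))
  then show ?thesis using Bd Cd by (intro eq_matI) auto
qed

lemma psd_sqrt_props:
  assumes psd: "psd A" and A: "A \<in> carrier_mat d d"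
  shows "psd (psd_sqrt A)" "psd_sqrt A * psd_sqrt A = A" "psd_sqrt A \<in> carrier_mat d d"
proof -
  obtain B where B: "psd B" "B \<in> carrier_mat d d" "B * B = A" using psd_square_root_exists[OF assms] by blast
  have "C = B" if "psd C \<and> C * C = A" for C
  proof -
    \<comment> \<open>The definition of \<open>psd_sqrt\<close> does not fix the size of its
      candidates; it is recovered from \<open>C * C = A\<close>.\<close>
    have "dim_row C = d" using that A by (metis carrier_matD(1) index_mult_mat(2))
    moreover have "square_mat C" using that by (simp add: psd_def)
    ultimately have "C \<in> carrier_mat d d" by (metis carrier_matI square_mat.simps)
    then show ?thesis
      by (rule psd_square_root_unique[OF conjunct1[OF that] B(1)
        trans[OF conjunct2[OF that] B(3)[symmetric]] _ B(2)])
  qed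
  then have "psd_sqrt A = B" unfolding psd_sqrt_def using B by (intro the_equality) blast+
  then show "psd (psd_sqrt A)" "psd_sqrt A * psd_sqrt A = A" "psd_sqrt A \<in> carrier_mat d d"
    using B by simp_all
qed

lemma vnorm_psd_sqrt:
  assumes psd: "psd A" and A: "A \<in> carrier_mat d d" and v: "v \<in> carrier_vec d"
  shows "vnorm (psd_sqrt A *\<^sub>v v) = sqrt (v \<bullet> (A *\<^sub>v v))"
proof -
  note p = psd_sqrt_props[OF psd A]
  have s: "transpose_mat (psd_sqrt A) = psd_sqrt A" using p(1) by (simp add: psd_def)
  have "psd_sqrt A *\<^sub>v v \<in> carrier_vec d" using p(3) v by auto
  then have "(psd_sqrt A *\<^sub>v v) \<bullet> (psd_sqrt A *\<^sub>v v) = v \<bullet> (A *\<^sub>v v)"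
    using symmetric_scalar_prod[OF p(3) s v] assoc_mult_mat_vec[OF p(3) p(3) v] p(2) by simp
  then show ?thesis by (simp add: vnorm_def)
qed

text \<open>\<open>B\<close> and \<open>T\<close> are the powers 1/2 and -1/2 of \<open>H\<close>,
  taken in a common eigenbasis. The last equation exhibits \<open>T * T\<close> as the inverse of
  \<open>H\<close>, which is how the pseudoinverse in the ridge leverage scores is computed.\<close>

lemma whitening_exists:
  fixes H :: "real mat"
  assumes H: "H \<in> carrier_mat d d" and sym: "transpose_mat H = H"
    and pd: "\<And>v. v \<in> carrier_vec d \<Longrightarrow> v \<bullet> v > 0 \<Longrightarrow> v \<bullet> (H *\<^sub>v v) > 0"
  obtains T B where "T \<in> carrier_mat d d" "B \<in> carrier_mat d d" "transpose_mat T = T"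
    "transpose_mat B = B" "T * B = 1\<^sub>m d" "B * B = H" "H * (T * T) = 1\<^sub>m d"
proof -
  obtain u lam where e: "eigenbasis d H u lam" using symmetric_eigenbasis[OF H sym] .
  have mult: "spectral_fun d u f * spectral_fun d u g = spectral_fun d u (\<lambda>i. f i * g i)" for f g
    by (rule spectral_fun_mult) (use eigenbasisD[OF e] in auto)
  have one: "1\<^sub>m d = spectral_fun d u (\<lambda>i. 1)"
    by (rule spectral_fun_one[symmetric]) (use eigenbasisD[OF e] in auto)
  have pos: "lam i > 0" if i: "i < d" for i
    using pd[OF eigenbasisD(2)[OF e i]] eigenbasisD(2-4)[OF e] i by simp
  let ?T = "spectral_fun d u (\<lambda>i. 1 / sqrt (lam i))" and ?B = "spectral_fun d u (\<lambda>i. sqrt (lam i))"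
  have cong: "spectral_fun d u f = spectral_fun d u g" if "\<And>i. i < d \<Longrightarrow> f i = g i" for f g
    using that unfolding spectral_fun_def by (intro cong_mat) auto
  show ?thesis
  proof (rule that[of ?T ?B])
    show "?T * ?B = 1\<^sub>m d" unfolding mult one using pos by (intro cong) (simp add: less_imp_neq[symmetric])
    show "?B * ?B = H" unfolding mult eigenbasis_spectral_fun[OF e sym, symmetric] using pos
      by (intro cong) (simp add: less_imp_le)
    have "H * (?T * ?T) = spectral_fun d u lam * spectral_fun d u (\<lambda>i. 1 / sqrt (lam i) * (1 / sqrt (lam i)))"
      by (simp only: mult eigenbasis_spectral_fun[OF e sym])
    also have "\<dots> = 1\<^sub>m d" unfolding mult one using pos
      by (intro cong) (simp add: less_imp_le less_imp_neq[symmetric])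
    finally show "H * (?T * ?T) = 1\<^sub>m d" .
  qed auto
qed

subsection \<open>Extremal singular values\<close>

text \<open>The eigenvalues of \<open>A^T A\<close> are roots of a nonzero characteristic
  polynomial. Finiteness is what \<open>Max\<close> and \<open>Min\<close> in
  \<open>sigma_max\<close> and \<open>sigma_min\<close> rely on.\<close>

lemma singular_values_finite:
  assumes "A \<in> carrier_mat d d" "d > 0"
  shows "finite (singular_values A)"
proof -
  have C: "transpose_mat A * A \<in> carrier_mat d d" using assms by auto
  have "char_poly (transpose_mat A * A) \<noteq> 0" using degree_monic_char_poly[OF C] by auto
  then have "finite {k. poly (char_poly (transpose_mat A * A)) k = 0}" by (rule poly_roots_finite)
  then show ?thesis unfolding singular_values_def eigenvalue_root_char_poly[OF C] by auto
qed

lemma symmetric_singular_value: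
  assumes A: "A \<in> carrier_mat d d" and sym: "transpose_mat A = A" and e: "eigenbasis d A u lam" and i: "i < d"
  shows "\<bar>lam i\<bar> \<in> singular_values A"
proof -
  have u: "u i \<in> carrier_vec d" "u i \<noteq> 0\<^sub>v d" using eigenbasisD(2,4)[OF e i] eigenbasisD(4)[OF e i i] by auto
  have "(transpose_mat A * A) *\<^sub>v u i = (lam i * lam i) \<cdot>\<^sub>v u i"
    using A sym u assoc_mult_mat_vec[OF A A u(1)] eigenbasisD(3)[OF e i]
    by (simp add: mult_mat_vec[OF A u(1)] smult_smult_assoc)
  then have "eigenvalue (transpose_mat A * A) (lam i * lam i)"
    using u A unfolding eigenvalue_def eigenvector_def by (intro exI[of _ "u i"]) auto
  then have "sqrt (lam i * lam i) \<in> singular_values A" unfolding singular_values_def by blast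
  then show ?thesis by simp
qed

lemma symmetric_sigma_bounds:
  assumes A: "A \<in> carrier_mat d d" and sym: "transpose_mat A = A" and e: "eigenbasis d A u lam"
    and i: "i < d"
  shows "sigma_min A \<le> \<bar>lam i\<bar>" "\<bar>lam i\<bar> \<le> sigma_max A"
  using symmetric_singular_value[OF A sym e i] singular_values_finite[OF A] i
  unfolding sigma_min_def sigma_max_def by auto

lemma Cauchy_Schwarz_scalar_prod:
  fixes v w :: "real vec"
  assumes "v \<in> carrier_vec d" "w \<in> carrier_vec d"
  shows "\<bar>v \<bullet> w\<bar> \<le> vnorm v * vnorm w"
proof -
  have "(\<Sum>i<d. v $ i * w $ i)\<^sup>2 \<le> (\<Sum>i<d. (v $ i)\<^sup>2) * (\<Sum>i<d. (w $ i)\<^sup>2)"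
    by (rule Cauchy_Schwarz_ineq_sum)
  then have "(v \<bullet> w)\<^sup>2 \<le> (v \<bullet> v) * (w \<bullet> w)"
    using assms by (simp add: scalar_prod_def lessThan_atLeast0 power2_eq_square)
  then have "sqrt ((v \<bullet> w)\<^sup>2) \<le> sqrt ((v \<bullet> v) * (w \<bullet> w))" by (rule real_sqrt_le_mono)
  then show ?thesis by (simp add: vnorm_def real_sqrt_mult)
qed

lemma bilinear_bound_eigenvalues:
  assumes sym: "transpose_mat A = A" and e: "eigenbasis d A u lam"
    and b: "\<And>i. i < d \<Longrightarrow> \<bar>lam i\<bar> \<le> b"
    and v: "v \<in> carrier_vec d" and w: "w \<in> carrier_vec d" and b0: "b \<ge> 0"
  shows "\<bar>v \<bullet> (A *\<^sub>v w)\<bar> \<le> b * (vnorm v * vnorm w)"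
proof -
  have "\<bar>v \<bullet> (A *\<^sub>v w)\<bar> \<le> (\<Sum>i<d. \<bar>lam i * (u i \<bullet> v) * (u i \<bullet> w)\<bar>)"
    unfolding eigenbasis_bilinear[OF e sym v w] by (rule sum_abs)
  also have "\<dots> \<le> (\<Sum>i<d. b * (\<bar>u i \<bullet> v\<bar> * \<bar>u i \<bullet> w\<bar>))"
    by (intro sum_mono) (auto simp: abs_mult mult.assoc intro!: mult_right_mono b)
  also have "\<dots> = b * (\<Sum>i<d. \<bar>u i \<bullet> v\<bar> * \<bar>u i \<bullet> w\<bar>)" by (simp add: sum_distrib_left)
  also have "\<dots> \<le> b * (vnorm v * vnorm w)"
  proof (rule mult_left_mono[OF _ b0])
    have "(\<Sum>i<d. \<bar>u i \<bullet> v\<bar> * \<bar>u i \<bullet> w\<bar>)\<^sup>2 \<le> (\<Sum>i<d. \<bar>u i \<bullet> v\<bar>\<^sup>2) * (\<Sum>i<d. \<bar>u i \<bullet> w\<bar>\<^sup>2)"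
      by (rule Cauchy_Schwarz_ineq_sum)
    also have "\<dots> = (v \<bullet> v) * (w \<bullet> w)"
      by (simp add: eigenbasis_parseval[OF e v v] eigenbasis_parseval[OF e w w] power2_eq_square)
    finally have "sqrt ((\<Sum>i<d. \<bar>u i \<bullet> v\<bar> * \<bar>u i \<bullet> w\<bar>)\<^sup>2) \<le> sqrt ((v \<bullet> v) * (w \<bullet> w))"
      by (rule real_sqrt_le_mono)
    then show "(\<Sum>i<d. \<bar>u i \<bullet> v\<bar> * \<bar>u i \<bullet> w\<bar>) \<le> vnorm v * vnorm w"
      by (simp add: vnorm_def real_sqrt_mult)
  qed
  finally show ?thesis .
qed

lemma spectral_norm_bilinear:
  assumes A: "A \<in> carrier_mat d d" and sym: "transpose_mat A = A"
    and v: "v \<in> carrier_vec d" and w: "w \<in> carrier_vec d" and d: "d > 0"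
  shows "\<bar>v \<bullet> (A *\<^sub>v w)\<bar> \<le> spectral_norm A * (vnorm v * vnorm w)"
proof -
  obtain u lam where e: "eigenbasis d A u lam" using symmetric_eigenbasis[OF A sym] .
  show ?thesis
    using symmetric_sigma_bounds(2)[OF A sym e] symmetric_sigma_bounds(2)[OF A sym e d]
    unfolding spectral_norm_def
    by (intro bilinear_bound_eigenvalues[OF sym e _ v w]) auto
qed

lemma psd_sigma_bounds:
  assumes A: "A \<in> carrier_mat d d" and psd: "psd A" and v: "v \<in> carrier_vec d"
  shows "sigma_min A * (v \<bullet> v) \<le> v \<bullet> (A *\<^sub>v v)" "v \<bullet> (A *\<^sub>v v) \<le> sigma_max A * (v \<bullet> v)"
proof -
  have sym: "transpose_mat A = A" using psd by (simp add: psd_def)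
  obtain u lam where e: "eigenbasis d A u lam" using symmetric_eigenbasis[OF A sym] .
  note b = symmetric_sigma_bounds[OF A sym e]
  note nn = psd_eigen_nonneg[OF psd e]
  show "sigma_min A * (v \<bullet> v) \<le> v \<bullet> (A *\<^sub>v v)" "v \<bullet> (A *\<^sub>v v) \<le> sigma_max A * (v \<bullet> v)"
    unfolding eigenbasis_bilinear[OF e sym v v] eigenbasis_parseval[OF e v v] sum_distrib_left
    using b nn by (auto simp: mult.assoc intro!: sum_mono mult_right_mono)
qed

text \<open>The minimum is attained by some eigenpair \<open>k\<close>, \<open>v\<close> of
  \<open>A^T A\<close>, and \<open>k * (v \<bullet> v)\<close> is the squared length of
  \<open>A v\<close>. This is positive, since \<open>A v = 0\<close> would contradict the lower
  bound on the quadratic form.\<close>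

lemma sigma_min_pos:
  assumes A: "A \<in> carrier_mat d d" and sym: "transpose_mat A = A" and d: "d > 0" and g: "g > 0"
    and pd: "\<And>v. v \<in> carrier_vec d \<Longrightarrow> g * (v \<bullet> v) \<le> v \<bullet> (A *\<^sub>v v)"
  shows "sigma_min A > 0"
proof -
  obtain u lam where e: "eigenbasis d A u lam" using symmetric_eigenbasis[OF A sym] .
  have ne: "singular_values A \<noteq> {}" using symmetric_singular_value[OF A sym e d] by blast
  have "sigma_min A \<in> singular_values A"
    unfolding sigma_min_def by (rule Min_in[OF singular_values_finite[OF A d] ne])
  then obtain k v where k: "sigma_min A = sqrt k" and ev: "eigenvector (transpose_mat A * A) v k"
    unfolding singular_values_def eigenvalue_def by auto
  have v: "v \<in> carrier_vec d" "v \<noteq> 0\<^sub>v d" "(A * A) *\<^sub>v v = k \<cdot>\<^sub>v v"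
    using ev A sym unfolding eigenvector_def by auto
  have Av: "A *\<^sub>v v \<in> carrier_vec d" using A v by auto
  have vv: "v \<bullet> v > 0" using scalar_prod_self_ge_0[of v] scalar_prod_self_eq_0[of v d] v by fastforce
  have "A *\<^sub>v (A *\<^sub>v v) = k \<cdot>\<^sub>v v" using assoc_mult_mat_vec[OF A A v(1)] v(3) by simp
  then have "(A *\<^sub>v v) \<bullet> (A *\<^sub>v v) = k * (v \<bullet> v)"
    using symmetric_scalar_prod[OF A sym v(1) Av] v(1) by simp
  moreover have "A *\<^sub>v v \<noteq> 0\<^sub>v d"
  proof
    assume "A *\<^sub>v v = 0\<^sub>v d"
    then have "g * (v \<bullet> v) \<le> 0" using pd[OF v(1)] v by simp
    then show False using g vv by (simp add: mult_le_0_iff)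
  qed
  then have "(A *\<^sub>v v) \<bullet> (A *\<^sub>v v) > 0"
    using scalar_prod_self_ge_0[of "A *\<^sub>v v"] scalar_prod_self_eq_0[OF Av] by fastforce
  ultimately have "k * (v \<bullet> v) > 0" by simp
  then have "k > 0" using vv by (simp add: zero_less_mult_iff)
  then show ?thesis by (simp add: k)
qed

text \<open>The definition by description calls for uniqueness: multiplying the Penrose equation
  \<open>A * Y * A = A\<close> by \<open>X\<close> on the right gives \<open>A * Y = 1\<close>, so
  \<open>Y\<close> is the inverse \<open>X\<close>.\<close>

lemma pinv_eq:
  assumes A: "A \<in> carrier_mat d d" and X: "X \<in> carrier_mat d d" and AX: "A * X = 1\<^sub>m d"
  shows "pinv A = X"
proof -
  have XA: "X * A = 1\<^sub>m d" using mat_mult_left_right_inverse[OF A X AX] .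
  have "is_pinv A X" using A X AX XA by (auto simp: is_pinv_def)
  moreover have "Y = X" if "is_pinv A Y" for Y
  proof -
    have Y: "Y \<in> carrier_mat d d" and eq: "A * Y * A = A" using that A by (auto simp: is_pinv_def)
    have AY: "A * Y \<in> carrier_mat d d" using A Y by auto
    have "A * Y = A * Y * (A * X)" by (simp only: AX right_mult_one_mat[OF AY])
    also have "\<dots> = A * Y * A * X" by (rule assoc_mult_mat[OF AY A X, symmetric])
    also have "\<dots> = 1\<^sub>m d" by (simp only: eq AX)
    finally have AY1: "A * Y = 1\<^sub>m d" .
    have "Y = (X * A) * Y" using Y XA by simp
    also have "\<dots> = X * (A * Y)" by (rule assoc_mult_mat[OF X A Y])
    also have "\<dots> = X" using X by (simp add: AY1)
    finally show ?thesis .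
  qed
  ultimately show ?thesis unfolding pinv_def by (rule the_equality)
qed

subsection \<open>Traces of powers\<close>

definition tr :: "real mat \<Rightarrow> real" where
  "tr A = (\<Sum>i<dim_row A. A $$ (i, i))"

lemma tr_add: "A \<in> carrier_mat d d \<Longrightarrow> B \<in> carrier_mat d d \<Longrightarrow> tr (A + B) = tr A + tr B"
  by (auto simp: tr_def sum.distrib[symmetric] intro!: sum.cong)

lemma tr_minus: "A \<in> carrier_mat d d \<Longrightarrow> B \<in> carrier_mat d d \<Longrightarrow> tr (A - B) = tr A - tr B"
  by (auto simp: tr_def sum_subtractf[symmetric] intro!: sum.cong)

lemma tr_smult: "A \<in> carrier_mat d d \<Longrightarrow> tr (c \<cdot>\<^sub>m A) = c * tr A"
  by (auto simp: tr_def sum_distrib_left intro!: sum.cong)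

lemma tr_mult:
  "A \<in> carrier_mat d d \<Longrightarrow> B \<in> carrier_mat d d \<Longrightarrow> tr (A * B) = (\<Sum>i<d. \<Sum>j<d. A $$ (i, j) * B $$ (j, i))"
  by (auto simp: tr_def scalar_prod_def lessThan_atLeast0 intro!: sum.cong)

lemma tr_mult_comm:
  assumes "A \<in> carrier_mat d d" "B \<in> carrier_mat d d"
  shows "tr (A * B) = tr (B * A)"
  unfolding tr_mult[OF assms] tr_mult[OF assms(2,1)] by (subst sum.swap) (simp add: mult.commute)

lemma tr_eigenbasis:
  assumes e: "eigenbasis d X u lam" and A: "A \<in> carrier_mat d d"
  shows "tr A = (\<Sum>i<d. u i \<bullet> (A *\<^sub>v u i))"
proof -
  have one: "spectral_fun d u (\<lambda>i. 1) = 1\<^sub>m d"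
    by (rule spectral_fun_one) (use eigenbasisD[OF e] in auto)
  have delta: "(\<Sum>i<d. u i $ a * u i $ b) = (if a = b then 1 else 0)" if "a < d" "b < d" for a b
    using arg_cong[OF one, of "\<lambda>M. M $$ (a, b)"] that by (simp add: spectral_fun_def)
  have "(\<Sum>i<d. u i \<bullet> (A *\<^sub>v u i)) = (\<Sum>i<d. \<Sum>a<d. \<Sum>b<d. A $$ (a, b) * (u i $ a * u i $ b))"
    using A carrier_vecD[OF eigenbasisD(2)[OF e]]
    by (auto simp: scalar_prod_def lessThan_atLeast0 sum_distrib_left mult_ac intro!: sum.cong)
  also have "\<dots> = (\<Sum>a<d. \<Sum>i<d. \<Sum>b<d. A $$ (a, b) * (u i $ a * u i $ b))" by (rule sum.swap)
  also have "\<dots> = (\<Sum>a<d. \<Sum>b<d. \<Sum>i<d. A $$ (a, b) * (u i $ a * u i $ b))"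
    by (intro sum.cong refl sum.swap)
  also have "\<dots> = (\<Sum>a<d. \<Sum>b<d. A $$ (a, b) * (if a = b then 1 else 0))"
    by (intro sum.cong refl) (simp only: sum_distrib_left[symmetric] delta lessThan_iff)
  also have "\<dots> = tr A" using A by (simp add: tr_def if_distrib sum.delta cong: if_cong)
  finally show ?thesis by simp
qed

text \<open>Two symmetric matrices that do not commute have no common eigenbasis. Using the
  eigenvectors of one on the left and of the other on the right still turns powers of both into
  scalars.\<close>

lemma tr_mult_mixed_bases:
  assumes e: "eigenbasis d W u w" and f: "eigenbasis d Y v y"
    and A: "A \<in> carrier_mat d d" and B: "B \<in> carrier_mat d d" and sym: "transpose_mat A = A"
  shows "tr (A * B) = (\<Sum>j<d. \<Sum>i<d. (u i \<bullet> (A *\<^sub>v v j)) * (u i \<bullet> (B *\<^sub>v v j)))"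
proof -
  have AB: "A * B \<in> carrier_mat d d" using A B by auto
  have "tr (A * B) = (\<Sum>j<d. v j \<bullet> ((A * B) *\<^sub>v v j))" by (rule tr_eigenbasis[OF f AB])
  also have "\<dots> = (\<Sum>j<d. \<Sum>i<d. (u i \<bullet> (A *\<^sub>v v j)) * (u i \<bullet> (B *\<^sub>v v j)))"
  proof (rule sum.cong[OF refl])
    fix j assume "j \<in> {..<d}"
    then have vj: "v j \<in> carrier_vec d" using eigenbasisD(2)[OF f] by simp
    have Av: "A *\<^sub>v v j \<in> carrier_vec d" and Bv: "B *\<^sub>v v j \<in> carrier_vec d" using A B vj by auto
    have "v j \<bullet> ((A * B) *\<^sub>v v j) = (A *\<^sub>v v j) \<bullet> (B *\<^sub>v v j)"
      using assoc_mult_mat_vec[OF A B vj] symmetric_scalar_prod[OF A sym vj Bv] by simp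
    then show "v j \<bullet> ((A * B) *\<^sub>v v j) = (\<Sum>i<d. (u i \<bullet> (A *\<^sub>v v j)) * (u i \<bullet> (B *\<^sub>v v j)))"
      using eigenbasis_parseval[OF e Av Bv] by simp
  qed
  finally show ?thesis .
qed

section \<open>Powers of symmetric matrices and a mean value inequality for traces\<close>

lemma transpose_pow_mat:
  assumes "A \<in> carrier_mat d d" "transpose_mat A = (A :: real mat)"
  shows "transpose_mat (A ^\<^sub>m k) = A ^\<^sub>m k"
proof (induction k)
  case 0
  then show ?case by simp
next
  case (Suc k)
  have "A ^\<^sub>m k * A = A * A ^\<^sub>m k"
  proof (induction k)
    case 0
    then show ?case using assms by simp
  next
    case (Suc k)
    then show ?case using assms(1)
      by (simp add: assoc_mult_mat[of _ d d _ d _ d])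
  qed
  then show ?case using Suc assms by (simp add: transpose_mult[of _ d d _ d])
qed

lemma pow_mat_add:
  assumes "(A :: real mat) \<in> carrier_mat d d"
  shows "A ^\<^sub>m (k + l) = A ^\<^sub>m k * A ^\<^sub>m l"
proof (induction l)
  case 0
  then show ?case using assms by (simp add: right_mult_one_mat[of _ d d])
next
  case (Suc l)
  then show ?case using assms by (simp add: assoc_mult_mat[of _ d d _ d _ d])
qed

lemma eigenbasis_pow:
  assumes e: "eigenbasis d A u lam"
  shows "eigenbasis d (A ^\<^sub>m k) u (\<lambda>i. lam i ^ k)"
proof -
  have "(A ^\<^sub>m k) *\<^sub>v u i = lam i ^ k \<cdot>\<^sub>v u i" if i: "i < d" for i
  proof (induction k)
    case 0
    then show ?case using eigenbasisD[OF e] i by simp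
  next
    case (Suc k)
    have "(A ^\<^sub>m Suc k) *\<^sub>v u i = A ^\<^sub>m k *\<^sub>v (lam i \<cdot>\<^sub>v u i)"
      using eigenbasisD[OF e] i by (simp add: assoc_mult_mat_vec[of _ d d _ d])
    then show ?case using Suc eigenbasisD[OF e] i
      by (simp add: mult_mat_vec[of _ d d] smult_smult_assoc)
  qed
  then show ?thesis using eigenbasisD[OF e] unfolding eigenbasis_def by auto
qed

lemma tr_pow:
  assumes e: "eigenbasis d A u lam"
  shows "tr (A ^\<^sub>m k) = (\<Sum>i<d. lam i ^ k)"
  using tr_eigenbasis[OF e eigenbasisD(1)[OF eigenbasis_pow[OF e]]]
    eigenbasisD[OF eigenbasis_pow[OF e, of k]] by simp

text \<open>The sum is the difference quotient of the power \<open>Suc m\<close>. Pairing index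
  \<open>i\<close> with \<open>m - i\<close> reduces the claim to
  \<open>(a ^ i - b ^ i) * (a ^ (m - i) - b ^ (m - i)) \<ge> 0\<close> for the absolute values;
  evenness of \<open>m\<close> allows the return from these to \<open>x\<close> and
  \<open>y\<close>.\<close>

lemma power_mean_sum_le:
  fixes x y :: real
  assumes m: "even m"
  shows "(\<Sum>i<Suc m. y ^ (m - i) * x ^ i) \<le> real (Suc m) / 2 * (x ^ m + y ^ m)"
proof -
  have pt: "y ^ (m - i) * x ^ i + y ^ i * x ^ (m - i) \<le> x ^ m + y ^ m" if i: "i \<le> m" for i
  proof -
    define a b where "a = \<bar>x\<bar>" and "b = \<bar>y\<bar>"
    have ab: "a \<ge> 0" "b \<ge> 0" by (auto simp: a_def b_def)
    have "(a ^ i - b ^ i) * (a ^ (m - i) - b ^ (m - i)) \<ge> 0"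
    proof (cases "a \<le> b")
      case True
      then show ?thesis using ab by (intro mult_nonpos_nonpos) (auto intro: power_mono)
    next
      case False
      then show ?thesis using ab by (intro mult_nonneg_nonneg) (auto intro: power_mono)
    qed
    moreover have "a ^ i * a ^ (m - i) = a ^ m" "b ^ i * b ^ (m - i) = b ^ m"
      using i by (simp_all add: power_add[symmetric])
    moreover have "a ^ m = x ^ m" "b ^ m = y ^ m" using m by (auto simp: a_def b_def power_even_abs)
    ultimately have "b ^ (m - i) * a ^ i + b ^ i * a ^ (m - i) \<le> x ^ m + y ^ m"
      by (simp add: algebra_simps)
    moreover have "y ^ (m - i) * x ^ i \<le> b ^ (m - i) * a ^ i" "y ^ i * x ^ (m - i) \<le> b ^ i * a ^ (m - i)"
      unfolding a_def b_def power_abs[symmetric] abs_mult[symmetric] by (rule abs_ge_self)+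
    ultimately show ?thesis by linarith
  qed
  have "(\<Sum>i<Suc m. y ^ (m - i) * x ^ i) = (\<Sum>i<Suc m. y ^ i * x ^ (m - i))"
    by (subst sum.nat_diff_reindex[symmetric]) (auto intro!: sum.cong)
  then have "2 * (\<Sum>i<Suc m. y ^ (m - i) * x ^ i)
      = (\<Sum>i<Suc m. y ^ (m - i) * x ^ i + y ^ i * x ^ (m - i))"
    by (simp add: sum.distrib del: sum.lessThan_Suc)
  also have "\<dots> \<le> (\<Sum>i<Suc m. x ^ m + y ^ m)"
    using pt by (intro sum_mono) auto
  also have "\<dots> = real (Suc m) * (x ^ m + y ^ m)" by (simp add: algebra_simps)
  finally show ?thesis by simp
qed

lemma power_mean_value_ineq:
  fixes x y :: real
  assumes m: "even m"
  shows "(x - y) * (x ^ Suc m - y ^ Suc m) \<le> real (Suc m) / 2 * ((x - y)\<^sup>2 * (x ^ m + y ^ m))"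
proof -
  have "x ^ Suc m - y ^ Suc m = (x - y) * (\<Sum>i<Suc m. y ^ (m - i) * x ^ i)"
    using power_diff_sumr2[of x "Suc m" y] by simp
  then have "(x - y) * (x ^ Suc m - y ^ Suc m) = (x - y)\<^sup>2 * (\<Sum>i<Suc m. y ^ (m - i) * x ^ i)"
    by (simp add: power2_eq_square mult.assoc del: sum.lessThan_Suc)
  also have "\<dots> \<le> (x - y)\<^sup>2 * (real (Suc m) / 2 * (x ^ m + y ^ m))"
    by (intro mult_left_mono power_mean_sum_le m) simp
  finally show ?thesis by (simp only: mult.left_commute)
qed

text \<open>Between an eigenvector \<open>u i\<close> of \<open>W\<close> and an eigenvector
  \<open>v j\<close> of \<open>Y\<close>, the matrix element of
  \<open>W ^\<^sub>m k - Y ^\<^sub>m k\<close> is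
  \<open>(w i ^ k - y j ^ k) * (u i \<bullet> v j)\<close>. Both sides therefore become sums of the
  scalar inequality with weights \<open>(u i \<bullet> v j)\<^sup>2\<close>.\<close>

lemma trace_mean_value_ineq:
  assumes W: "W \<in> carrier_mat d d" "transpose_mat W = W"
    and Y: "Y \<in> carrier_mat d d" "transpose_mat Y = Y" and m: "even m"
  shows "tr ((W - Y) * (W ^\<^sub>m Suc m - Y ^\<^sub>m Suc m))
    \<le> real (Suc m) / 2 * (tr ((W - Y) * (W - Y) * W ^\<^sub>m m) + tr ((W - Y) * (W - Y) * Y ^\<^sub>m m))"
proof -
  define D where "D = W - Y"
  have D: "D \<in> carrier_mat d d" using W Y by (auto simp: D_def)
  have sD: "transpose_mat D = D" using W Y by (simp add: D_def transpose_minus[of _ d d])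
  obtain u w where e: "eigenbasis d W u w" using symmetric_eigenbasis[OF W] .
  obtain v y where f: "eigenbasis d Y v y" using symmetric_eigenbasis[OF Y] .
  note e' = eigenbasis_pow[OF e] and f' = eigenbasis_pow[OF f]
  have ss: "transpose_mat (W ^\<^sub>m k) = W ^\<^sub>m k" for k by (rule transpose_pow_mat[OF W])
  have c: "W ^\<^sub>m k \<in> carrier_mat d d" "Y ^\<^sub>m k \<in> carrier_mat d d" for k using W Y by auto
  have diff: "u i \<bullet> ((W ^\<^sub>m k - Y ^\<^sub>m k) *\<^sub>v v j) = (w i ^ k - y j ^ k) * (u i \<bullet> v j)"
    if "i < d" "j < d" for i j k
    using that eigenbasisD(3)[OF f'[of k], of j] eigenbasisD(2)[OF f, of j] eigenbasisD(2)[OF e, of i]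
      eigenbasis_coord[OF e'[of k] ss, of "v j" i] mult_mat_vec_carrier[OF c(1), of "v j" k]
    by (simp add: minus_mult_distrib_mat_vec[OF c] scalar_prod_minus_distrib[of _ d] algebra_simps)
  have d1: "u i \<bullet> (D *\<^sub>v v j) = (w i - y j) * (u i \<bullet> v j)" if "i < d" "j < d" for i j
    using diff[OF that, of 1] W Y by (simp add: D_def)
  have dW: "u i \<bullet> ((W ^\<^sub>m m * D) *\<^sub>v v j) = w i ^ m * ((w i - y j) * (u i \<bullet> v j))"
    if "i < d" "j < d" for i j
  proof -
    have vj: "v j \<in> carrier_vec d" using eigenbasisD(2)[OF f that(2)] .
    show ?thesis using eigenbasis_coord[OF e'[of m] ss mult_mat_vec_carrier[OF D vj] that(1)]
        assoc_mult_mat_vec[OF c(1) D vj] d1[OF that] by simp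
  qed
  have dY: "u i \<bullet> ((D * Y ^\<^sub>m m) *\<^sub>v v j) = y j ^ m * ((w i - y j) * (u i \<bullet> v j))"
    if "i < d" "j < d" for i j
  proof -
    have vj: "v j \<in> carrier_vec d" using eigenbasisD(2)[OF f that(2)] .
    show ?thesis using eigenbasisD(3)[OF f'[of m] that(2)] mult_mat_vec_carrier[OF D vj]
        assoc_mult_mat_vec[OF D c(2) vj] mult_mat_vec[OF D vj] d1[OF that] eigenbasisD(2)[OF e that(1)] by simp
  qed
  \<comment> \<open>Cyclicity puts \<open>W ^\<^sub>m m\<close> at the left end of the second
    factor, where it meets its own eigenvectors \<open>u i\<close>; \<open>Y ^\<^sub>m m\<close>
    already stands at the right end, next to \<open>v j\<close>.\<close>
  have tW: "tr (D * D * W ^\<^sub>m m) = tr (D * (W ^\<^sub>m m * D))"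
    using D c tr_mult_comm[of "D * W ^\<^sub>m m" d D] by (simp add: assoc_mult_mat[of _ d d _ d _ d])
  have tY: "tr (D * D * Y ^\<^sub>m m) = tr (D * (D * Y ^\<^sub>m m))"
    using D c by (simp add: assoc_mult_mat[of _ d d _ d _ d])
  have "tr (D * (W ^\<^sub>m Suc m - Y ^\<^sub>m Suc m))
     = (\<Sum>j<d. \<Sum>i<d. (u i \<bullet> (D *\<^sub>v v j)) * (u i \<bullet> ((W ^\<^sub>m Suc m - Y ^\<^sub>m Suc m) *\<^sub>v v j)))"
    by (rule tr_mult_mixed_bases[OF e f D _ sD], rule minus_carrier_mat) (rule c)
  also have "\<dots> = (\<Sum>j<d. \<Sum>i<d. (u i \<bullet> v j)\<^sup>2 * ((w i - y j) * (w i ^ Suc m - y j ^ Suc m)))"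
    by (intro sum.cong refl) (simp add: d1 diff power2_eq_square del: pow_mat.simps power_Suc)
  also have "\<dots> \<le> (\<Sum>j<d. \<Sum>i<d. (u i \<bullet> v j)\<^sup>2 *
      (real (Suc m) / 2 * ((w i - y j)\<^sup>2 * (w i ^ m + y j ^ m))))"
    by (intro sum_mono mult_left_mono power_mean_value_ineq m) simp
  also have "\<dots> = real (Suc m) / 2 *
      ((\<Sum>j<d. \<Sum>i<d. (u i \<bullet> (D *\<^sub>v v j)) * (u i \<bullet> ((W ^\<^sub>m m * D) *\<^sub>v v j)))
      + (\<Sum>j<d. \<Sum>i<d. (u i \<bullet> (D *\<^sub>v v j)) * (u i \<bullet> ((D * Y ^\<^sub>m m) *\<^sub>v v j))))"
    unfolding sum.distrib[symmetric] sum_distrib_left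
    by (intro sum.cong refl) (simp add: d1 dW dY power2_eq_square algebra_simps del: of_nat_Suc)
  also have "\<dots> = real (Suc m) / 2 * (tr (D * (W ^\<^sub>m m * D)) + tr (D * (D * Y ^\<^sub>m m)))"
    using D c by (subst (1 2) tr_mult_mixed_bases[OF e f D _ sD]) (auto intro: mult_carrier_mat[of _ d d])
  finally show ?thesis unfolding tW[symmetric] tY[symmetric] unfolding D_def .
qed

lemma tr_mult_square:
  assumes N: "N \<in> carrier_mat d d" and B: "B \<in> carrier_mat d d" "transpose_mat B = B"
  shows "tr (N * (B * B)) = (\<Sum>j<d. col B j \<bullet> (N *\<^sub>v col B j))"
proof -
  have "tr (N * (B * B)) = tr (B * (N * B))"
    using N B tr_mult_comm[of "N * B" d B] by (simp add: assoc_mult_mat[of _ d d _ d _ d])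
  also have "\<dots> = (\<Sum>j<d. col B j \<bullet> (N *\<^sub>v col B j))"
  proof -
    have "(B * (N * B)) $$ (j, j) = col B j \<bullet> (N *\<^sub>v col B j)" if "j < d" for j
    proof -
      have "row B j = col B j" using B that by (metis carrier_matD(2) row_transpose)
      moreover have "col (N * B) j = N *\<^sub>v col B j" using N B that by auto
      ultimately show ?thesis using N B that by simp
    qed
    then show ?thesis using B by (auto simp: tr_def)
  qed
  finally show ?thesis .
qed

text \<open>A trace against \<open>B * B\<close> is a sum of quadratic forms at the columns of
  \<open>B\<close>, hence monotone in the Loewner order. Even powers of a symmetric matrix are such
  squares, and so the recursion below runs over even powers.\<close>

lemma tr_mult_square_mono:
  assumes N: "N \<in> carrier_mat d d" and N': "N' \<in> carrier_mat d d"
    and B: "B \<in> carrier_mat d d" "transpose_mat B = B"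
    and le: "\<And>v. v \<in> carrier_vec d \<Longrightarrow> v \<bullet> (N *\<^sub>v v) \<le> v \<bullet> (N' *\<^sub>v v)"
  shows "tr (N * (B * B)) \<le> tr (N' * (B * B))"
  unfolding tr_mult_square[OF N B] tr_mult_square[OF N' B] using B by (intro sum_mono le) auto

subsection \<open>Sampling rank-one matrices\<close>

lemma smult_mat_mult_vec:
  fixes A :: "real mat"
  assumes "A \<in> carrier_mat m d" "v \<in> carrier_vec d"
  shows "(c \<cdot>\<^sub>m A) *\<^sub>v v = c \<cdot>\<^sub>v (A *\<^sub>v v)"
  using assms by (intro eq_vecI) auto

section \<open>Resampling one draw\<close>

lemma expectation_pair_pmf_finite:
  fixes f :: "'a \<times> 'b \<Rightarrow> real"
  assumes "finite (set_pmf p)" "finite (set_pmf q)"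
  shows "measure_pmf.expectation (pair_pmf p q) f
    = measure_pmf.expectation p (\<lambda>a. measure_pmf.expectation q (\<lambda>b. f (a, b)))"
proof -
  have "measure_pmf.expectation (pair_pmf p q) f
      = (\<Sum>z\<in>set_pmf p \<times> set_pmf q. f z * pmf (pair_pmf p q) z)"
    using assms by (intro integral_measure_pmf_real) auto
  also have "\<dots> = (\<Sum>a\<in>set_pmf p. \<Sum>b\<in>set_pmf q. f (a, b) * (pmf p a * pmf q b))"
    by (subst sum.cartesian_product) (auto simp: pmf_pair intro!: sum.cong)
  also have "\<dots> = (\<Sum>a\<in>set_pmf p. measure_pmf.expectation q (\<lambda>b. f (a, b)) * pmf p a)"
    using assms by (intro sum.cong refl, subst integral_measure_pmf_real[where A = "set_pmf q"])
      (auto simp: sum_distrib_right sum_distrib_left mult_ac)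
  also have "\<dots> = measure_pmf.expectation p (\<lambda>a. measure_pmf.expectation q (\<lambda>b. f (a, b)))"
    using assms by (intro integral_measure_pmf_real[symmetric]) auto
  finally show ?thesis .
qed

text \<open>An exchangeable pair in the sense of Stein's method. The first component keeps the law
  of the original draws, and the entry \<open>c\<close> of the second is independent of the first
  component.\<close>

definition resampled_draws :: "nat \<Rightarrow> nat pmf \<Rightarrow> nat \<Rightarrow> ((nat \<Rightarrow> nat) \<times> (nat \<Rightarrow> nat)) pmf" where
  "resampled_draws s q c = map_pmf (\<lambda>(k, j). (k, k(c := j))) (pair_pmf (column_draws s q) q)"

text \<open>Given the draws other than \<open>c\<close>, the old and the new value at
  \<open>c\<close> are independent with the same law, so swapping the pair amounts to commuting two
  binds.\<close>

lemma resampled_draws_exchangeable: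
  assumes "c < s"
  shows "map_pmf prod.swap (resampled_draws s q c) = resampled_draws s q c"
proof -
  define P where "P = Pi_pmf ({..<s} - {c}) (0 :: nat) (\<lambda>_. q)"
  have "{..<s} = insert c ({..<s} - {c})" using assms by auto
  then have "column_draws s q = Pi_pmf (insert c ({..<s} - {c})) 0 (\<lambda>_. q)"
    by (simp add: column_draws_def)
  also have "\<dots> = do {i \<leftarrow> q; f \<leftarrow> P; return_pmf (f(c := i))}"
    unfolding P_def by (rule Pi_pmf_insert') auto
  finally have cd: "column_draws s q = do {i \<leftarrow> q; f \<leftarrow> P; return_pmf (f(c := i))}" .
  have J: "resampled_draws s q c
      = do {i \<leftarrow> q; f \<leftarrow> P; j \<leftarrow> q; return_pmf (f(c := i), f(c := j))}"
    by (simp add: resampled_draws_def cd map_pmf_def pair_pmf_def bind_assoc_pmf bind_return_pmf)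
  have J': "resampled_draws s q c
      = do {f \<leftarrow> P; i \<leftarrow> q; j \<leftarrow> q; return_pmf (f(c := i), f(c := j))}"
    unfolding J by (rule bind_commute_pmf)
  have "map_pmf prod.swap (resampled_draws s q c)
      = do {f \<leftarrow> P; i \<leftarrow> q; j \<leftarrow> q; return_pmf (f(c := j), f(c := i))}"
    unfolding J' by (simp add: map_pmf_def bind_assoc_pmf bind_return_pmf)
  also have "\<dots> = do {f \<leftarrow> P; j \<leftarrow> q; i \<leftarrow> q; return_pmf (f(c := j), f(c := i))}"
    by (intro bind_pmf_cong refl bind_commute_pmf)
  also have "\<dots> = resampled_draws s q c" unfolding J' ..
  finally show ?thesis .
qed

text \<open>The vectors \<open>y k\<close> stand for whitened and rescaled data rows. The assumption
  \<open>mean_bound\<close> says that the mean \<open>M\<close> of the rank-one matrices lies below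
  the identity; \<open>R\<close> bounds their operator norms.\<close>

locale rank_one_sampling =
  fixes d s n :: nat and q :: "nat pmf" and y :: "nat \<Rightarrow> real vec" and R :: real
  assumes s_pos: "s > 0"
    and support: "set_pmf q \<subseteq> {..<n}"
    and y_carrier: "\<And>k. k < n \<Longrightarrow> y k \<in> carrier_vec d"
    and y_bound: "\<And>k. k < n \<Longrightarrow> y k \<bullet> y k \<le> R"
    and mean_bound: "\<And>v. v \<in> carrier_vec d \<Longrightarrow> (\<Sum>k<n. pmf q k * (y k \<bullet> v)\<^sup>2) \<le> v \<bullet> v"
begin

abbreviation E :: "((nat \<Rightarrow> nat) \<Rightarrow> real) \<Rightarrow> real" where
  "E f \<equiv> measure_pmf.expectation (column_draws s q) f"

abbreviation J :: "nat \<Rightarrow> ((nat \<Rightarrow> nat) \<times> (nat \<Rightarrow> nat) \<Rightarrow> real) \<Rightarrow> real" where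
  "J c f \<equiv> measure_pmf.expectation (resampled_draws s q c) f"

definition Z :: "nat \<Rightarrow> real mat" where
  "Z k = mat d d (\<lambda>(a, b). y k $ a * y k $ b)"

definition M :: "real mat" where
  "M = mat d d (\<lambda>(a, b). \<Sum>k<n. pmf q k * (y k $ a * y k $ b))"

definition X :: "(nat \<Rightarrow> nat) \<Rightarrow> real mat" where
  "X h = mat d d (\<lambda>(a, b). (\<Sum>c<s. Z (h c) $$ (a, b)) / real s - M $$ (a, b))"

lemma Z_carrier [simp]: "Z k \<in> carrier_mat d d" and Z_sym: "transpose_mat (Z k) = Z k"
  by (auto simp: Z_def mult.commute intro!: eq_matI)

lemma M_carrier [simp]: "M \<in> carrier_mat d d" and M_sym: "transpose_mat M = M"
  by (auto simp: M_def mult.commute intro!: eq_matI)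

lemma X_carrier [simp]: "X h \<in> carrier_mat d d"
  by (simp add: X_def)

lemma X_sym: "transpose_mat (X h) = X h"
  by (auto simp: X_def Z_def M_def mult.commute intro!: eq_matI)

lemma finite_q: "finite (set_pmf q)"
  using support finite_subset by blast

lemma finite_draws: "finite (set_pmf (column_draws s q))"
proof -
  have "set_pmf (column_draws s q) \<subseteq> PiE_dflt {..<s} 0 (\<lambda>_. set_pmf q)"
    unfolding column_draws_def by (subst set_Pi_pmf) (auto simp: o_def)
  moreover have "finite (PiE_dflt {..<s} (0 :: nat) (\<lambda>_. set_pmf q))"
    using finite_q by (intro finite_PiE_dflt) auto
  ultimately show ?thesis by (rule finite_subset)
qed

lemma draws_lt: "h \<in> set_pmf (column_draws s q) \<Longrightarrow> c < s \<Longrightarrow> h c < n"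
  using support unfolding column_draws_def by (subst (asm) set_Pi_pmf) (auto simp: PiE_dflt_def)

lemma finite_resampled: "finite (set_pmf (resampled_draws s q c))"
  unfolding resampled_draws_def using finite_draws finite_q by simp

lemma integrable_E [simp]: "integrable (measure_pmf (column_draws s q)) (f :: _ \<Rightarrow> real)"
  by (rule integrable_measure_pmf_finite[OF finite_draws])

lemma integrable_J [simp]: "integrable (measure_pmf (resampled_draws s q c)) (f :: _ \<Rightarrow> real)"
  by (rule integrable_measure_pmf_finite[OF finite_resampled])

lemma E_mono:
  assumes "\<And>h. h \<in> set_pmf (column_draws s q) \<Longrightarrow> f h \<le> g h"
  shows "E f \<le> E g"
  by (intro integral_mono_AE) (auto simp: AE_measure_pmf_iff assms)

lemma J_mono:
  assumes "\<And>z. z \<in> set_pmf (resampled_draws s q c) \<Longrightarrow> f z \<le> g z"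
  shows "J c f \<le> J c g"
  by (intro integral_mono_AE) (auto simp: AE_measure_pmf_iff assms)

lemma J_eq: "J c f = E (\<lambda>h. measure_pmf.expectation q (\<lambda>j. f (h, h(c := j))))"
  unfolding resampled_draws_def
  by (simp add: expectation_pair_pmf_finite[OF finite_draws finite_q] case_prod_beta)

lemma J_fst: "J c (\<lambda>(h, h'). f h) = E f"
  unfolding J_eq by simp

lemma J_swap: "c < s \<Longrightarrow> J c (\<lambda>(h, h'). f h' h) = J c (\<lambda>(h, h'). f h h')"
proof -
  assume c: "c < s"
  have "J c (\<lambda>(h, h'). f h h')
      = measure_pmf.expectation (map_pmf prod.swap (resampled_draws s q c)) (\<lambda>(h, h'). f h h')"
    unfolding resampled_draws_exchangeable[OF c] ..
  also have "\<dots> = J c (\<lambda>(h, h'). f h' h)" by (simp add: case_prod_beta')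
  finally show ?thesis ..
qed

lemma tr_X_mult:
  assumes B: "B \<in> carrier_mat d d"
  shows "tr (X h * B) = (\<Sum>c<s. tr (Z (h c) * B)) / real s - tr (M * B)"
proof -
  have "tr (X h * B) = (\<Sum>i<d. \<Sum>j<d. (\<Sum>c<s. Z (h c) $$ (i, j) * B $$ (j, i)) / real s - M $$ (i, j) * B $$ (j, i))"
    unfolding tr_mult[OF X_carrier B]
    by (intro sum.cong refl) (simp add: X_def left_diff_distrib sum_distrib_right)
  also have "\<dots> = (\<Sum>i<d. \<Sum>j<d. \<Sum>c<s. Z (h c) $$ (i, j) * B $$ (j, i)) / real s - tr (M * B)"
    by (simp add: sum_subtractf tr_mult[OF M_carrier B] sum_divide_distrib)
  also have "(\<Sum>i<d. \<Sum>j<d. \<Sum>c<s. Z (h c) $$ (i, j) * B $$ (j, i)) = (\<Sum>c<s. tr (Z (h c) * B))"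
  proof -
    have "(\<Sum>i<d. \<Sum>j<d. \<Sum>c<s. Z (h c) $$ (i, j) * B $$ (j, i))
        = (\<Sum>i<d. \<Sum>c<s. \<Sum>j<d. Z (h c) $$ (i, j) * B $$ (j, i))"
      by (intro sum.cong refl sum.swap)
    also have "\<dots> = (\<Sum>c<s. \<Sum>i<d. \<Sum>j<d. Z (h c) $$ (i, j) * B $$ (j, i))" by (rule sum.swap)
    finally show ?thesis unfolding tr_mult[OF Z_carrier B] .
  qed
  finally show ?thesis .
qed

lemma tr_M_mult:
  assumes B: "B \<in> carrier_mat d d"
  shows "tr (M * B) = measure_pmf.expectation q (\<lambda>k. tr (Z k * B))"
proof -
  have "tr (M * B) = (\<Sum>i<d. \<Sum>j<d. \<Sum>k<n. pmf q k * (Z k $$ (i, j) * B $$ (j, i)))"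
    unfolding tr_mult[OF M_carrier B]
    by (intro sum.cong refl) (simp add: M_def Z_def sum_distrib_right mult.assoc)
  also have "\<dots> = (\<Sum>i<d. \<Sum>k<n. \<Sum>j<d. pmf q k * (Z k $$ (i, j) * B $$ (j, i)))"
    by (intro sum.cong refl sum.swap)
  also have "\<dots> = (\<Sum>k<n. \<Sum>i<d. \<Sum>j<d. pmf q k * (Z k $$ (i, j) * B $$ (j, i)))" by (rule sum.swap)
  also have "\<dots> = (\<Sum>k<n. tr (Z k * B) * pmf q k)"
    unfolding tr_mult[OF Z_carrier B] by (simp add: sum_distrib_left mult.commute)
  also have "\<dots> = measure_pmf.expectation q (\<lambda>k. tr (Z k * B))"
    using support by (intro integral_measure_pmf_real[symmetric]) auto
  finally show ?thesis .
qed

lemma Z_mult_vec: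
  assumes "k < n" "v \<in> carrier_vec d"
  shows "Z k *\<^sub>v v = (y k \<bullet> v) \<cdot>\<^sub>v y k"
  using assms carrier_vecD[OF y_carrier[OF assms(1)]]
  by (intro eq_vecI) (auto simp: Z_def scalar_prod_def sum_distrib_right sum_distrib_left mult_ac intro!: sum.cong)

lemma bilinear_trace:
  assumes A: "A \<in> carrier_mat d d" and v: "v \<in> carrier_vec d" and w: "w \<in> carrier_vec d"
  shows "v \<bullet> (A *\<^sub>v w) = tr (A * mat d d (\<lambda>(a, b). w $ a * v $ b))"
  using A v w by (subst tr_mult[of _ d])
    (auto simp: scalar_prod_def lessThan_atLeast0 sum_distrib_left mult_ac intro!: sum.cong)

lemma bilinear_Z:
  assumes "k < n" "v \<in> carrier_vec d" "w \<in> carrier_vec d"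
  shows "v \<bullet> (Z k *\<^sub>v w) = (y k \<bullet> v) * (y k \<bullet> w)"
  using assms comm_scalar_prod[OF y_carrier[OF assms(1)] assms(2)] y_carrier[OF assms(1)]
  by (simp add: Z_mult_vec mult.commute)

lemma bilinear_M:
  assumes v: "v \<in> carrier_vec d" and w: "w \<in> carrier_vec d"
  shows "v \<bullet> (M *\<^sub>v w) = (\<Sum>k<n. pmf q k * ((y k \<bullet> v) * (y k \<bullet> w)))"
proof -
  have "v \<bullet> (M *\<^sub>v w) = measure_pmf.expectation q (\<lambda>k. v \<bullet> (Z k *\<^sub>v w))"
    using bilinear_trace[OF M_carrier v w] bilinear_trace[OF Z_carrier v w] by (simp add: tr_M_mult)
  also have "\<dots> = (\<Sum>k<n. v \<bullet> (Z k *\<^sub>v w) * pmf q k)"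
    using support by (intro integral_measure_pmf_real) auto
  also have "\<dots> = (\<Sum>k<n. pmf q k * ((y k \<bullet> v) * (y k \<bullet> w)))"
    by (intro sum.cong) (auto simp: bilinear_Z[OF _ v w])
  finally show ?thesis .
qed

lemma bilinear_X:
  assumes v: "v \<in> carrier_vec d" and w: "w \<in> carrier_vec d" and h: "\<And>c. c < s \<Longrightarrow> h c < n"
  shows "v \<bullet> (X h *\<^sub>v w) = (\<Sum>c<s. (y (h c) \<bullet> v) * (y (h c) \<bullet> w)) / real s
    - (\<Sum>k<n. pmf q k * ((y k \<bullet> v) * (y k \<bullet> w)))"
proof -
  have "v \<bullet> (X h *\<^sub>v w) = (\<Sum>c<s. v \<bullet> (Z (h c) *\<^sub>v w)) / real s - v \<bullet> (M *\<^sub>v w)"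
    using bilinear_trace[OF X_carrier v w] bilinear_trace[OF M_carrier v w] bilinear_trace[OF Z_carrier v w]
    by (simp add: tr_X_mult)
  also have "(\<Sum>c<s. v \<bullet> (Z (h c) *\<^sub>v w)) = (\<Sum>c<s. (y (h c) \<bullet> v) * (y (h c) \<bullet> w))"
    by (intro sum.cong) (auto simp: bilinear_Z[OF h v w])
  finally show ?thesis by (simp add: bilinear_M[OF v w])
qed

lemma quadratic_form_Z:
  "k < n \<Longrightarrow> v \<in> carrier_vec d \<Longrightarrow> v \<bullet> (Z k *\<^sub>v v) = (y k \<bullet> v)\<^sup>2"
  by (simp add: bilinear_Z power2_eq_square)

lemma quadratic_form_M:
  "v \<in> carrier_vec d \<Longrightarrow> v \<bullet> (M *\<^sub>v v) = (\<Sum>k<n. pmf q k * (y k \<bullet> v)\<^sup>2)"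
  by (simp add: bilinear_M power2_eq_square)

lemma tr_M: "tr M = (\<Sum>k<n. pmf q k * (y k \<bullet> y k))"
proof -
  have "tr M = (\<Sum>i<d. \<Sum>k<n. pmf q k * (y k $ i * y k $ i))" by (simp add: tr_def M_def)
  also have "\<dots> = (\<Sum>k<n. \<Sum>i<d. pmf q k * (y k $ i * y k $ i))" by (rule sum.swap)
  also have "\<dots> = (\<Sum>k<n. pmf q k * (y k \<bullet> y k))"
    using carrier_vecD[OF y_carrier]
    by (intro sum.cong) (auto simp: scalar_prod_def sum_distrib_left lessThan_atLeast0)
  finally show ?thesis .
qed

lemma X_resample:
  assumes c: "c < s"
  shows "X h - X (h(c := j)) = (1 / real s) \<cdot>\<^sub>m (Z (h c) - Z j)"
proof (rule eq_matI)
  fix a b assume ab: "a < dim_row ((1 / real s) \<cdot>\<^sub>m (Z (h c) - Z j))"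
    "b < dim_col ((1 / real s) \<cdot>\<^sub>m (Z (h c) - Z j))"
  have dims: "dim_row (Z k) = d" "dim_col (Z k) = d" for k by (simp_all add: Z_def)
  have "(\<Sum>i<s. Z (h i) $$ (a, b)) - (\<Sum>i<s. Z ((h(c := j)) i) $$ (a, b)) = Z (h c) $$ (a, b) - Z j $$ (a, b)"
  proof -
    have "(\<Sum>i<s. Z (h i) $$ (a, b)) - (\<Sum>i<s. Z ((h(c := j)) i) $$ (a, b))
        = (\<Sum>i<s. if i = c then Z (h c) $$ (a, b) - Z j $$ (a, b) else 0)"
      unfolding sum_subtractf[symmetric] by (intro sum.cong) auto
    then show ?thesis using c by simp
  qed
  then show "(X h - X (h(c := j))) $$ (a, b) = ((1 / real s) \<cdot>\<^sub>m (Z (h c) - Z j)) $$ (a, b)"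
    using ab by (simp add: X_def dims diff_divide_distrib[symmetric])
qed (simp_all add: X_def Z_def)

section \<open>Recursion for the trace moments of the deviation\<close>

lemma pow_X [simp]: "X h ^\<^sub>m k \<in> carrier_mat d d"
  by simp

lemma pow_X_square: "X h ^\<^sub>m (2 * k) = X h ^\<^sub>m k * X h ^\<^sub>m k"
  using pow_mat_add[OF X_carrier, of h k k] by (simp add: mult_2)

lemma pow_X_sym: "transpose_mat (X h ^\<^sub>m k) = X h ^\<^sub>m k"
  by (rule transpose_pow_mat[OF X_carrier X_sym])

lemma R_nonneg: "R \<ge> 0"
proof -
  obtain k where "k \<in> set_pmf q" using set_pmf_not_empty by fast
  then have "y k \<bullet> y k \<le> R" using support y_bound by auto
  then show ?thesis using scalar_prod_self_ge_0[of "y k"] by simp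
qed

text \<open>Up to the factor \<open>1 / (real s)\<^sup>2\<close> this is the Loewner bound
  \<open>(Z - Z')\<^sup>2 \<le> 2 * R * (Z + Z')\<close> for two rank-one matrices, taken in trace
  against an even power. The power belongs to an arbitrary \<open>g\<close>, so that the bound
  serves both members of an exchangeable pair.\<close>

lemma resample_variance:
  assumes c: "c < s" and i: "h c < n" and j: "j < n"
  shows "tr ((X h - X (h(c := j))) * (X h - X (h(c := j))) * X g ^\<^sub>m (2 * k))
    \<le> 2 * R / (real s)\<^sup>2 * (tr (Z (h c) * X g ^\<^sub>m (2 * k)) + tr (Z j * X g ^\<^sub>m (2 * k)))"
proof -
  let ?D = "Z (h c) - Z j"
  have D: "?D \<in> carrier_mat d d" by (rule minus_carrier_mat) simp
  have sD: "transpose_mat ?D = ?D" by (simp add: transpose_minus[of _ d d] Z_sym)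
  have DD: "?D * ?D \<in> carrier_mat d d" using D by auto
  have ZZ: "Z (h c) + Z j \<in> carrier_mat d d" by auto
  have smult: "a \<cdot>\<^sub>m (b \<cdot>\<^sub>m N) = (a * b) \<cdot>\<^sub>m N" for a b :: real and N
    by (intro eq_matI) auto
  have "(X h - X (h(c := j))) * (X h - X (h(c := j))) = (1 / (real s)\<^sup>2) \<cdot>\<^sub>m (?D * ?D)"
    unfolding X_resample[OF c] using D
    by (simp add: mult_smult_assoc_mat[of _ d d _ d] mult_smult_distrib[of _ d d _ d] power2_eq_square smult)
  then have eq: "tr ((X h - X (h(c := j))) * (X h - X (h(c := j))) * X g ^\<^sub>m (2 * k))
      = 1 / (real s)\<^sup>2 * tr (?D * ?D * X g ^\<^sub>m (2 * k))"
    using DD by (simp add: mult_smult_assoc_mat[of _ d d _ d] tr_smult[of _ d])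
  have "tr (?D * ?D * X g ^\<^sub>m (2 * k)) \<le> tr (((2 * R) \<cdot>\<^sub>m (Z (h c) + Z j)) * X g ^\<^sub>m (2 * k))"
    unfolding pow_X_square
  proof (rule tr_mult_square_mono[OF DD _ pow_X pow_X_sym])
    fix v :: "real vec" assume v: "v \<in> carrier_vec d"
    have Dv: "?D *\<^sub>v v \<in> carrier_vec d" using D v by auto
    define a b where "a = y (h c) \<bullet> v" and "b = y j \<bullet> v"
    let ?p = "y (h c)" and ?r = "y j"
    have p: "?p \<in> carrier_vec d" "?r \<in> carrier_vec d" using y_carrier i j by auto
    have Dv': "?D *\<^sub>v v = a \<cdot>\<^sub>v ?p - b \<cdot>\<^sub>v ?r"
      using v i j by (simp add: minus_mult_distrib_mat_vec[of _ d d] Z_mult_vec a_def b_def)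
    have "v \<bullet> ((?D * ?D) *\<^sub>v v) = (?D *\<^sub>v v) \<bullet> (?D *\<^sub>v v)"
      using assoc_mult_mat_vec[OF D D v] symmetric_scalar_prod[OF D sD v Dv] by simp
    also have "\<dots> = a\<^sup>2 * (?p \<bullet> ?p) - 2 * (a * b) * (?p \<bullet> ?r) + b\<^sup>2 * (?r \<bullet> ?r)"
      unfolding Dv' using p comm_scalar_prod[OF p]
      by (simp add: minus_scalar_prod_distrib[of _ d] scalar_prod_minus_distrib[of _ d]
        power2_eq_square algebra_simps)
    \<comment> \<open>The inequality
      \<open>|p - r|\<^sup>2 \<le> 2 * |p|\<^sup>2 + 2 * |r|\<^sup>2\<close> for the scaled vectors;
      the difference of its sides is the squared length of their sum.\<close>
    also have "\<dots> \<le> 2 * a\<^sup>2 * (?p \<bullet> ?p) + 2 * b\<^sup>2 * (?r \<bullet> ?r)"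
    proof -
      have "(a \<cdot>\<^sub>v ?p + b \<cdot>\<^sub>v ?r) \<bullet> (a \<cdot>\<^sub>v ?p + b \<cdot>\<^sub>v ?r)
          = a\<^sup>2 * (?p \<bullet> ?p) + 2 * (a * b) * (?p \<bullet> ?r) + b\<^sup>2 * (?r \<bullet> ?r)"
        using p comm_scalar_prod[OF p]
        by (simp add: add_scalar_prod_distrib[of _ d] scalar_prod_add_distrib[of _ d]
          power2_eq_square algebra_simps)
      then have "0 \<le> a\<^sup>2 * (?p \<bullet> ?p) + 2 * (a * b) * (?p \<bullet> ?r) + b\<^sup>2 * (?r \<bullet> ?r)"
        using scalar_prod_self_ge_0 by metis
      then show ?thesis by (simp add: algebra_simps)
    qed
    also have "\<dots> \<le> 2 * a\<^sup>2 * R + 2 * b\<^sup>2 * R"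
      using y_bound i j by (intro add_mono mult_left_mono) auto
    also have "\<dots> = v \<bullet> (((2 * R) \<cdot>\<^sub>m (Z (h c) + Z j)) *\<^sub>v v)"
    proof -
      have zv: "Z k *\<^sub>v v \<in> carrier_vec d" for k using v mult_mat_vec_carrier[OF Z_carrier] by blast
      have "((2 * R) \<cdot>\<^sub>m (Z (h c) + Z j)) *\<^sub>v v = (2 * R) \<cdot>\<^sub>v (Z (h c) *\<^sub>v v + Z j *\<^sub>v v)"
        using add_mult_distrib_mat_vec[OF Z_carrier Z_carrier v] smult_mat_mult_vec[OF ZZ v] by simp
      then show ?thesis using v zv quadratic_form_Z[OF i v] quadratic_form_Z[OF j v]
        by (simp add: scalar_prod_add_distrib[of _ d] a_def b_def algebra_simps)
    qed
    finally show "v \<bullet> ((?D * ?D) *\<^sub>v v) \<le> v \<bullet> (((2 * R) \<cdot>\<^sub>m (Z (h c) + Z j)) *\<^sub>v v)" .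
  qed (use ZZ in auto)
  also have "tr (((2 * R) \<cdot>\<^sub>m (Z (h c) + Z j)) * X g ^\<^sub>m (2 * k))
      = 2 * R * (tr (Z (h c) * X g ^\<^sub>m (2 * k)) + tr (Z j * X g ^\<^sub>m (2 * k)))"
    using ZZ by (simp add: mult_carrier_mat[of _ d d] mult_smult_assoc_mat[of _ d d _ d] add_mult_distrib_mat[of _ d d _ _ d]
      tr_smult[of _ d] tr_add[of _ d])
  finally have "1 / (real s)\<^sup>2 * tr (?D * ?D * X g ^\<^sub>m (2 * k)) \<le> 1 / (real s)\<^sup>2 *
      (2 * R * (tr (Z (h c) * X g ^\<^sub>m (2 * k)) + tr (Z j * X g ^\<^sub>m (2 * k))))"
    by (intro mult_left_mono) auto
  then show ?thesis unfolding eq by simp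
qed

definition moment :: "nat \<Rightarrow> real" where
  "moment m = E (\<lambda>h. tr (X h ^\<^sub>m m))"

text \<open>The fresh draw \<open>h' c\<close> is independent of \<open>h\<close>, so its rank-one
  matrix may be averaged to \<open>M\<close> while \<open>B h\<close> is held fixed.\<close>

lemma J_tr_Z_mult: "c < s \<Longrightarrow> J c (\<lambda>(h, h'). tr (Z (h' c) * B h)) = E (\<lambda>h. tr (M * B h))"
  if "\<And>h. B h \<in> carrier_mat d d" for B
  unfolding J_eq using tr_M_mult[OF that] by simp

lemma resample_support:
  assumes "(h, h') \<in> set_pmf (resampled_draws s q c)" "c < s"
  obtains j where "h' = h(c := j)" "j < n" "h c < n"
  using assms draws_lt[of h c] support unfolding resampled_draws_def by auto

text \<open>
  Exchangeability under replacing one draw by an independent copy: with \<open>X'\<close> the resampled \<open>X\<close>, the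
  trace of \<open>(Z (h c) - M) X\<^bsup>m+1\<^esup>\<close> has the same expectation as \<open>s/2\<close> times that of
  \<open>(X - X') (X\<^bsup>m+1\<^esup> - X'\<^bsup>m+1\<^esup>)\<close>.
\<close>

lemma column_moment_bound:
  assumes c: "c < s" and m: "m = 2 * k"
  shows "E (\<lambda>h. tr (Z (h c) * X h ^\<^sub>m Suc m)) - E (\<lambda>h. tr (M * X h ^\<^sub>m Suc m))
    \<le> real (Suc m) * R / real s * (E (\<lambda>h. tr (Z (h c) * X h ^\<^sub>m m)) + E (\<lambda>h. tr (M * X h ^\<^sub>m m)))"
proof -
  note pw [simp del] = pow_mat.simps
  define G where "G h h' = tr ((X h - X h') * X h ^\<^sub>m Suc m)" for h h'
  define V where "V h h' = tr (Z (h c) * X h ^\<^sub>m m) + tr (Z (h' c) * X h ^\<^sub>m m)" for h h'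
  have XX: "X h - X h' \<in> carrier_mat d d" for h h' by (rule minus_carrier_mat) simp
  have G: "real s * G h h' = tr (Z (h c) * X h ^\<^sub>m Suc m) - tr (Z (h' c) * X h ^\<^sub>m Suc m)"
    if hh: "(h, h') \<in> set_pmf (resampled_draws s q c)" for h h'
  proof -
    obtain j where j: "h' = h(c := j)" "j < n" "h c < n" by (rule resample_support[OF hh c])
    have ZZ: "Z (h c) - Z j \<in> carrier_mat d d" by (rule minus_carrier_mat) simp
    have "real s * G h h' = tr ((Z (h c) - Z j) * X h ^\<^sub>m Suc m)"
      unfolding G_def j(1) X_resample[OF c] using ZZ s_pos
      by (simp add: mult_smult_assoc_mat[of _ d d _ d] tr_smult[of _ d])
    then show ?thesis unfolding j(1)
      by (simp add: mult_carrier_mat[of _ d d] minus_mult_distrib_mat[of _ d d _ _ d] tr_minus[of _ d])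
  qed
  have ae: "J c f = J c g" if "\<And>z. z \<in> set_pmf (resampled_draws s q c) \<Longrightarrow> f z = g z" for f g
    using that by (intro antisym J_mono) auto
  have "E (\<lambda>h. tr (Z (h c) * X h ^\<^sub>m Suc m)) - E (\<lambda>h. tr (M * X h ^\<^sub>m Suc m))
      = J c (\<lambda>(h, h'). tr (Z (h c) * X h ^\<^sub>m Suc m)) - J c (\<lambda>(h, h'). tr (Z (h' c) * X h ^\<^sub>m Suc m))"
    using J_tr_Z_mult[of "\<lambda>h. X h ^\<^sub>m Suc m" c] c J_fst[of c "\<lambda>h. tr (Z (h c) * X h ^\<^sub>m Suc m)"] by simp
  also have "\<dots> = J c (\<lambda>(h, h'). tr (Z (h c) * X h ^\<^sub>m Suc m) - tr (Z (h' c) * X h ^\<^sub>m Suc m))"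
    by (simp add: case_prod_beta')
  also have "\<dots> = J c (\<lambda>(h, h'). real s * G h h')"
    by (rule ae) (auto simp: G)
  also have "\<dots> = real s * J c (\<lambda>(h, h'). G h h')" by (simp add: case_prod_beta')
  also have "J c (\<lambda>(h, h'). G h h') = 1 / 2 * J c (\<lambda>(h, h'). G h h' + G h' h)"
  proof -
    have "J c (\<lambda>(h, h'). G h h' + G h' h) = J c (\<lambda>(h, h'). G h h') + J c (\<lambda>(h, h'). G h' h)"
      by (simp add: case_prod_beta')
    then show ?thesis using J_swap[OF c, of G] by simp
  qed
  also have "J c (\<lambda>(h, h'). G h h' + G h' h)
      \<le> J c (\<lambda>(h, h'). real (Suc m) * R / (real s)\<^sup>2 * (V h h' + V h' h))"
  proof (rule J_mono, clarify)
    fix h h' assume hh: "(h, h') \<in> set_pmf (resampled_draws s q c)"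
    obtain j where j: "h' = h(c := j)" "j < n" "h c < n" by (rule resample_support[OF hh c])
    \<comment> \<open>Exchanging \<open>h\<close> and \<open>h'\<close> reverses the sign of
      \<open>X h - X h'\<close>, so that the two terms merge into a trace with a difference of
      powers, the form required by the mean value inequality.\<close>
    have "G h h' + G h' h = tr ((X h - X h') * (X h ^\<^sub>m Suc m - X h' ^\<^sub>m Suc m))"
    proof -
      have "tr ((X h' - X h) * B) = - tr ((X h - X h') * B)" if "B \<in> carrier_mat d d" for B
        using that by (simp add: mult_carrier_mat[of _ d d] minus_mult_distrib_mat[of _ d d _ _ d] tr_minus[of _ d])
      then show ?thesis using XX
        by (simp add: G_def mult_carrier_mat[of _ d d] mult_minus_distrib_mat[of _ d d _ d] tr_minus[of _ d])
    qed
    also have "\<dots> \<le> real (Suc m) / 2 * (tr ((X h - X h') * (X h - X h') * X h ^\<^sub>m m)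
        + tr ((X h - X h') * (X h - X h') * X h' ^\<^sub>m m))"
      by (rule trace_mean_value_ineq[OF X_carrier X_sym X_carrier X_sym]) (simp add: m)
    also have "\<dots> \<le> real (Suc m) / 2 *
        (2 * R / (real s)\<^sup>2 * (tr (Z (h c) * X h ^\<^sub>m m) + tr (Z j * X h ^\<^sub>m m))
        + 2 * R / (real s)\<^sup>2 * (tr (Z (h c) * X h' ^\<^sub>m m) + tr (Z j * X h' ^\<^sub>m m)))"
      unfolding m j(1) by (intro mult_left_mono add_mono resample_variance c j(2,3)) auto
    \<comment> \<open>As \<open>h' c = j\<close>, the two traces against the power of
      \<open>X h\<close> form \<open>V h h'\<close>, and the two against the power of
      \<open>X h'\<close> form \<open>V h' h\<close>.\<close>
    also have "\<dots> = real (Suc m) * R / (real s)\<^sup>2 * (V h h' + V h' h)"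
      unfolding V_def j(1) by (simp add: algebra_simps add_divide_distrib)
    finally show "G h h' + G h' h \<le> real (Suc m) * R / (real s)\<^sup>2 * (V h h' + V h' h)" .
  qed
  also have "J c (\<lambda>(h, h'). real (Suc m) * R / (real s)\<^sup>2 * (V h h' + V h' h))
      = real (Suc m) * R / (real s)\<^sup>2 * (2 * J c (\<lambda>(h, h'). V h h'))"
  proof -
    have "J c (\<lambda>(h, h'). V h h' + V h' h) = J c (\<lambda>(h, h'). V h h') + J c (\<lambda>(h, h'). V h' h)"
      by (simp add: case_prod_beta')
    then have "J c (\<lambda>(h, h'). V h h' + V h' h) = 2 * J c (\<lambda>(h, h'). V h h')"
      using J_swap[OF c, of V] by simp
    moreover have "J c (\<lambda>(h, h'). real (Suc m) * R / (real s)\<^sup>2 * (V h h' + V h' h))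
      = real (Suc m) * R / (real s)\<^sup>2 * J c (\<lambda>(h, h'). V h h' + V h' h)"
      unfolding case_prod_beta' by (rule integral_mult_right_zero)
    ultimately show ?thesis by simp
  qed
  also have "J c (\<lambda>(h, h'). V h h') = E (\<lambda>h. tr (Z (h c) * X h ^\<^sub>m m)) + E (\<lambda>h. tr (M * X h ^\<^sub>m m))"
  proof -
    have "J c (\<lambda>(h, h'). V h h') = J c (\<lambda>(h, h'). tr (Z (h c) * X h ^\<^sub>m m))
        + J c (\<lambda>(h, h'). tr (Z (h' c) * X h ^\<^sub>m m))"
      by (simp add: case_prod_beta' V_def)
    then show ?thesis
      using J_tr_Z_mult[of "\<lambda>h. X h ^\<^sub>m m" c] c J_fst[of c "\<lambda>h. tr (Z (h c) * X h ^\<^sub>m m)"] by simp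
  qed
  finally have "E (\<lambda>h. tr (Z (h c) * X h ^\<^sub>m Suc m)) - E (\<lambda>h. tr (M * X h ^\<^sub>m Suc m))
    \<le> real s * (1 / 2 * (real (Suc m) * R / (real s)\<^sup>2 *
        (2 * (E (\<lambda>h. tr (Z (h c) * X h ^\<^sub>m m)) + E (\<lambda>h. tr (M * X h ^\<^sub>m m))))))"
    by (simp add: mult_left_mono)
  also have "\<dots> = real (Suc m) * R / real s * (E (\<lambda>h. tr (Z (h c) * X h ^\<^sub>m m)) + E (\<lambda>h. tr (M * X h ^\<^sub>m m)))"
  proof -
    have "real s * (1 / 2 * (K * R / (real s)\<^sup>2 * (2 * W))) = K * R / real s * W" for K W :: real
      using s_pos by (simp add: power2_eq_square field_simps)
    then show ?thesis .
  qed
  finally show ?thesis .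
qed

lemma pow_X_Suc: "X h ^\<^sub>m Suc m = X h * X h ^\<^sub>m m"
  using pow_mat_add[OF X_carrier, of h 1 m] left_mult_one_mat[OF X_carrier, of h] by simp

lemma E_tr_X_mult:
  assumes "\<And>h. B h \<in> carrier_mat d d"
  shows "E (\<lambda>h. tr (X h * B h)) = (\<Sum>c<s. E (\<lambda>h. tr (Z (h c) * B h))) / real s - E (\<lambda>h. tr (M * B h))"
  unfolding tr_X_mult[OF assms] by simp

text \<open>One factor \<open>X\<close> of the power is expanded into its columns, to each of which
  the column bound applies. On the right, the average of the rank-one matrices is
  \<open>X + M\<close>; this is where the odd moment and the second copy of the \<open>M\<close>
  term come from.\<close>

lemma moment_recursion:
  assumes m: "m = 2 * k"
  shows "moment (m + 2) \<le> real (Suc m) * R / real s * (moment (m + 1) + 2 * E (\<lambda>h. tr (M * X h ^\<^sub>m m)))"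
proof -
  note pw [simp del] = pow_mat.simps
  let ?a = "\<lambda>i c. E (\<lambda>h. tr (Z (h c) * X h ^\<^sub>m i))" and ?b = "\<lambda>i. E (\<lambda>h. tr (M * X h ^\<^sub>m i))"
  have "moment (m + 2) = (\<Sum>c<s. ?a (Suc m) c) / real s - ?b (Suc m)"
  proof -
    have "moment (m + 2) = E (\<lambda>h. tr (X h * X h ^\<^sub>m Suc m))"
      unfolding moment_def by (simp only: pow_X_Suc[of _ "Suc m", symmetric]) simp
    then show ?thesis by (simp only: E_tr_X_mult[OF pow_X])
  qed
  also have "\<dots> = (\<Sum>c<s. ?a (Suc m) c - ?b (Suc m)) / real s"
    using s_pos by (simp add: sum_subtractf diff_divide_distrib)
  also have "\<dots> \<le> (\<Sum>c<s. real (Suc m) * R / real s * (?a m c + ?b m)) / real s"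
    by (intro divide_right_mono sum_mono column_moment_bound[OF _ m]) auto
  also have "\<dots> = real (Suc m) * R / real s * ((\<Sum>c<s. ?a m c) / real s + ?b m)"
  proof -
    have "(\<Sum>c<s. K * (f c + b)) / real s = K * ((\<Sum>c<s. f c) / real s + b)" for K b :: real and f
      using s_pos by (simp only: sum_distrib_left[symmetric] sum.distrib) (simp add: field_simps)
    then show ?thesis .
  qed
  also have "(\<Sum>c<s. ?a m c) / real s = moment (m + 1) + ?b m"
  proof -
    have "moment (m + 1) = E (\<lambda>h. tr (X h * X h ^\<^sub>m m))"
      unfolding moment_def by (simp only: pow_X_Suc[of _ m, symmetric]) simp
    then show ?thesis by (simp only: E_tr_X_mult[OF pow_X])
  qed
  finally show ?thesis by (simp add: algebra_simps add_divide_distrib)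
qed

lemma moment_1: "moment 1 = 0"
proof -
  have one: "1\<^sub>m d \<in> carrier_mat d d" by simp
  have "moment 1 = E (\<lambda>h. tr (X h * 1\<^sub>m d))"
    unfolding moment_def by (simp add: left_mult_one_mat[OF X_carrier] right_mult_one_mat[OF X_carrier])
  also have "\<dots> = (\<Sum>c<s. E (\<lambda>h. tr (Z (h c) * 1\<^sub>m d))) / real s - E (\<lambda>h. tr (M * 1\<^sub>m d))"
    by (rule E_tr_X_mult) simp
  also have "E (\<lambda>h. tr (Z (h c) * 1\<^sub>m d)) = E (\<lambda>h. tr (M * 1\<^sub>m d))" if "c < s" for c
    using J_swap[OF that, of "\<lambda>h h'. tr (Z (h c) * 1\<^sub>m d)"] J_tr_Z_mult[of "\<lambda>h. 1\<^sub>m d" c] that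
      J_fst[of c "\<lambda>h. tr (Z (h c) * 1\<^sub>m d)"] by simp
  then have "(\<Sum>c<s. E (\<lambda>h. tr (Z (h c) * 1\<^sub>m d))) / real s = E (\<lambda>h. tr (M * 1\<^sub>m d))"
    using s_pos by simp
  finally show ?thesis by simp
qed

text \<open>Induction by two powers at a time. The odd moment is split between its even neighbours,
  and \<open>M \<le> 1\<close> bounds the trace with \<open>M\<close> by the lower even moment. The
  order \<open>P\<close> fixes the largest coefficient, which then dominates those of all earlier
  steps.\<close>

lemma moment_even_le:
  assumes rho: "real (2 * P - 1) * R / real s \<le> \<rho>" "\<rho> \<le> 1 / 3" and p: "1 \<le> p" "p \<le> P"
  shows "moment (2 * p) \<le> (3 * \<rho>) ^ p * tr M"
proof -
  have "0 \<le> real (2 * P - 1) * R / real s" using R_nonneg by simp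
  then have rho0: "\<rho> \<ge> 0" using rho(1) by linarith
  have trM: "tr M \<ge> 0"
    by (auto simp: tr_def M_def intro!: sum_nonneg)
  have coef: "real (2 * p - 1) * R / real s \<le> \<rho>" if "p \<le> P" for p
  proof -
    have "real (2 * p - 1) * R / real s \<le> real (2 * P - 1) * R / real s"
      using that R_nonneg by (intro divide_right_mono mult_right_mono) auto
    then show ?thesis using rho by simp
  qed
  show ?thesis using p
  proof (induction p rule: nat_induct_at_least)
    case base
    have "moment (0 + 2) \<le> real (Suc 0) * R / real s * (moment (0 + 1) + 2 * E (\<lambda>h. tr (M * X h ^\<^sub>m 0)))"
      by (rule moment_recursion[of 0 0]) simp
    also have "\<dots> = real (Suc 0) * R / real s * (2 * tr M)"
      using moment_1 by (simp add: right_mult_one_mat[OF M_carrier] carrier_matD(1)[OF X_carrier])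
    also have "\<dots> \<le> \<rho> * (2 * tr M)" using coef[of 1] base trM by (intro mult_right_mono) auto
    also have "\<dots> \<le> 3 * \<rho> * tr M" using rho0 trM by simp
    finally show ?case by (simp add: numeral_2_eq_2)
  next
    case (Suc p)
    define c where "c = real (Suc (2 * p)) * R / real s"
    have c: "0 \<le> c" "c \<le> \<rho>" using coef[of "Suc p"] Suc.prems R_nonneg by (auto simp: c_def)
    let ?m = "2 * p"
    have b: "E (\<lambda>h. tr (M * X h ^\<^sub>m ?m)) \<le> moment ?m"
      unfolding moment_def
    proof (rule E_mono)
      fix h
      have "tr (M * (X h ^\<^sub>m p * X h ^\<^sub>m p)) \<le> tr (1\<^sub>m d * (X h ^\<^sub>m p * X h ^\<^sub>m p))"
        using mean_bound quadratic_form_M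
        by (intro tr_mult_square_mono[OF M_carrier _ pow_X pow_X_sym]) auto
      also have "1\<^sub>m d * (X h ^\<^sub>m p * X h ^\<^sub>m p) = X h ^\<^sub>m ?m"
        unfolding pow_X_square[symmetric] by (rule left_mult_one_mat[OF pow_X])
      finally show "tr (M * X h ^\<^sub>m ?m) \<le> tr (X h ^\<^sub>m ?m)" unfolding pow_X_square .
    qed
    have o: "moment (?m + 1) \<le> 1 / 2 * (moment (?m + 2) + moment ?m)"
    proof -
      have "moment (?m + 1) \<le> E (\<lambda>h. 1 / 2 * (tr (X h ^\<^sub>m (?m + 2)) + tr (X h ^\<^sub>m ?m)))"
        unfolding moment_def
      proof (rule E_mono)
        fix h
        obtain u lam where e: "eigenbasis d (X h) u lam" using symmetric_eigenbasis[OF X_carrier X_sym] .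
        have "lam i ^ (?m + 1) \<le> 1 / 2 * (lam i ^ (?m + 2) + lam i ^ ?m)" for i
        proof -
          define b where "b = lam i ^ ?m"
          have "b \<ge> 0" by (simp add: b_def power_mult)
          \<comment> \<open>This is \<open>lam ^ (m + 1) \<le> (lam ^ (m + 2) + lam ^ m) / 2\<close>
            in factored form, with \<open>lam ^ m\<close> nonnegative for even
            \<open>m\<close>.\<close>
          then have "0 \<le> b * ((lam i - 1) * (lam i - 1))" by simp
          moreover have "lam i ^ (?m + 2) = b * (lam i * lam i)" "lam i ^ (?m + 1) = b * lam i"
            by (simp_all add: b_def power_add power2_eq_square)
          ultimately show ?thesis unfolding b_def[symmetric] by (simp only:) (simp add: algebra_simps)
        qed
        then show "tr (X h ^\<^sub>m (?m + 1)) \<le> 1 / 2 * (tr (X h ^\<^sub>m (?m + 2)) + tr (X h ^\<^sub>m ?m))"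
          unfolding tr_pow[OF e] sum.distrib[symmetric] sum_distrib_left by (intro sum_mono)
      qed
      then show ?thesis unfolding moment_def by simp
    qed
    have nn: "0 \<le> moment (2 * i)" for i
    proof -
      have "E (\<lambda>h. 0) \<le> moment (2 * i)" unfolding moment_def
      proof (rule E_mono)
        fix h
        obtain u lam where e: "eigenbasis d (X h) u lam" using symmetric_eigenbasis[OF X_carrier X_sym] .
        show "0 \<le> tr (X h ^\<^sub>m (2 * i))" unfolding tr_pow[OF e] by (intro sum_nonneg) (simp add: power_mult)
      qed
      then show ?thesis by simp
    qed
    have "moment (?m + 2) \<le> c * (moment (?m + 1) + 2 * E (\<lambda>h. tr (M * X h ^\<^sub>m ?m)))"
      using moment_recursion[of ?m p] by (simp add: c_def)
    also have "\<dots> \<le> c * (1 / 2 * (moment (?m + 2) + moment ?m) + 2 * moment ?m)"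
      using b o c by (intro mult_left_mono) linarith+
    also have "\<dots> \<le> \<rho> * (1 / 2 * (moment (?m + 2) + moment ?m) + 2 * moment ?m)"
      using c nn[of p] nn[of "Suc p"] by (intro mult_right_mono) auto
    finally have 1: "(1 - \<rho> / 2) * moment (?m + 2) \<le> 5 / 2 * \<rho> * moment ?m" by (simp add: algebra_simps)
    \<comment> \<open>Part of the moment being estimated occurs on the right and has been moved to
      the left; \<open>\<rho> \<le> 1 / 3\<close> leaves a factor of at least 5/6 there. Dividing
      5/2 by 5/6 yields the 3 of the statement.\<close>
    have "5 / 6 * moment (?m + 2) \<le> (1 - \<rho> / 2) * moment (?m + 2)"
      using rho(2) nn[of "Suc p"] by (intro mult_right_mono) auto
    with 1 have "moment (?m + 2) \<le> 3 * \<rho> * moment ?m" by (simp add: algebra_simps)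
    also have "\<dots> \<le> 3 * \<rho> * ((3 * \<rho>) ^ p * tr M)" using Suc rho0 by (intro mult_left_mono) auto
    finally show ?case by (simp add: algebra_simps)
  qed
qed

text \<open>The trace of an even power dominates that power of each single eigenvalue, so a small
  trace bounds all eigenvalues and with them the bilinear form.\<close>

lemma concentration:
  assumes rho: "real (2 * P - 1) * R / real s \<le> \<rho>" "\<rho> \<le> 1 / 3" and P: "1 \<le> P" and eta: "\<eta> > 0"
  shows "measure_pmf.prob (column_draws s q)
     {h. \<forall>v \<in> carrier_vec d. \<forall>w \<in> carrier_vec d. \<bar>v \<bullet> (X h *\<^sub>v w)\<bar> \<le> \<eta> * (vnorm v * vnorm w)}
    \<ge> 1 - (3 * \<rho> / \<eta>\<^sup>2) ^ P * tr M" (is "measure_pmf.prob _ ?G \<ge> _")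
proof -
  let ?B = "{h. tr (X h ^\<^sub>m (2 * P)) \<ge> \<eta> ^ (2 * P)}"
  have nonneg: "0 \<le> tr (X h ^\<^sub>m (2 * P))" for h
  proof -
    obtain u lam where e: "eigenbasis d (X h) u lam" using symmetric_eigenbasis[OF X_carrier X_sym] .
    show ?thesis unfolding tr_pow[OF e] by (intro sum_nonneg) (simp add: power_mult)
  qed
  have "- ?B \<subseteq> ?G"
  proof (clarify, unfold not_le)
    fix h and v w :: "real vec"
    assume lt: "tr (X h ^\<^sub>m (2 * P)) < \<eta> ^ (2 * P)"
      and v: "v \<in> carrier_vec d" and w: "w \<in> carrier_vec d"
    obtain u lam where e: "eigenbasis d (X h) u lam" using symmetric_eigenbasis[OF X_carrier X_sym] .
    have "\<bar>lam i\<bar> \<le> \<eta>" if i: "i < d" for i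
    proof -
      have "\<bar>lam i\<bar> ^ (2 * P) \<le> (\<Sum>i<d. \<bar>lam i\<bar> ^ (2 * P))"
        using i by (intro member_le_sum) auto
      also have "\<dots> = tr (X h ^\<^sub>m (2 * P))" unfolding tr_pow[OF e] by (simp add: power_even_abs)
      finally have "\<bar>lam i\<bar> ^ (2 * P) < \<eta> ^ (2 * P)" using lt by simp
      then show ?thesis using power_less_imp_less_base[of "\<bar>lam i\<bar>" "2 * P" \<eta>] eta by simp
    qed
    then show "\<bar>v \<bullet> (X h *\<^sub>v w)\<bar> \<le> \<eta> * (vnorm v * vnorm w)"
      using eta by (intro bilinear_bound_eigenvalues[OF X_sym e _ v w]) auto
  qed
  then have "measure_pmf.prob (column_draws s q) (- ?B) \<le> measure_pmf.prob (column_draws s q) ?G"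
    by (intro measure_pmf.finite_measure_mono) auto
  moreover have "measure_pmf.prob (column_draws s q) (- ?B) = 1 - measure_pmf.prob (column_draws s q) ?B"
    using measure_pmf.prob_compl[of ?B "column_draws s q"] by (simp add: Compl_eq_Diff_UNIV)
  moreover have "measure_pmf.prob (column_draws s q) ?B \<le> moment (2 * P) / \<eta> ^ (2 * P)"
    unfolding moment_def
    using integral_Markov_inequality_measure[of "measure_pmf (column_draws s q)"
      "\<lambda>h. tr (X h ^\<^sub>m (2 * P))" UNIV "\<eta> ^ (2 * P)"] nonneg eta by simp
  moreover have "moment (2 * P) / \<eta> ^ (2 * P) \<le> (3 * \<rho>) ^ P * tr M / \<eta> ^ (2 * P)"
    using moment_even_le[OF rho P] eta by (intro divide_right_mono) auto
  moreover have "(3 * \<rho>) ^ P * tr M / \<eta> ^ (2 * P) = (3 * \<rho> / \<eta>\<^sup>2) ^ P * tr M"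
    by (simp add: power_divide power_mult)
  ultimately show ?thesis by linarith
qed

end

subsection \<open>Concentration of the sub-sampled Hessian\<close>

text \<open>For the weighted data matrix at \<open>w\<close> this is the Hessian of the smooth part
  at \<open>w\<close>. It is a function of the matrix alone, so that the concentration argument
  involves no derivatives.\<close>

definition reg_hessian :: "real \<Rightarrow> real mat \<Rightarrow> real mat" where
  "reg_hessian \<gamma> A =
     (1 / real (dim_row A)) \<cdot>\<^sub>m (transpose_mat A * A) + \<gamma> \<cdot>\<^sub>m 1\<^sub>m (dim_col A)"

definition enorm :: "real mat \<Rightarrow> real vec \<Rightarrow> real" where
  "enorm H v = sqrt (v \<bullet> (H *\<^sub>v v))"

lemma reg_hessian_carrier [simp]: "A \<in> carrier_mat n d \<Longrightarrow> reg_hessian \<gamma> A \<in> carrier_mat d d"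
  by (auto simp: reg_hessian_def)

lemma gram_bilinear:
  fixes B :: "real mat"
  assumes B: "B \<in> carrier_mat m d" and v: "v \<in> carrier_vec d" and w: "w \<in> carrier_vec d"
  shows "v \<bullet> ((transpose_mat B * B) *\<^sub>v w) = (B *\<^sub>v v) \<bullet> (B *\<^sub>v w)"
proof -
  have tB: "transpose_mat B \<in> carrier_mat d m" using B by simp
  have "B *\<^sub>v w \<in> carrier_vec m" using B w by auto
  then show ?thesis
    using assoc_mult_mat_vec[OF tB B w] transpose_vec_mult_scalar[OF tB _ v, of "B *\<^sub>v w"] by simp
qed

lemma regularized_bilinear:
  fixes G :: "real mat"
  assumes G: "G \<in> carrier_mat d d" and v: "v \<in> carrier_vec d" and w: "w \<in> carrier_vec d"
  shows "v \<bullet> ((c \<cdot>\<^sub>m G + \<gamma> \<cdot>\<^sub>m 1\<^sub>m d) *\<^sub>v w) = c * (v \<bullet> (G *\<^sub>v w)) + \<gamma> * (v \<bullet> w)"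
proof -
  have "(c \<cdot>\<^sub>m G + \<gamma> \<cdot>\<^sub>m 1\<^sub>m d) *\<^sub>v w = c \<cdot>\<^sub>v (G *\<^sub>v w) + \<gamma> \<cdot>\<^sub>v w"
    using G w by (simp add: add_mult_distrib_mat_vec[of _ d d] smult_mat_mult_vec[of _ d d])
  moreover have "G *\<^sub>v w \<in> carrier_vec d" using G w by auto
  ultimately show ?thesis using v w by (simp add: scalar_prod_add_distrib[of _ d])
qed

lemma reg_hessian_bilinear:
  assumes A: "A \<in> carrier_mat n d" and v: "v \<in> carrier_vec d" and w: "w \<in> carrier_vec d"
  shows "v \<bullet> (reg_hessian \<gamma> A *\<^sub>v w)
    = (\<Sum>j<n. (row A j \<bullet> v) * (row A j \<bullet> w)) / real n + \<gamma> * (v \<bullet> w)"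
proof -
  have "transpose_mat A * A \<in> carrier_mat d d" using A by auto
  moreover have "(A *\<^sub>v v) \<bullet> (A *\<^sub>v w) = (\<Sum>j<n. (row A j \<bullet> v) * (row A j \<bullet> w))"
    using A by (auto simp: scalar_prod_def[of "A *\<^sub>v v"] lessThan_atLeast0 intro!: sum.cong)
  ultimately show ?thesis
    using regularized_bilinear[of "transpose_mat A * A" d v w "1 / real n" \<gamma>] gram_bilinear[OF A v w] A v w
    by (simp add: reg_hessian_def)
qed

lemma sampled_gram:
  fixes A S :: "real mat"
  assumes A: "A \<in> carrier_mat n d" and S: "S \<in> carrier_mat n s"
  shows "transpose_mat A * S * transpose_mat S * A = transpose_mat (transpose_mat S * A) * (transpose_mat S * A)"
proof -
  have tA: "transpose_mat A \<in> carrier_mat d n" and tS: "transpose_mat S \<in> carrier_mat s n" using A S by auto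
  have AS: "transpose_mat A * S \<in> carrier_mat d s" using tA S by auto
  show ?thesis using transpose_mult[OF tS A] assoc_mult_mat[OF AS tS A] by simp
qed

text \<open>Each column of the sampling matrix selects one row of \<open>A\<close>. The identity
  includes \<open>s = 0\<close> and draws of probability 0, where both sides contain the quotient by
  0 that equals 0; the case \<open>s = 0\<close> occurs below.\<close>

lemma sampled_hessian_bilinear:
  assumes A: "A \<in> carrier_mat n d" and h: "\<And>c. c < s \<Longrightarrow> h c < n"
    and v: "v \<in> carrier_vec d" and w: "w \<in> carrier_vec d"
  shows "v \<bullet> (sampled_hessian \<gamma> A (sampling_matrix n s q h) *\<^sub>v w)
    = (\<Sum>c<s. (row A (h c) \<bullet> v) * (row A (h c) \<bullet> w) / (real s * pmf q (h c))) / real n + \<gamma> * (v \<bullet> w)"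
proof -
  let ?S = "sampling_matrix n s q h"
  let ?B = "transpose_mat ?S * A"
  have S: "?S \<in> carrier_mat n s" by (simp add: sampling_matrix_def)
  have B: "?B \<in> carrier_mat s d" using S A by auto
  have entry: "(?B *\<^sub>v u) $ c = (row A (h c) \<bullet> u) / sqrt (real s * pmf q (h c))"
    if c: "c < s" and u: "u \<in> carrier_vec d" for c u
  proof -
    have Au: "A *\<^sub>v u \<in> carrier_vec n" using A u by auto
    have "(?B *\<^sub>v u) $ c = (transpose_mat ?S *\<^sub>v (A *\<^sub>v u)) $ c"
      using assoc_mult_mat_vec[of "transpose_mat ?S" s n A d u] S A u by simp
    also have "\<dots> = (\<Sum>i\<in>{0..<n}. ?S $$ (i, c) * (A *\<^sub>v u) $ i)"
      using S A c by (auto simp: scalar_prod_def intro!: sum.cong)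
    also have "\<dots> = (\<Sum>i\<in>{0..<n}. if i = h c then (A *\<^sub>v u) $ i / sqrt (real s * pmf q (h c)) else 0)"
      using c by (intro sum.cong) (auto simp: sampling_matrix_def)
    also have "\<dots> = (row A (h c) \<bullet> u) / sqrt (real s * pmf q (h c))" using h[OF c] A by simp
    finally show ?thesis .
  qed
  have BB: "(?B *\<^sub>v v) \<bullet> (?B *\<^sub>v w)
      = (\<Sum>c<s. (row A (h c) \<bullet> v) * (row A (h c) \<bullet> w) / (real s * pmf q (h c)))"
  proof -
    have "(?B *\<^sub>v v) \<bullet> (?B *\<^sub>v w) = (\<Sum>c<s. (?B *\<^sub>v v) $ c * (?B *\<^sub>v w) $ c)"
      using carrier_matD(1)[OF B] carrier_matD[OF S] by (simp add: scalar_prod_def[of "?B *\<^sub>v v"] lessThan_atLeast0)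
    also have "\<dots> = (\<Sum>c<s. (row A (h c) \<bullet> v) * (row A (h c) \<bullet> w) / (real s * pmf q (h c)))"
      by (intro sum.cong refl) (simp add: entry v w real_sqrt_mult[symmetric])
    finally show ?thesis .
  qed
  have "transpose_mat ?B * ?B \<in> carrier_mat d d" using B by auto
  from regularized_bilinear[OF this v w, of "1 / real n" \<gamma>] show ?thesis
    using gram_bilinear[OF B v w] BB A unfolding sampled_hessian_def sampled_gram[OF A S] by simp
qed

lemma sampled_hessian_carrier [simp]:
  "A \<in> carrier_mat n d \<Longrightarrow> sampled_hessian \<gamma> A (sampling_matrix n s q h) \<in> carrier_mat d d"
  by (auto simp: sampled_hessian_def sampling_matrix_def)

lemma symmetric_from_bilinear:
  fixes A :: "real mat"
  assumes A: "A \<in> carrier_mat d d"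
    and c: "\<And>v w. v \<in> carrier_vec d \<Longrightarrow> w \<in> carrier_vec d \<Longrightarrow> v \<bullet> (A *\<^sub>v w) = w \<bullet> (A *\<^sub>v v)"
  shows "transpose_mat A = A"
proof (rule mat_eq_bilinear[of _ d])
  fix v w :: "real vec" assume v: "v \<in> carrier_vec d" and w: "w \<in> carrier_vec d"
  have "v \<bullet> (transpose_mat A *\<^sub>v w) = w \<bullet> (A *\<^sub>v v)"
    using transpose_vec_mult_scalar[OF A v w] A v w comm_scalar_prod[of v d "transpose_mat A *\<^sub>v w"] by simp
  then show "v \<bullet> (transpose_mat A *\<^sub>v w) = v \<bullet> (A *\<^sub>v w)" using c[OF v w] by simp
qed (use A in auto)

lemma reg_hessian_psd:
  assumes A: "A \<in> carrier_mat n d" and g: "\<gamma> > 0"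
  shows "psd (reg_hessian \<gamma> A)"
    and "v \<in> carrier_vec d \<Longrightarrow> \<gamma> * (v \<bullet> v) \<le> v \<bullet> (reg_hessian \<gamma> A *\<^sub>v v)"
proof -
  show lb: "\<gamma> * (v \<bullet> v) \<le> v \<bullet> (reg_hessian \<gamma> A *\<^sub>v v)" if v: "v \<in> carrier_vec d" for v
    unfolding reg_hessian_bilinear[OF A v v] by (auto intro!: sum_nonneg divide_nonneg_nonneg)
  have "transpose_mat (reg_hessian \<gamma> A) = reg_hessian \<gamma> A"
    using A by (intro symmetric_from_bilinear[of _ d])
      (auto simp: reg_hessian_bilinear[OF A] mult.commute comm_scalar_prod[of _ d])
  moreover have "0 \<le> v \<bullet> (reg_hessian \<gamma> A *\<^sub>v v)" if v: "v \<in> carrier_vec d" for v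
  proof -
    have "0 \<le> \<gamma> * (v \<bullet> v)" using g scalar_prod_self_ge_0[of v] by simp
    then show ?thesis using lb[OF v] by linarith
  qed
  ultimately show "psd (reg_hessian \<gamma> A)"
    unfolding psd_def using carrier_matD[OF reg_hessian_carrier[OF A]] by simp
qed

lemma sampled_hessian_psd:
  assumes A: "A \<in> carrier_mat n d" and g: "\<gamma> > 0" and h: "\<And>c. c < s \<Longrightarrow> h c < n"
  shows "psd (sampled_hessian \<gamma> A (sampling_matrix n s q h))" (is "psd ?H")
proof -
  note bil = sampled_hessian_bilinear[where q = q and s = s, OF A h]
  have "transpose_mat ?H = ?H"
    using A by (intro symmetric_from_bilinear[of _ d])
      (auto simp: bil mult.commute comm_scalar_prod[of _ d])
  moreover have "0 \<le> v \<bullet> (?H *\<^sub>v v)" if v: "v \<in> carrier_vec d" for v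
  proof -
    have "v \<bullet> (?H *\<^sub>v v) = (\<Sum>c<s. (row A (h c) \<bullet> v) * (row A (h c) \<bullet> v) / (real s * pmf q (h c))) / real n
        + \<gamma> * (v \<bullet> v)"
      by (rule sampled_hessian_bilinear[OF A _ v v]) (rule h)
    then show ?thesis using g scalar_prod_self_ge_0[of v]
      by (auto intro!: sum_nonneg divide_nonneg_nonneg add_nonneg_nonneg)
  qed
  ultimately show ?thesis
    unfolding psd_def using carrier_matD[OF sampled_hessian_carrier[OF A]] by simp
qed

text \<open>The moment order is the logarithm of \<open>m\<close>, rounded up. Each of the
  \<open>P\<close> factors is below \<open>exp (- 1)\<close>, which together gives at most
  \<open>1 / m\<close>, hence at most \<open>\<delta> / D\<close> for positive \<open>D\<close>. The
  constant is 200 = 4 * 50: the order satisfies \<open>2 * P - 1 \<le> 4 * ln m\<close>, and the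
  coefficient aimed at is \<open>\<epsilon>\<^sup>2 / 50\<close>.\<close>

lemma chernoff_exponent:
  fixes D R \<epsilon> \<delta> :: real
  assumes "D \<ge> 0" "R \<ge> 0" and eps: "\<epsilon> \<in> {0<..<1/4}" and del: "\<delta> \<in> {0<..<1}" and s: "s > (0 :: nat)"
    and big: "real s \<ge> 200 * (R / \<epsilon>\<^sup>2) * ln (max 2 (D / \<delta>))"
  shows "\<exists>P \<ge> 1. real (2 * P - 1) * R / real s \<le> \<epsilon>\<^sup>2 / 50 \<and>
    (3 * (\<epsilon>\<^sup>2 / 50) / (\<epsilon> / 2)\<^sup>2) ^ P * D \<le> \<delta>"
proof -
  define m where "m = max 2 (D / \<delta>)"
  define P where "P = nat \<lceil>ln m\<rceil>"
  have m: "m \<ge> 2" "m \<ge> D / \<delta>" by (auto simp: m_def)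
  have "ln (2 :: real) \<ge> 1 / 2"
  proof -
    have "exp (1 / 2 :: real) ^ 2 = exp 1" by (simp add: exp_double[symmetric])
    also have "\<dots> \<le> 2 ^ 2" using exp_le by simp
    finally have "exp (1 / 2 :: real) \<le> 2" by (rule power2_le_imp_le) simp
    then show ?thesis using ln_ge_iff[of 2 "1 / 2"] by simp
  qed
  moreover have "ln 2 \<le> ln m" using m by simp
  ultimately have L: "ln m \<ge> 1 / 2" by linarith
  have P1: "P \<ge> 1" and P2: "real P \<ge> ln m" and P3: "real P \<le> ln m + 1"
    using L unfolding P_def by linarith+
  \<comment> \<open>Rounding up gives \<open>2 * ln m + 1\<close>; the 1 is absorbed because
    \<open>ln m\<close> is at least 1/2, an effect of the cut-off at 2.\<close>
  have "real (2 * P - 1) \<le> 4 * ln m" using P1 P3 L by (simp add: of_nat_diff)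
  then have "real (2 * P - 1) * R \<le> 4 * ln m * R" using assms(2) by (rule mult_right_mono)
  also have "4 * ln m * R \<le> \<epsilon>\<^sup>2 / 50 * real s"
  proof -
    have "200 * (R / \<epsilon>\<^sup>2) * ln m * (\<epsilon>\<^sup>2 / 50) \<le> real s * (\<epsilon>\<^sup>2 / 50)"
      using big unfolding m_def[symmetric] by (intro mult_right_mono) auto
    then show ?thesis using eps by (simp add: field_simps)
  qed
  finally have 1: "real (2 * P - 1) * R / real s \<le> \<epsilon>\<^sup>2 / 50" using s by (simp add: field_simps)
  \<comment> \<open>The value 6/25 is 4 * 3/50, the 4 stemming from the accuracy \<epsilon>/2. It is
    smaller than 1/e.\<close>
  have "(3 * (\<epsilon>\<^sup>2 / 50) / (\<epsilon> / 2)\<^sup>2) ^ P * D = (6 / 25) ^ P * D" using eps by (simp add: power2_eq_square)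
  also have "\<dots> \<le> \<delta>"
  proof (cases "D = 0")
    case True
    then show ?thesis using del P1 by simp
  next
    case False
    then have D: "D > 0" using assms(1) by simp
    have "(6 / 25 :: real) \<le> exp (- 1)"
      using exp_le by (simp add: exp_minus field_simps)
    then have "(6 / 25 :: real) ^ P \<le> exp (- 1) ^ P" by (intro power_mono) auto
    also have "\<dots> = exp (- real P)" by (simp add: exp_of_nat_mult[symmetric])
    also have "\<dots> \<le> exp (- ln m)" using P2 by simp
    also have "\<dots> = 1 / m" using m by (simp add: exp_minus inverse_eq_divide)
    also have "\<dots> \<le> 1 / (D / \<delta>)" using m D del by (intro divide_left_mono) auto
    finally have "(6 / 25) ^ P * D \<le> 1 / (D / \<delta>) * D" using D by (intro mult_right_mono) auto
    then show ?thesis using D by simp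
  qed
  finally show ?thesis using 1 P1 by blast
qed

text \<open>In whitened coordinates a ridge leverage score is a squared row length divided by
  \<open>n\<close>. Hence the score bound says that the rescaled rank-one matrices have norm at most
  \<open>R\<close>, and the trace of their mean is the effective dimension. Nonnegativity of the
  scores is a by-product of the same formula.\<close>

lemma concentration_of_scores:
  assumes A: "A \<in> carrier_mat n d" and n: "n > 0" and g: "\<gamma> > 0"
    and eps: "\<epsilon> \<in> {0<..<1/4}" and del: "\<delta> \<in> {0<..<1}"
    and supp: "set_pmf q \<subseteq> {..<n}"
    and score: "\<And>j. j < n \<Longrightarrow> ridge_lev \<gamma> A j \<le> R * pmf q j"
    and big: "real s \<ge> 200 * (R / \<epsilon>\<^sup>2) * ln (max 2 (eff_dim \<gamma> A / \<delta>))"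
  shows "measure_pmf.prob (column_draws s q) {h. (\<forall>c<s. h c < n) \<and>
      (\<forall>v \<in> carrier_vec d. \<forall>w \<in> carrier_vec d.
        \<bar>v \<bullet> (sampled_hessian \<gamma> A (sampling_matrix n s q h) *\<^sub>v w) - v \<bullet> (reg_hessian \<gamma> A *\<^sub>v w)\<bar>
          \<le> \<epsilon> / 2 * (enorm (reg_hessian \<gamma> A) v * enorm (reg_hessian \<gamma> A) w))} \<ge> 1 - \<delta>"
    (is "measure_pmf.prob _ ?Good \<ge> _")
    and "\<And>j. j < n \<Longrightarrow> ridge_lev \<gamma> A j \<ge> 0"
proof -
  let ?H = "reg_hessian \<gamma> A"
  have H: "?H \<in> carrier_mat d d" using A by simp
  have psd: "psd ?H" by (rule reg_hessian_psd(1)[OF A g])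
  then have sym: "transpose_mat ?H = ?H" by (simp add: psd_def)
  have pd: "v \<bullet> (?H *\<^sub>v v) > 0" if "v \<in> carrier_vec d" "v \<bullet> v > 0" for v
    using reg_hessian_psd(2)[OF A g that(1)] g that(2) by (metis mult_pos_pos order_less_le_trans)
  obtain T B where TB: "T \<in> carrier_mat d d" "B \<in> carrier_mat d d" "transpose_mat T = T"
    "transpose_mat B = B" "T * B = 1\<^sub>m d" "B * B = ?H" "?H * (T * T) = 1\<^sub>m d"
    using whitening_exists[OF H sym pd] by blast
  have BT: "B * T = 1\<^sub>m d" by (rule mat_mult_left_right_inverse[OF TB(1,2,5)])
  have TBv: "T *\<^sub>v (B *\<^sub>v v) = v" if "v \<in> carrier_vec d" for v
    using assoc_mult_mat_vec[OF TB(1,2) that] TB(5) that by simp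
  have BTv: "B *\<^sub>v (T *\<^sub>v v) = v" if "v \<in> carrier_vec d" for v
    using assoc_mult_mat_vec[OF TB(2,1) that] BT that by simp
  have cT: "T *\<^sub>v v \<in> carrier_vec d" and cB: "B *\<^sub>v v \<in> carrier_vec d" if "v \<in> carrier_vec d" for v
    using TB(1,2) that by auto
  have T0: "T *\<^sub>v 0\<^sub>v d = 0\<^sub>v d" using TB(1) by (intro eq_vecI) auto
  have BB: "(B *\<^sub>v v) \<bullet> (B *\<^sub>v w) = v \<bullet> (?H *\<^sub>v w)" if "v \<in> carrier_vec d" "w \<in> carrier_vec d" for v w
    using symmetric_scalar_prod[OF TB(2,4) that(1) cB[OF that(2)]] assoc_mult_mat_vec[OF TB(2,2) that(2)] TB(6)
    by simp
  define a where "a j = row A j" for j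
  have a: "a j \<in> carrier_vec d" if "j < n" for j using A that by (auto simp: a_def)
  have TT: "T * T \<in> carrier_mat d d" using TB(1) by auto
  have lev: "ridge_lev \<gamma> A j = (T *\<^sub>v a j) \<bullet> (T *\<^sub>v a j) / real n" if j: "j < n" for j
  proof -
    let ?K = "transpose_mat A * A + (real n * \<gamma>) \<cdot>\<^sub>m 1\<^sub>m d"
    have smult: "b \<cdot>\<^sub>m (c \<cdot>\<^sub>m N) = (b * c) \<cdot>\<^sub>m N" for b c :: real and N by (intro eq_matI) auto
    have one_smult: "1 \<cdot>\<^sub>m N = N" for N :: "real mat" by (intro eq_matI) auto
    have AA: "transpose_mat A * A \<in> carrier_mat d d" using A by auto
    \<comment> \<open>The matrix inside the pseudoinverse is \<open>n\<close> times the Hessian,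
      hence invertible with inverse \<open>(1 / n) * T * T\<close>.\<close>
    have K: "?K = real n \<cdot>\<^sub>m ?H"
      using A AA n by (intro eq_matI) (auto simp: reg_hessian_def algebra_simps)
    have "?K * ((1 / real n) \<cdot>\<^sub>m (T * T)) = 1\<^sub>m d"
      unfolding K using H TT TB(7) n
      by (simp add: mult_smult_assoc_mat[of _ d d _ d] mult_smult_distrib[of _ d d _ d] smult one_smult)
    then have "pinv ?K = (1 / real n) \<cdot>\<^sub>m (T * T)" using AA TT by (intro pinv_eq[of _ d]) auto
    then have "ridge_lev \<gamma> A j = a j \<bullet> (((1 / real n) \<cdot>\<^sub>m (T * T)) *\<^sub>v a j)"
      using A by (simp add: ridge_lev_def a_def)
    also have "\<dots> = (a j \<bullet> (T *\<^sub>v (T *\<^sub>v a j))) / real n"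
      using smult_mat_mult_vec[OF TT a[OF j]] assoc_mult_mat_vec[OF TB(1,1) a[OF j]] cT[OF cT[OF a[OF j]]] a[OF j]
      by simp
    also have "a j \<bullet> (T *\<^sub>v (T *\<^sub>v a j)) = (T *\<^sub>v a j) \<bullet> (T *\<^sub>v a j)"
      by (rule symmetric_scalar_prod[OF TB(1,3) a[OF j] cT[OF a[OF j]]])
    finally show ?thesis .
  qed
  show lev0: "ridge_lev \<gamma> A j \<ge> 0" if "j < n" for j
    using lev[OF that] scalar_prod_self_ge_0[of "T *\<^sub>v a j"] by simp
  have zero: "a j = 0\<^sub>v d" if j: "j < n" and l: "ridge_lev \<gamma> A j \<le> 0" for j
  proof -
    have "(T *\<^sub>v a j) \<bullet> (T *\<^sub>v a j) = 0" using lev[OF j] lev0[OF j] l n by simp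
    then have "T *\<^sub>v a j = 0\<^sub>v d" by (rule scalar_prod_self_eq_0[OF cT[OF a[OF j]]])
    moreover have "B *\<^sub>v 0\<^sub>v d = 0\<^sub>v d" using TB(2) by (intro eq_vecI) auto
    ultimately show ?thesis using BTv[OF a[OF j]] by simp
  qed
  have D: "eff_dim \<gamma> A = (\<Sum>j<n. ridge_lev \<gamma> A j)" using A by (simp add: eff_dim_def)
  have D0: "eff_dim \<gamma> A \<ge> 0" unfolding D by (intro sum_nonneg lev0) simp
  have supp_h: "h c < n" if "h \<in> set_pmf (column_draws s q)" "c < s" for h c
    using that supp unfolding column_draws_def by (subst (asm) set_Pi_pmf) (auto simp: PiE_dflt_def)
  have ge1: "measure_pmf.prob (column_draws s q) S \<le> measure_pmf.prob (column_draws s q) ?Good"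
    if "\<And>h. h \<in> S \<Longrightarrow> h \<in> set_pmf (column_draws s q) \<Longrightarrow> h \<in> ?Good" for S
    using that by (intro measure_pmf.finite_measure_mono_AE) (auto simp: AE_measure_pmf_iff)
  \<comment> \<open>Some index has positive probability, and its score is nonnegative.\<close>
  have R0: "R \<ge> 0"
  proof -
    obtain k where k: "k \<in> set_pmf q" using set_pmf_not_empty by fast
    then have "0 \<le> R * pmf q k" using score[of k] lev0[of k] supp by force
    moreover have "pmf q k > 0" using k by (simp add: pmf_positive)
    ultimately show ?thesis by (simp add: zero_le_mult_iff)
  qed
  show "measure_pmf.prob (column_draws s q) ?Good \<ge> 1 - \<delta>"
  proof (cases "s = 0")
    \<comment> \<open>An empty sample is admissible only for \<open>R = 0\<close>. Then all scores
      vanish, so all rows do, and both Hessians equal \<gamma> times the identity.\<close>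
    case True
    have "max 2 (eff_dim \<gamma> A / \<delta>) \<ge> 2" by simp
    then have ln: "ln (max 2 (eff_dim \<gamma> A / \<delta>)) > 0" by (intro ln_gt_zero) linarith
    have "200 * (R / \<epsilon>\<^sup>2) * ln (max 2 (eff_dim \<gamma> A / \<delta>)) \<le> 0" using big True by simp
    moreover have "200 * (R / \<epsilon>\<^sup>2) * ln (max 2 (eff_dim \<gamma> A / \<delta>)) > 0" if "R > 0"
      using that eps ln by (intro mult_pos_pos divide_pos_pos) auto
    ultimately have "R = 0" using R0 by fastforce
    then have a0: "a j = 0\<^sub>v d" if "j < n" for j using zero[OF that] score[OF that] by simp
    have "h \<in> ?Good" for h
    proof -
      have "v \<bullet> (sampled_hessian \<gamma> A (sampling_matrix n s q h) *\<^sub>v w) = v \<bullet> (?H *\<^sub>v w)"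
        if v: "v \<in> carrier_vec d" and w: "w \<in> carrier_vec d" for v w
      proof -
        have "v \<bullet> (sampled_hessian \<gamma> A (sampling_matrix n s q h) *\<^sub>v w) = \<gamma> * (v \<bullet> w)"
          using sampled_hessian_bilinear[OF A _ v w, of s h \<gamma> q] True by simp
        moreover have "v \<bullet> (?H *\<^sub>v w) = \<gamma> * (v \<bullet> w)"
          using reg_hessian_bilinear[OF A v w, of \<gamma>] a0 v w by (simp add: a_def)
        ultimately show ?thesis by simp
      qed
      moreover have "0 \<le> enorm ?H v" if "v \<in> carrier_vec d" for v
        unfolding enorm_def using psd H that by (auto simp: psd_def)
      ultimately show ?thesis using True eps by auto
    qed
    then have "measure_pmf.prob (column_draws s q) UNIV \<le> measure_pmf.prob (column_draws s q) ?Good"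
      by (intro ge1)
    then show ?thesis using del by simp
  next
    case False
    then have s: "s > 0" by simp
    \<comment> \<open>The division by the root of \<open>n * pmf q j\<close> makes the mean of the
      rank-one matrices the whitened Gram matrix divided by \<open>n\<close>, whatever the sampling
      law.\<close>
    define y where "y j = (1 / sqrt (real n * pmf q j)) \<cdot>\<^sub>v (T *\<^sub>v a j)" for j
    have yv: "y j \<bullet> (B *\<^sub>v v) = (a j \<bullet> v) / sqrt (real n * pmf q j)"
      if j: "j < n" and v: "v \<in> carrier_vec d" for j v
      using symmetric_scalar_prod[OF TB(1,3) a[OF j] cB[OF v]] cT[OF a[OF j]] cB[OF v] TBv[OF v]
      by (simp add: y_def)
    \<comment> \<open>Rows that are never drawn must vanish by the score bound; otherwise the sample
      mean would be biased.\<close>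
    have q0: "a j = 0\<^sub>v d" if "j < n" "pmf q j = 0" for j
      using zero[OF that(1)] score[OF that(1)] that(2) by simp
    have mean: "(\<Sum>k<n. pmf q k * ((y k \<bullet> (B *\<^sub>v v)) * (y k \<bullet> (B *\<^sub>v w))))
        = (\<Sum>k<n. (a k \<bullet> v) * (a k \<bullet> w)) / real n"
      if v: "v \<in> carrier_vec d" and w: "w \<in> carrier_vec d" for v w
      unfolding sum_divide_distrib
    proof (intro sum.cong refl)
      fix k assume "k \<in> {..<n}"
      then have k: "k < n" by simp
      show "pmf q k * ((y k \<bullet> (B *\<^sub>v v)) * (y k \<bullet> (B *\<^sub>v w))) = (a k \<bullet> v) * (a k \<bullet> w) / real n"
      proof (cases "pmf q k = 0")
        case True
        then show ?thesis using q0[OF k] v w by simp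
      next
        case False
        then have "pmf q k > 0" by (simp add: less_le)
        moreover have "sqrt (real n * pmf q k) * sqrt (real n * pmf q k) = real n * pmf q k" by simp
        ultimately show ?thesis using n unfolding yv[OF k v] yv[OF k w] times_divide_times_eq by simp
      qed
    qed
    have norm_y: "pmf q k * (y k \<bullet> y k) = ridge_lev \<gamma> A k" if k: "k < n" for k
    proof (cases "pmf q k = 0")
      case True
      then show ?thesis using lev[OF k] q0[OF k] T0 by simp
    next
      case False
      then have "pmf q k > 0" by (simp add: less_le)
      then show ?thesis using n unfolding lev[OF k] by (simp add: y_def)
    qed
    interpret rank_one_sampling d s n q y R
    proof
      show "s > 0" by fact
      show "set_pmf q \<subseteq> {..<n}" by fact
      show "y k \<in> carrier_vec d" if "k < n" for k using cT[OF a[OF that]] by (simp add: y_def)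
      show "y k \<bullet> y k \<le> R" if k: "k < n" for k
      proof (cases "pmf q k = 0")
        case True
        then show ?thesis using R0 q0[OF k] T0 by (simp add: y_def)
      next
        case False
        then have "pmf q k > 0" by (simp add: less_le)
        moreover have "pmf q k * (y k \<bullet> y k) \<le> pmf q k * R"
          unfolding norm_y[OF k] using score[OF k] by (simp add: mult.commute)
        ultimately show ?thesis by simp
      qed
      show "(\<Sum>k<n. pmf q k * (y k \<bullet> v)\<^sup>2) \<le> v \<bullet> v" if v: "v \<in> carrier_vec d" for v
      proof -
        define u where "u = T *\<^sub>v v"
        have u: "u \<in> carrier_vec d" "B *\<^sub>v u = v" using cT[OF v] BTv[OF v] by (auto simp: u_def)
        have "(\<Sum>k<n. pmf q k * (y k \<bullet> v)\<^sup>2) = (\<Sum>k<n. (a k \<bullet> u) * (a k \<bullet> u)) / real n"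
          using mean[OF u(1) u(1)] by (simp add: u(2) power2_eq_square)
        also have "\<dots> \<le> u \<bullet> (?H *\<^sub>v u)"
          unfolding reg_hessian_bilinear[OF A u(1) u(1)] a_def
          using g scalar_prod_self_ge_0[of u] by simp
        also have "\<dots> = v \<bullet> v" using BB[OF u(1) u(1)] by (simp add: u(2))
        finally show ?thesis .
      qed
    qed
    have trM: "tr M = eff_dim \<gamma> A" unfolding tr_M D using norm_y by simp
    obtain P where P: "P \<ge> 1" "real (2 * P - 1) * R / real s \<le> \<epsilon>\<^sup>2 / 50"
      "(3 * (\<epsilon>\<^sup>2 / 50) / (\<epsilon> / 2)\<^sup>2) ^ P * eff_dim \<gamma> A \<le> \<delta>"
      using chernoff_exponent[OF D0 R0 eps del s big] by blast
    have e3: "\<epsilon>\<^sup>2 / 50 \<le> 1 / 3"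
    proof -
      have "\<epsilon>\<^sup>2 \<le> 1\<^sup>2" using eps by (intro power_mono) auto
      then show ?thesis by simp
    qed
    let ?G = "{h. \<forall>v \<in> carrier_vec d. \<forall>w \<in> carrier_vec d.
      \<bar>v \<bullet> (X h *\<^sub>v w)\<bar> \<le> \<epsilon> / 2 * (vnorm v * vnorm w)}"
    have "1 - \<delta> \<le> measure_pmf.prob (column_draws s q) ?G"
      using concentration[OF P(2) e3 P(1), of "\<epsilon> / 2"] P(3) eps unfolding trM by simp
    also have "\<dots> \<le> measure_pmf.prob (column_draws s q) ?Good"
    proof (rule ge1)
      fix h assume G: "h \<in> ?G" and hs: "h \<in> set_pmf (column_draws s q)"
      have hn: "\<And>c. c < s \<Longrightarrow> h c < n" using supp_h[OF hs] .
      have "\<bar>v \<bullet> (sampled_hessian \<gamma> A (sampling_matrix n s q h) *\<^sub>v w) - v \<bullet> (?H *\<^sub>v w)\<bar>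
          \<le> \<epsilon> / 2 * (enorm ?H v * enorm ?H w)"
        if v: "v \<in> carrier_vec d" and w: "w \<in> carrier_vec d" for v w
      proof -
        have "(\<Sum>c<s. (y (h c) \<bullet> (B *\<^sub>v v)) * (y (h c) \<bullet> (B *\<^sub>v w))) / real s
            = (\<Sum>c<s. (a (h c) \<bullet> v) * (a (h c) \<bullet> w) / (real s * pmf q (h c))) / real n"
          unfolding sum_divide_distrib
        proof (intro sum.cong refl)
          fix c assume "c \<in> {..<s}"
          then have c: "h c < n" using hn by simp
          have "sqrt (real n * pmf q (h c)) * sqrt (real n * pmf q (h c)) = real n * pmf q (h c)" by simp
          then show "(y (h c) \<bullet> (B *\<^sub>v v)) * (y (h c) \<bullet> (B *\<^sub>v w)) / real s
              = (a (h c) \<bullet> v) * (a (h c) \<bullet> w) / (real s * pmf q (h c)) / real n"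
            unfolding yv[OF c v] yv[OF c w] by (simp add: mult_ac)
        qed
        moreover have "(B *\<^sub>v v) \<bullet> (X h *\<^sub>v (B *\<^sub>v w))
            = (\<Sum>c<s. (y (h c) \<bullet> (B *\<^sub>v v)) * (y (h c) \<bullet> (B *\<^sub>v w))) / real s
              - (\<Sum>k<n. pmf q k * ((y k \<bullet> (B *\<^sub>v v)) * (y k \<bullet> (B *\<^sub>v w))))"
          by (rule bilinear_X[OF cB[OF v] cB[OF w]]) (rule hn)
        moreover have "v \<bullet> (sampled_hessian \<gamma> A (sampling_matrix n s q h) *\<^sub>v w)
            = (\<Sum>c<s. (a (h c) \<bullet> v) * (a (h c) \<bullet> w) / (real s * pmf q (h c))) / real n + \<gamma> * (v \<bullet> w)"
          unfolding a_def by (rule sampled_hessian_bilinear[OF A _ v w]) (rule hn)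
        ultimately have "(B *\<^sub>v v) \<bullet> (X h *\<^sub>v (B *\<^sub>v w))
            = v \<bullet> (sampled_hessian \<gamma> A (sampling_matrix n s q h) *\<^sub>v w) - v \<bullet> (?H *\<^sub>v w)"
          using mean[OF v w] reg_hessian_bilinear[OF A v w, of \<gamma>] by (simp add: a_def)
        moreover have "vnorm (B *\<^sub>v u) = enorm ?H u" if "u \<in> carrier_vec d" for u
          using BB[OF that that] by (simp add: vnorm_def enorm_def)
        ultimately show ?thesis using G cB[OF v] cB[OF w] v w by fastforce
      qed
      then show "h \<in> ?Good" using hn by blast
    qed
    finally show ?thesis .
  qed
qed

text \<open>For uniform sampling, coherence times effective dimension is \<open>n\<close> times the
  largest score, so it serves as \<open>R\<close> for probabilities \<open>1 / n\<close>. For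
  leverage score sampling, the score is exactly the effective dimension times the probability. If
  the effective dimension is 0, these quotients degenerate, but then every score is 0.\<close>

lemma sampling_scheme_concentration:
  assumes A: "A \<in> carrier_mat n d" and n: "n > 0" and g: "\<gamma> > 0"
    and eps: "\<epsilon> \<in> {0<..<1/4}" and del: "\<delta> \<in> {0<..<1}"
    and scheme: "sampling_scheme 200 \<gamma> \<epsilon> \<delta> A s q"
  shows "measure_pmf.prob (column_draws s q) {h. (\<forall>c<s. h c < n) \<and>
      (\<forall>v \<in> carrier_vec d. \<forall>w \<in> carrier_vec d.
        \<bar>v \<bullet> (sampled_hessian \<gamma> A (sampling_matrix n s q h) *\<^sub>v w) - v \<bullet> (reg_hessian \<gamma> A *\<^sub>v w)\<bar>
          \<le> \<epsilon> / 2 * (enorm (reg_hessian \<gamma> A) v * enorm (reg_hessian \<gamma> A) w))} \<ge> 1 - \<delta>"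
proof -
  let ?l = "ridge_lev \<gamma> A"
  have D: "eff_dim \<gamma> A = (\<Sum>j<n. ?l j)" using A by (simp add: eff_dim_def)
  have dr: "dim_row A = n" using A by simp
  \<comment> \<open>Crude data for an auxiliary application with uniform probabilities and a
    sufficiently large sample; its sole purpose is to obtain nonnegativity of the scores.\<close>
  define R0 where "R0 = real n * (\<Sum>j<n. \<bar>?l j\<bar>)"
  have l0: "?l j \<ge> 0" if j: "j < n" for j
  proof -
    have le: "?l i \<le> R0 * pmf (pmf_of_set {..<n}) i" if i: "i < n" for i
    proof -
      have "?l i \<le> (\<Sum>j<n. \<bar>?l j\<bar>)"
        using member_le_sum[of i "{..<n}" "\<lambda>j. \<bar>?l j\<bar>"] i by auto
      moreover have "pmf (pmf_of_set {..<n}) i = 1 / real n" using n i by (subst pmf_of_set) auto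
      ultimately show ?thesis using n by (simp add: R0_def)
    qed
    obtain s0 :: nat where s0: "real s0 \<ge> 200 * (R0 / \<epsilon>\<^sup>2) * ln (max 2 (eff_dim \<gamma> A / \<delta>))"
      using real_arch_simple by blast
    have sp: "set_pmf (pmf_of_set {..<n}) \<subseteq> {..<n}" using n by (subst set_pmf_of_set) auto
    show ?thesis by (rule concentration_of_scores(2)[OF A n g eps del sp le s0 j])
  qed
  have zero: "?l j = 0" if "eff_dim \<gamma> A = 0" "j < n" for j
    using that l0 sum_nonneg_eq_0_iff[of "{..<n}" ?l] unfolding D by auto
  from scheme consider
    (U) "uniform_sampling n q"
      "real s \<ge> 200 * (ridge_coherence \<gamma> A * eff_dim \<gamma> A / \<epsilon>\<^sup>2) * ln (max 2 (eff_dim \<gamma> A / \<delta>))"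
    | (L) "ridge_lev_sampling \<gamma> A q"
      "real s \<ge> 200 * (eff_dim \<gamma> A / \<epsilon>\<^sup>2) * ln (max 2 (eff_dim \<gamma> A / \<delta>))"
    unfolding sampling_scheme_def dr by blast
  then show ?thesis
  proof cases
    case U
    show ?thesis
    proof (rule concentration_of_scores(1)[OF A n g eps del _ _ U(2)])
      show "set_pmf q \<subseteq> {..<n}" using U(1) by (simp add: uniform_sampling_def)
      fix j assume j: "j < n"
      have q: "pmf q j = 1 / real n" using U(1) j by (simp add: uniform_sampling_def)
      show "?l j \<le> ridge_coherence \<gamma> A * eff_dim \<gamma> A * pmf q j"
      proof (cases "eff_dim \<gamma> A = 0")
        case True
        then show ?thesis using zero[OF True j] by simp
      next
        case False
        have "?l j \<le> Max (?l ` {..<n})" using j by (intro Max_ge) auto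
        then show ?thesis using False n by (simp add: ridge_coherence_def q dr)
      qed
    qed
  next
    case L
    show ?thesis
    proof (rule concentration_of_scores(1)[OF A n g eps del _ _ L(2)])
      show "set_pmf q \<subseteq> {..<n}" using L(1) by (simp add: ridge_lev_sampling_def dr)
      fix j assume j: "j < n"
      have q: "pmf q j = ?l j / eff_dim \<gamma> A" using L(1) j by (simp add: ridge_lev_sampling_def dr D)
      show "?l j \<le> eff_dim \<gamma> A * pmf q j"
        using zero[of j] j by (cases "eff_dim \<gamma> A = 0") (auto simp: q)
    qed
  qed
qed

subsection \<open>Energy norm\<close>

lemma vnorm_nonneg [simp]: "vnorm v \<ge> 0"
  by (simp add: vnorm_def scalar_prod_self_ge_0)

lemma vnorm_square: "(vnorm v)\<^sup>2 = v \<bullet> v"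
  by (simp add: vnorm_def scalar_prod_self_ge_0)

lemma vnorm_smult: "vnorm (t \<cdot>\<^sub>v v) = \<bar>t\<bar> * vnorm v"
  by (simp add: vnorm_def real_sqrt_mult power2_eq_square[symmetric] mult.assoc[symmetric])

lemma vnorm_triangle:
  assumes "v \<in> carrier_vec d" "w \<in> carrier_vec d"
  shows "vnorm (v + w) \<le> vnorm v + vnorm w"
proof (rule power2_le_imp_le)
  have "(vnorm (v + w))\<^sup>2 = v \<bullet> v + 2 * (v \<bullet> w) + w \<bullet> w"
    using assms comm_scalar_prod[OF assms]
    by (simp add: vnorm_square add_scalar_prod_distrib[of _ d] scalar_prod_add_distrib[of _ d])
  also have "\<dots> \<le> v \<bullet> v + 2 * (vnorm v * vnorm w) + w \<bullet> w"
    using Cauchy_Schwarz_scalar_prod[OF assms] by linarith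
  also have "\<dots> = (vnorm v + vnorm w)\<^sup>2" by (simp add: power2_sum vnorm_square)
  finally show "(vnorm (v + w))\<^sup>2 \<le> (vnorm v + vnorm w)\<^sup>2" .
qed simp

lemma enorm_eq_vnorm:
  assumes "psd H" "H \<in> carrier_mat d d" "v \<in> carrier_vec d"
  shows "enorm H v = vnorm (psd_sqrt H *\<^sub>v v)"
  unfolding enorm_def vnorm_psd_sqrt[OF assms] ..

lemma enorm_nonneg: "psd H \<Longrightarrow> H \<in> carrier_mat d d \<Longrightarrow> v \<in> carrier_vec d \<Longrightarrow> enorm H v \<ge> 0"
  by (simp add: enorm_eq_vnorm)

lemma enorm_square: "psd H \<Longrightarrow> H \<in> carrier_mat d d \<Longrightarrow> v \<in> carrier_vec d \<Longrightarrow> (enorm H v)\<^sup>2 = v \<bullet> (H *\<^sub>v v)"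
  by (auto simp: enorm_def psd_def)

lemma enorm_triangle:
  assumes "psd H" "H \<in> carrier_mat d d" "v \<in> carrier_vec d" "w \<in> carrier_vec d"
  shows "enorm H (v + w) \<le> enorm H v + enorm H w"
proof -
  have R: "psd_sqrt H \<in> carrier_mat d d" by (rule psd_sqrt_props(3)[OF assms(1,2)])
  show ?thesis
    using vnorm_triangle[of "psd_sqrt H *\<^sub>v v" d "psd_sqrt H *\<^sub>v w"] assms R
    by (simp add: enorm_eq_vnorm[of _ d] mult_add_distrib_mat_vec[of _ d d])
qed

lemma enorm_minus_triangle:
  assumes "psd H" "H \<in> carrier_mat d d" "v \<in> carrier_vec d" "w \<in> carrier_vec d"
  shows "enorm H (v - w) \<le> enorm H v + enorm H w"
proof -
  have R: "psd_sqrt H \<in> carrier_mat d d" by (rule psd_sqrt_props(3)[OF assms(1,2)])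
  have Rw: "psd_sqrt H *\<^sub>v w \<in> carrier_vec d" using R assms by auto
  have eq: "v - w = v + (- 1) \<cdot>\<^sub>v w" using assms by (intro eq_vecI) auto
  have "enorm H ((- 1) \<cdot>\<^sub>v w) = enorm H w"
    using assms R Rw vnorm_smult[of "- 1" "psd_sqrt H *\<^sub>v w"]
    by (simp add: enorm_eq_vnorm[of _ d] mult_mat_vec[of _ d d])
  then show ?thesis unfolding eq using enorm_triangle[OF assms(1,2,3), of "(- 1) \<cdot>\<^sub>v w"] assms(4) by simp
qed

subsection \<open>One proximal step\<close>

lemma one_sided_minimum_derivative:
  fixes f :: "real \<Rightarrow> real"
  assumes "(f has_real_derivative a) (at 0)" "\<And>t. 0 < t \<Longrightarrow> t \<le> 1 \<Longrightarrow> f 0 \<le> f t"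
  shows "a \<ge> 0"
proof (rule ccontr)
  assume "\<not> a \<ge> 0"
  then obtain e where e: "e > 0" "\<And>t. 0 < t \<Longrightarrow> t < e \<Longrightarrow> f (0 + t) < f 0"
    using DERIV_neg_dec_right[OF assms(1)] by fastforce
  define t where "t = min (e / 2) 1"
  have "0 < t" "t < e" "t \<le> 1" using e(1) by (auto simp: t_def)
  then show False using e(2)[of t] assms(2)[of t] by simp
qed

lemma convex_vec_segment:
  assumes "convex_vec d r" and z: "z \<in> carrier_vec d" and u: "u \<in> carrier_vec d" and t: "0 \<le> t" "t \<le> 1"
  shows "r (z + t \<cdot>\<^sub>v (u - z)) \<le> r z + t * (r u - r z)"
proof -
  have "z + t \<cdot>\<^sub>v (u - z) = t \<cdot>\<^sub>v u + (1 - t) \<cdot>\<^sub>v z"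
    using z u by (intro eq_vecI) (auto simp: algebra_simps)
  moreover have "r (t \<cdot>\<^sub>v u + (1 - t) \<cdot>\<^sub>v z) \<le> t * r u + (1 - t) * r z"
    using assms unfolding convex_vec_def by auto
  ultimately show ?thesis by (simp add: algebra_simps)
qed

text \<open>A variational inequality in place of a subgradient inclusion. On the segment towards
  \<open>u\<close> the convex \<open>r\<close> lies below its chord; replacing it by the chord gives
  a differentiable upper model that agrees with the objective at the minimiser, so its one-sided
  derivative there is nonnegative.\<close>

lemma subproblem_optimality:
  assumes Ht: "Ht \<in> carrier_mat d d" and sym: "transpose_mat Ht = Ht" and g: "g \<in> carrier_vec d"
    and r: "convex_vec d r" and w: "w \<in> carrier_vec d"
    and p: "is_arg_min (subproblem Ht g r w) (\<lambda>q. q \<in> carrier_vec d) p" and u: "u \<in> carrier_vec d"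
  shows "0 \<le> g \<bullet> (u - (w - p)) - (u - (w - p)) \<bullet> (Ht *\<^sub>v p) + (r u - r (w - p))"
proof -
  have pc: "p \<in> carrier_vec d" and min: "\<And>y. y \<in> carrier_vec d \<Longrightarrow> subproblem Ht g r w p \<le> subproblem Ht g r w y"
    using p unfolding is_arg_min_def by (auto simp: not_less)
  define z where "z = w - p"
  define D where "D = u - z"
  have z: "z \<in> carrier_vec d" using w pc by (auto simp: z_def)
  have D: "D \<in> carrier_vec d" using u z by (auto simp: D_def)
  have HD: "Ht *\<^sub>v D \<in> carrier_vec d" and Hp: "Ht *\<^sub>v p \<in> carrier_vec d" using Ht D pc by auto
  define f where "f t = t * (g \<bullet> D - D \<bullet> (Ht *\<^sub>v p) + (r u - r z)) + t * t * (D \<bullet> (Ht *\<^sub>v D) / 2)" for t :: real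
  have "(f has_real_derivative (g \<bullet> D - D \<bullet> (Ht *\<^sub>v p) + (r u - r z))) (at 0)"
    unfolding f_def by (auto intro!: derivative_eq_intros)
  moreover have "f 0 \<le> f t" if t: "0 < t" "t \<le> 1" for t
  proof -
    define y where "y = p - t \<cdot>\<^sub>v D"
    have tD: "t \<cdot>\<^sub>v D \<in> carrier_vec d" using D by simp
    have y: "y \<in> carrier_vec d" using pc D by (auto simp: y_def)
    have wy: "w - y = z + t \<cdot>\<^sub>v (u - z)"
      using w pc z u by (intro eq_vecI) (auto simp: y_def z_def D_def)
    have Hy: "Ht *\<^sub>v y = Ht *\<^sub>v p - t \<cdot>\<^sub>v (Ht *\<^sub>v D)"
      using Ht pc tD D by (simp add: y_def mult_minus_distrib_mat_vec[of _ d d] mult_mat_vec[of _ d d])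
    have pHD: "p \<bullet> (Ht *\<^sub>v D) = D \<bullet> (Ht *\<^sub>v p)"
      using symmetric_scalar_prod[OF Ht sym pc D] comm_scalar_prod[OF Hp D] by simp
    have yy: "y \<bullet> (Ht *\<^sub>v y) = p \<bullet> (Ht *\<^sub>v p) - 2 * t * (D \<bullet> (Ht *\<^sub>v p)) + t * t * (D \<bullet> (Ht *\<^sub>v D))"
      unfolding Hy using pc D HD Hp pHD
      by (simp add: y_def scalar_prod_minus_distrib[of _ d] minus_scalar_prod_distrib[of _ d] algebra_simps)
    have gy: "g \<bullet> y = g \<bullet> p - t * (g \<bullet> D)"
      using g pc D by (simp add: y_def scalar_prod_minus_distrib[of _ d])
    have rz: "r (w - y) \<le> r z + t * (r u - r z)"
      unfolding wy using t by (intro convex_vec_segment[OF r z u]) auto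
    have "subproblem Ht g r w p \<le> subproblem Ht g r w y" by (rule min[OF y])
    then have "p \<bullet> (Ht *\<^sub>v p) / 2 - g \<bullet> p + r z \<le> y \<bullet> (Ht *\<^sub>v y) / 2 - g \<bullet> y + r (w - y)"
      unfolding subproblem_def z_def by (simp add: algebra_simps)
    then show ?thesis using rz unfolding yy gy f_def by (simp add: algebra_simps add_divide_distrib diff_divide_distrib)
  qed
  ultimately show ?thesis unfolding D_def z_def by (rule one_sided_minimum_derivative)
qed

text \<open>Moves the inexactness condition from the sampled norm to the exact one. Both factors
  \<open>1 - \<epsilon> / 2\<close> and \<open>1 + \<epsilon> / 2\<close> lie between 7/8 and 9/8,
  and half the square root of 9/7 is slightly below 23/40.\<close>

lemma perturbed_norm_ratio:
  fixes \<epsilon> :: real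
  assumes eps: "0 < \<epsilon>" "\<epsilon> < 1 / 4" and x: "x \<ge> 0" and y: "y \<ge> 0" and e0: "e0 \<ge> 0"
    and lower: "(1 - \<epsilon> / 2) * x\<^sup>2 \<le> a\<^sup>2" and upper: "b\<^sup>2 \<le> (1 + \<epsilon> / 2) * y\<^sup>2"
    and ab: "0 \<le> a" "0 \<le> b" "a \<le> e0 / 2 * b"
  shows "x \<le> 23 / 40 * e0 * y"
proof (rule power2_le_imp_le)
  have "a\<^sup>2 \<le> (e0 / 2 * b)\<^sup>2" using ab by (intro power_mono) auto
  then have "(1 - \<epsilon> / 2) * x\<^sup>2 \<le> e0\<^sup>2 / 4 * b\<^sup>2" using lower by (simp add: power_mult_distrib power_divide)
  also have "\<dots> \<le> e0\<^sup>2 / 4 * ((1 + \<epsilon> / 2) * y\<^sup>2)" using upper by (intro mult_left_mono) auto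
  also have "\<dots> \<le> e0\<^sup>2 / 4 * ((9 / 8) * y\<^sup>2)" using eps by (intro mult_left_mono mult_right_mono) auto
  finally have 1: "(1 - \<epsilon> / 2) * x\<^sup>2 \<le> e0\<^sup>2 / 4 * ((9 / 8) * y\<^sup>2)" .
  have "7 / 8 * x\<^sup>2 \<le> (1 - \<epsilon> / 2) * x\<^sup>2" using eps by (intro mult_right_mono) auto
  with 1 have "x\<^sup>2 \<le> 9 / 28 * (e0\<^sup>2 * y\<^sup>2)" by simp
  also have "\<dots> \<le> (23 / 40)\<^sup>2 * (e0\<^sup>2 * y\<^sup>2)" by (intro mult_right_mono) (auto simp: power2_eq_square)
  also have "\<dots> = (23 / 40 * e0 * y)\<^sup>2" by (simp only: power_mult_distrib mult.assoc)
  finally show "x\<^sup>2 \<le> (23 / 40 * e0 * y)\<^sup>2" .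
qed (use y e0 in simp)

text \<open>
  \<open>g\<close> and \<open>g'\<close> are the gradients of the smooth part at \<open>w\<close> and at the minimiser \<open>w'\<close>; \<open>b\<close> bounds the
  error of the linearisation of the gradient, which vanishes for quadratic losses.
\<close>

lemma prox_newton_step:
  assumes H: "H \<in> carrier_mat d d" and psdH: "psd H" and Ht: "Ht \<in> carrier_mat d d" and psdHt: "psd Ht"
    and close: "\<And>u v. u \<in> carrier_vec d \<Longrightarrow> v \<in> carrier_vec d \<Longrightarrow>
      \<bar>u \<bullet> (Ht *\<^sub>v v) - u \<bullet> (H *\<^sub>v v)\<bar> \<le> \<epsilon> / 2 * (enorm H u * enorm H v)"
    and eps: "\<epsilon> \<in> {0<..<1/4}" and e0: "e0 \<in> {0<..<1}" and b0: "b \<ge> 0"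
    and r: "convex_vec d r" and w: "w \<in> carrier_vec d" and w': "w' \<in> carrier_vec d"
    and g: "g \<in> carrier_vec d" and g': "g' \<in> carrier_vec d"
    and opt: "\<And>u. u \<in> carrier_vec d \<Longrightarrow> 0 \<le> g' \<bullet> (u - w') + (r u - r w')"
    and resid: "\<And>e. e \<in> carrier_vec d \<Longrightarrow> e \<bullet> (H *\<^sub>v (w - w')) - (g - g') \<bullet> e \<le> b * enorm H e"
    and upd: "sspn_update d Ht g r e0 w v"
  shows "v \<in> carrier_vec d" "enorm H (v - w') \<le> (\<epsilon> + e0) * enorm H (w - w') + 2 * b"
proof -
  have symt: "transpose_mat Ht = Ht" using psdHt by (simp add: psd_def)
  obtain p p' where p: "is_arg_min (subproblem Ht g r w) (\<lambda>q. q \<in> carrier_vec d) p"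
    and p': "p' \<in> carrier_vec d" and inexact: "vnorm (psd_sqrt Ht *\<^sub>v (p - p')) \<le> e0 / 2 * vnorm (psd_sqrt Ht *\<^sub>v p)"
    and v: "v = w - p'"
    using upd unfolding sspn_update_def by blast
  have pc: "p \<in> carrier_vec d" using p by (simp add: is_arg_min_def)
  show "v \<in> carrier_vec d" using w p' by (auto simp: v)
  define \<Delta> where "\<Delta> = w - w'"
  define e where "e = (w - p) - w'"
  have z: "w - p \<in> carrier_vec d" using w pc by auto
  have D: "\<Delta> \<in> carrier_vec d" and e: "e \<in> carrier_vec d" using w w' z by (auto simp: \<Delta>_def e_def)
  have pe: "p = \<Delta> - e" using w w' pc by (intro eq_vecI) (auto simp: \<Delta>_def e_def)
  have HtD: "Ht *\<^sub>v \<Delta> \<in> carrier_vec d" and Hte: "Ht *\<^sub>v e \<in> carrier_vec d" using Ht D e by auto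
  define E where "E = enorm H e"
  define N where "N = enorm H \<Delta>"
  have E0: "E \<ge> 0" and N0: "N \<ge> 0" using enorm_nonneg[OF psdH H] D e by (auto simp: E_def N_def)
  have we: "w' - (w - p) = - e" using w w' pc by (intro eq_vecI) (auto simp: e_def)
  \<comment> \<open>The subproblem is tested at the minimiser \<open>w'\<close>, the full problem at
    the exact step \<open>w - p\<close>. In the sum of the two inequalities the values of
    \<open>r\<close> cancel.\<close>
  have "0 \<le> g \<bullet> (w' - (w - p)) - (w' - (w - p)) \<bullet> (Ht *\<^sub>v p) + (r w' - r (w - p))"
    by (rule subproblem_optimality[OF Ht symt g r w p w'])
  moreover have "0 \<le> g' \<bullet> e + (r (w - p) - r w')" using opt[OF z] by (simp add: e_def)
  moreover have "g \<bullet> (- e) = - (g \<bullet> e)" using g e by simp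
  moreover have "(- e) \<bullet> (Ht *\<^sub>v p) = - (e \<bullet> (Ht *\<^sub>v p))" using Ht e pc by simp
  ultimately have "0 \<le> - (g \<bullet> e) + e \<bullet> (Ht *\<^sub>v p) + g' \<bullet> e" unfolding we by simp
  moreover have "(g - g') \<bullet> e = g \<bullet> e - g' \<bullet> e" by (rule minus_scalar_prod_distrib[OF g g' e])
  moreover have "e \<bullet> (Ht *\<^sub>v p) = e \<bullet> (Ht *\<^sub>v \<Delta>) - e \<bullet> (Ht *\<^sub>v e)"
    unfolding pe using Ht D e HtD Hte
    by (simp add: mult_minus_distrib_mat_vec[of _ d d] scalar_prod_minus_distrib[of _ d])
  ultimately have 1: "e \<bullet> (Ht *\<^sub>v e) \<le> e \<bullet> (Ht *\<^sub>v \<Delta>) - (g - g') \<bullet> e" by simp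
  have quad: "(1 - \<epsilon> / 2) * (enorm H u)\<^sup>2 \<le> u \<bullet> (Ht *\<^sub>v u)" "u \<bullet> (Ht *\<^sub>v u) \<le> (1 + \<epsilon> / 2) * (enorm H u)\<^sup>2"
    if u: "u \<in> carrier_vec d" for u
  proof -
    have "\<bar>u \<bullet> (Ht *\<^sub>v u) - (enorm H u)\<^sup>2\<bar> \<le> \<epsilon> / 2 * (enorm H u)\<^sup>2"
      using close[OF u u] unfolding enorm_square[OF psdH H u, symmetric] by (simp only: power2_eq_square)
    then show "(1 - \<epsilon> / 2) * (enorm H u)\<^sup>2 \<le> u \<bullet> (Ht *\<^sub>v u)" "u \<bullet> (Ht *\<^sub>v u) \<le> (1 + \<epsilon> / 2) * (enorm H u)\<^sup>2"
      unfolding abs_le_iff left_diff_distrib distrib_right by linarith+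
  qed
  have "(1 - \<epsilon> / 2) * E\<^sup>2 \<le> e \<bullet> (H *\<^sub>v \<Delta>) + \<epsilon> / 2 * (E * N) - (g - g') \<bullet> e"
    using 1 quad(1)[OF e] close[OF e D] unfolding E_def N_def abs_le_iff by linarith
  also have "\<dots> \<le> \<epsilon> / 2 * (E * N) + b * E" using resid[OF e] unfolding \<Delta>_def E_def by linarith
  \<comment> \<open>Every term on the right carries the factor \<open>E\<close>, so the quadratic
    inequality for the new error becomes linear after cancellation.\<close>
  finally have "E * ((1 - \<epsilon> / 2) * E) \<le> E * (\<epsilon> / 2 * N + b)" by (simp add: power2_eq_square algebra_simps)
  then have 2: "(1 - \<epsilon> / 2) * E \<le> \<epsilon> / 2 * N + b"
  proof (cases "E = 0")
    case True
    then show ?thesis using N0 b0 eps by simp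
  next
    case False
    then have "E > 0" using E0 by simp
    then show ?thesis using \<open>E * ((1 - \<epsilon> / 2) * E) \<le> E * (\<epsilon> / 2 * N + b)\<close> by simp
  qed
  have "7 / 8 * E \<le> (1 - \<epsilon> / 2) * E" using eps E0 by (intro mult_right_mono) auto
  with 2 have 3: "E \<le> 4 / 7 * (\<epsilon> * N) + 8 / 7 * b" by simp
  have pp: "p - p' \<in> carrier_vec d" using pc p' by auto
  have 4: "enorm H (p - p') \<le> 23 / 40 * e0 * enorm H p"
  proof (rule perturbed_norm_ratio[where \<epsilon> = \<epsilon>])
    show "enorm Ht (p - p') \<le> e0 / 2 * enorm Ht p"
      using inexact by (simp add: enorm_eq_vnorm[OF psdHt Ht] pc pp)
    show "(1 - \<epsilon> / 2) * (enorm H (p - p'))\<^sup>2 \<le> (enorm Ht (p - p'))\<^sup>2"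
      unfolding enorm_square[OF psdHt Ht pp] by (rule quad(1)[OF pp])
    show "(enorm Ht p)\<^sup>2 \<le> (1 + \<epsilon> / 2) * (enorm H p)\<^sup>2"
      unfolding enorm_square[OF psdHt Ht pc] by (rule quad(2)[OF pc])
  qed (use eps e0 enorm_nonneg[OF psdH H] enorm_nonneg[OF psdHt Ht] pc pp in auto)
  have 5: "enorm H p \<le> N + E"
    unfolding N_def E_def pe by (rule enorm_minus_triangle[OF psdH H D e])
  have "v - w' = e + (p - p')" using w w' pc p' by (intro eq_vecI) (auto simp: v e_def)
  then have "enorm H (v - w') \<le> E + enorm H (p - p')"
    unfolding E_def using enorm_triangle[OF psdH H e pp] by simp
  also have "\<dots> \<le> E + 23 / 40 * e0 * (N + E)"
  proof -
    have "23 / 40 * e0 * enorm H p \<le> 23 / 40 * e0 * (N + E)" using 5 e0 by (intro mult_left_mono) auto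
    then show ?thesis using 4 by linarith
  qed
  also have "\<dots> = (1 + 23 / 40 * e0) * E + 23 / 40 * (e0 * N)" by (simp add: algebra_simps)
  also have "\<dots> \<le> (1 + 23 / 40) * E + e0 * N"
    using e0 E0 N0 by (intro add_mono mult_right_mono) auto
  also have "\<dots> \<le> (1 + 23 / 40) * (4 / 7 * (\<epsilon> * N) + 8 / 7 * b) + e0 * N"
    by (intro add_right_mono mult_left_mono 3) simp
  \<comment> \<open>Here 63/40 * 4/7 = 9/10 and 63/40 * 8/7 = 9/5, which stay below the factors 1
    and 2 of the claim.\<close>
  also have "\<dots> \<le> (\<epsilon> + e0) * N + 2 * b"
  proof -
    have "0 \<le> \<epsilon> * N" using N0 eps by simp
    then show ?thesis using b0 by (simp add: algebra_simps)
  qed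
  finally show "enorm H (v - w') \<le> (\<epsilon> + e0) * enorm H (w - w') + 2 * b" unfolding N_def \<Delta>_def .
qed

subsection \<open>Derivatives of the smooth part\<close>

text \<open>Comparing the tangents at two points shows that the first derivative is monotone. The
  result ensures that the square roots in \<open>weighted_data\<close> square back to the second
  derivatives.\<close>

lemma convex_second_derivative_nonneg:
  assumes c: "convex_on UNIV f" and f: "twice_differentiable f"
  shows "deriv (deriv f) z \<ge> 0"
proof -
  have d1: "(f has_real_derivative deriv f x) (at x)" for x
    using f unfolding twice_differentiable_def by (metis DERIV_deriv_iff_real_differentiable)
  have d2: "(deriv f has_real_derivative deriv (deriv f) x) (at x)" for x
    using f unfolding twice_differentiable_def by (metis DERIV_deriv_iff_real_differentiable)
  have tangent: "deriv f x * (y - x) \<le> f y - f x" for x y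
    using convex_on_imp_above_tangent[OF c, of x y "deriv f x"] d1[of x] by simp
  have "mono_on UNIV (deriv f)"
  proof (rule mono_onI)
    fix x y :: real assume "x \<le> y"
    have "deriv f x * (y - x) \<le> deriv f y * (y - x)"
      using tangent[of x y] tangent[of y x] by (simp add: algebra_simps)
    then show "deriv f x \<le> deriv f y" using \<open>x \<le> y\<close>
      by (cases "x = y") (auto simp: mult_le_cancel_right)
  qed
  then show ?thesis using mono_on_imp_deriv_nonneg[OF _ d2[of z], of UNIV] by simp
qed

locale regularized_losses =
  fixes n d :: nat and x :: "nat \<Rightarrow> real vec" and l :: "nat \<Rightarrow> real \<Rightarrow> real" and \<gamma> :: real
  assumes n: "0 < n" and dpos: "0 < d" and x: "\<And>j. j < n \<Longrightarrow> x j \<in> carrier_vec d" and \<gamma>: "\<gamma> > 0"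
    and l_convex: "\<And>j. j < n \<Longrightarrow> convex_on UNIV (l j)"
    and l_diff: "\<And>j. j < n \<Longrightarrow> twice_differentiable (l j)"
begin

abbreviation F :: "real vec \<Rightarrow> real" where "F \<equiv> smooth_part n x l \<gamma>"

abbreviation A :: "real vec \<Rightarrow> real mat" where "A \<equiv> weighted_data n d x l"

text \<open>The directional derivative of \<open>F\<close> at \<open>w\<close> along
  \<open>e\<close> in closed form; \<open>curvature\<close> is likewise the bilinear form of the
  Hessian. Working with these forms along lines reduces all differentiation to one real
  variable.\<close>

definition slope :: "real vec \<Rightarrow> real vec \<Rightarrow> real" where
  "slope w e = (\<Sum>j<n. deriv (l j) (x j \<bullet> w) * (x j \<bullet> e)) / real n + \<gamma> * (w \<bullet> e)"

definition curvature :: "real vec \<Rightarrow> real vec \<Rightarrow> real vec \<Rightarrow> real" where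
  "curvature w v e = (\<Sum>j<n. deriv (deriv (l j)) (x j \<bullet> w) * (x j \<bullet> v) * (x j \<bullet> e)) / real n + \<gamma> * (v \<bullet> e)"

lemma l_deriv: "j < n \<Longrightarrow> (l j has_real_derivative deriv (l j) z) (at z)"
  using l_diff unfolding twice_differentiable_def by (metis DERIV_deriv_iff_real_differentiable)

lemma l_deriv2: "j < n \<Longrightarrow> (deriv (l j) has_real_derivative deriv (deriv (l j)) z) (at z)"
  using l_diff unfolding twice_differentiable_def by (metis DERIV_deriv_iff_real_differentiable)

lemma inner_line:
  fixes u v w :: "real vec"
  assumes "u \<in> carrier_vec d" "w \<in> carrier_vec d" "v \<in> carrier_vec d"
  shows "u \<bullet> (w + t \<cdot>\<^sub>v v) = u \<bullet> w + t * (u \<bullet> v)"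
  using assms by (simp add: scalar_prod_add_distrib[of _ d] scalar_prod_smult_distrib[of _ d])

lemma F_line_derivative:
  assumes w: "w \<in> carrier_vec d" and v: "v \<in> carrier_vec d"
  shows "((\<lambda>t. F (w + t \<cdot>\<^sub>v v)) has_real_derivative slope (w + t \<cdot>\<^sub>v v) v) (at t)"
proof -
  have F: "F (w + t \<cdot>\<^sub>v v) = (\<Sum>j<n. l j (x j \<bullet> w + t * (x j \<bullet> v))) / real n
      + \<gamma> / 2 * (w \<bullet> w + 2 * t * (w \<bullet> v) + t * t * (v \<bullet> v))" for t
    unfolding smooth_part_def vnorm_square using w v comm_scalar_prod[OF w v]
    by (simp add: inner_line[OF x w v] add_scalar_prod_distrib[of _ d] scalar_prod_add_distrib[of _ d]
      algebra_simps)
  have summand: "((\<lambda>t. l j (x j \<bullet> w + t * (x j \<bullet> v))) has_real_derivative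
      deriv (l j) (x j \<bullet> (w + t \<cdot>\<^sub>v v)) * (x j \<bullet> v)) (at t)" if "j < n" for j t
    unfolding inner_line[OF x[OF that] w v]
    by (rule DERIV_chain2[OF l_deriv[OF that]]) (auto intro!: derivative_eq_intros)
  have wv: "(w + t \<cdot>\<^sub>v v) \<bullet> v = w \<bullet> v + t * (v \<bullet> v)"
    using w v by (simp add: add_scalar_prod_distrib[of _ d])
  have "((\<lambda>t. (\<Sum>j<n. l j (x j \<bullet> w + t * (x j \<bullet> v))) / real n) has_real_derivative
      (\<Sum>j<n. deriv (l j) (x j \<bullet> (w + t \<cdot>\<^sub>v v)) * (x j \<bullet> v)) / real n) (at t)"
    by (intro DERIV_cdivide DERIV_sum summand) auto
  moreover have "((\<lambda>t. \<gamma> / 2 * (w \<bullet> w + 2 * t * (w \<bullet> v) + t * t * (v \<bullet> v))) has_real_derivative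
      \<gamma> * (w \<bullet> v + t * (v \<bullet> v))) (at t)"
    by (auto intro!: derivative_eq_intros simp: algebra_simps)
  ultimately show ?thesis unfolding F slope_def wv by (rule DERIV_add)
qed

lemma slope_line_derivative:
  assumes w: "w \<in> carrier_vec d" and v: "v \<in> carrier_vec d" and e: "e \<in> carrier_vec d"
  shows "((\<lambda>t. slope (w + t \<cdot>\<^sub>v v) e) has_real_derivative curvature (w + t \<cdot>\<^sub>v v) v e) (at t)"
proof -
  have S: "slope (w + t \<cdot>\<^sub>v v) e = (\<Sum>j<n. deriv (l j) (x j \<bullet> w + t * (x j \<bullet> v)) * (x j \<bullet> e)) / real n
      + \<gamma> * (w \<bullet> e + t * (v \<bullet> e))" for t
    unfolding slope_def using w v e
    by (simp add: inner_line[OF x w v] add_scalar_prod_distrib[of _ d])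
  have summand: "((\<lambda>t. deriv (l j) (x j \<bullet> w + t * (x j \<bullet> v)) * (x j \<bullet> e)) has_real_derivative
      deriv (deriv (l j)) (x j \<bullet> (w + t \<cdot>\<^sub>v v)) * (x j \<bullet> v) * (x j \<bullet> e)) (at t)" if "j < n" for j t
    unfolding inner_line[OF x[OF that] w v]
    by (rule DERIV_cmult_right, rule DERIV_chain2[OF l_deriv2[OF that]]) (auto intro!: derivative_eq_intros)
  have "((\<lambda>t. (\<Sum>j<n. deriv (l j) (x j \<bullet> w + t * (x j \<bullet> v)) * (x j \<bullet> e)) / real n) has_real_derivative
      (\<Sum>j<n. deriv (deriv (l j)) (x j \<bullet> (w + t \<cdot>\<^sub>v v)) * (x j \<bullet> v) * (x j \<bullet> e)) / real n) (at t)"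
    by (intro DERIV_cdivide DERIV_sum summand) auto
  moreover have "((\<lambda>t. \<gamma> * (w \<bullet> e + t * (v \<bullet> e))) has_real_derivative \<gamma> * (v \<bullet> e)) (at t)"
    by (auto intro!: derivative_eq_intros)
  ultimately show ?thesis unfolding S curvature_def by (rule DERIV_add)
qed

lemma partial_F:
  assumes w: "w \<in> carrier_vec d" and i: "i < d"
  shows "partial i F w = slope w (unit_vec d i)"
proof -
  have "((\<lambda>t. F (w + t \<cdot>\<^sub>v unit_vec d i)) has_real_derivative slope (w + 0 \<cdot>\<^sub>v unit_vec d i) (unit_vec d i)) (at 0)"
    using w by (intro F_line_derivative) auto
  moreover have "w + 0 \<cdot>\<^sub>v unit_vec d i = w" using w by (intro eq_vecI) auto
  ultimately show ?thesis unfolding partial_def using w by (simp add: DERIV_imp_deriv)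
qed

lemma grad_carrier [simp]: "grad d f w \<in> carrier_vec d"
  by (simp add: grad_def)

lemma grad_scalar_prod:
  assumes w: "w \<in> carrier_vec d" and e: "e \<in> carrier_vec d"
  shows "grad d F w \<bullet> e = slope w e"
proof -
  have "grad d F w \<bullet> e = (\<Sum>i<d. slope w (unit_vec d i) * e $ i)"
    using e by (auto simp: grad_def scalar_prod_def lessThan_atLeast0 partial_F[OF w] intro!: sum.cong)
  also have "\<dots> = (\<Sum>i<d. (\<Sum>j<n. deriv (l j) (x j \<bullet> w) * (x j $ i * e $ i)) / real n + \<gamma> * (w $ i * e $ i))"
    using w x by (intro sum.cong refl) (auto simp: slope_def sum_distrib_left sum_distrib_right sum_divide_distrib algebra_simps)
  also have "\<dots> = (\<Sum>i<d. \<Sum>j<n. deriv (l j) (x j \<bullet> w) * (x j $ i * e $ i)) / real n + \<gamma> * (w \<bullet> e)"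
    using e by (simp add: sum.distrib sum_divide_distrib sum_distrib_left scalar_prod_def lessThan_atLeast0)
  also have "(\<Sum>i<d. \<Sum>j<n. deriv (l j) (x j \<bullet> w) * (x j $ i * e $ i)) = (\<Sum>j<n. deriv (l j) (x j \<bullet> w) * (x j \<bullet> e))"
    using e by (subst sum.swap) (simp add: scalar_prod_def lessThan_atLeast0 sum_distrib_left)
  finally show ?thesis unfolding slope_def .
qed

lemma A_carrier [simp]: "A w \<in> carrier_mat n d"
  by (simp add: weighted_data_def)

lemma row_A: "j < n \<Longrightarrow> v \<in> carrier_vec d \<Longrightarrow> row (A w) j \<bullet> v = sqrt (deriv (deriv (l j)) (x j \<bullet> w)) * (x j \<bullet> v)"
  by (auto simp: weighted_data_def scalar_prod_def sum_distrib_left intro!: sum.cong)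

lemma reg_hessian_curvature:
  assumes v: "v \<in> carrier_vec d" and e: "e \<in> carrier_vec d"
  shows "v \<bullet> (reg_hessian \<gamma> (A w) *\<^sub>v e) = curvature w v e"
proof -
  have "(row (A w) j \<bullet> v) * (row (A w) j \<bullet> e) = deriv (deriv (l j)) (x j \<bullet> w) * (x j \<bullet> v) * (x j \<bullet> e)"
    if j: "j < n" for j
  proof -
    have "sqrt (deriv (deriv (l j)) (x j \<bullet> w)) * sqrt (deriv (deriv (l j)) (x j \<bullet> w)) = deriv (deriv (l j)) (x j \<bullet> w)"
      using convex_second_derivative_nonneg[OF l_convex[OF j] l_diff[OF j]] by simp
    then show ?thesis unfolding row_A[OF j v] row_A[OF j e] by (metis mult.assoc mult.left_commute)
  qed
  then show ?thesis unfolding reg_hessian_bilinear[OF A_carrier v e] curvature_def by simp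
qed

lemma hessian_eq:
  assumes w: "w \<in> carrier_vec d"
  shows "hessian d F w = reg_hessian \<gamma> (A w)"
proof (rule eq_matI)
  have K: "reg_hessian \<gamma> (A w) \<in> carrier_mat d d" by (rule reg_hessian_carrier[OF A_carrier])
  fix i j assume "i < dim_row (reg_hessian \<gamma> (A w))" "j < dim_col (reg_hessian \<gamma> (A w))"
  then have i: "i < d" and j: "j < d" using K by auto
  have 0: "w + 0 \<cdot>\<^sub>v unit_vec d i = w" using w by (intro eq_vecI) auto
  have "partial i (partial j F) w = deriv (\<lambda>t. slope (w + t \<cdot>\<^sub>v unit_vec d i) (unit_vec d j)) 0"
    unfolding partial_def[of i] using w j by (simp add: partial_F)
  also have "\<dots> = curvature (w + 0 \<cdot>\<^sub>v unit_vec d i) (unit_vec d i) (unit_vec d j)"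
    using w by (intro DERIV_imp_deriv slope_line_derivative) auto
  also have "\<dots> = unit_vec d i \<bullet> (reg_hessian \<gamma> (A w) *\<^sub>v unit_vec d j)"
    unfolding 0 by (rule reg_hessian_curvature[symmetric]) auto
  also have "\<dots> = reg_hessian \<gamma> (A w) $$ (i, j)"
    using K i j by (simp add: scalar_prod_left_unit[of _ d])
  finally show "hessian d F w $$ (i, j) = reg_hessian \<gamma> (A w) $$ (i, j)"
    using i j by (simp add: hessian_def)
qed (use carrier_matD[OF reg_hessian_carrier[OF A_carrier, of \<gamma> w]] in \<open>simp_all add: hessian_def\<close>)

text \<open>The chord argument of \<open>subproblem_optimality\<close>, with the smooth part
  differentiated along the segment towards \<open>u\<close>.\<close>

lemma minimizer_optimality:
  assumes r: "convex_vec d r" and opt: "is_arg_min (\<lambda>w. F w + r w) (\<lambda>w. w \<in> carrier_vec d) wopt"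
    and u: "u \<in> carrier_vec d"
  shows "0 \<le> grad d F wopt \<bullet> (u - wopt) + (r u - r wopt)"
proof -
  have wo: "wopt \<in> carrier_vec d" and min: "\<And>y. y \<in> carrier_vec d \<Longrightarrow> F wopt + r wopt \<le> F y + r y"
    using opt unfolding is_arg_min_def by (auto simp: not_less)
  define D where "D = u - wopt"
  have D: "D \<in> carrier_vec d" using u wo by (auto simp: D_def)
  have 0: "wopt + 0 \<cdot>\<^sub>v D = wopt" using wo D by (intro eq_vecI) auto
  define f where "f t = F (wopt + t \<cdot>\<^sub>v D) + t * (r u - r wopt)" for t
  have "(f has_real_derivative slope (wopt + 0 \<cdot>\<^sub>v D) D + (r u - r wopt)) (at 0)"
    unfolding f_def by (intro DERIV_add F_line_derivative[OF wo D]) (auto intro!: derivative_eq_intros)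
  then have "(f has_real_derivative grad d F wopt \<bullet> D + (r u - r wopt)) (at 0)"
    unfolding 0 grad_scalar_prod[OF wo D] .
  moreover have "f 0 \<le> f t" if "0 < t" "t \<le> 1" for t
  proof -
    have "F wopt + r wopt \<le> F (wopt + t \<cdot>\<^sub>v D) + r (wopt + t \<cdot>\<^sub>v D)" using wo D by (intro min) auto
    moreover have "r (wopt + t \<cdot>\<^sub>v D) \<le> r wopt + t * (r u - r wopt)"
      unfolding D_def using that by (intro convex_vec_segment[OF r wo u]) auto
    ultimately show ?thesis unfolding f_def 0 by simp
  qed
  ultimately show ?thesis unfolding D_def[symmetric] by (rule one_sided_minimum_derivative)
qed

text \<open>The factor 1/2 is needed: the step loses up to a factor 2 on this error.\<close>

lemma gradient_linearization:
  assumes w: "w \<in> carrier_vec d" and wo: "wo \<in> carrier_vec d" and e: "e \<in> carrier_vec d"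
    and lip: "\<And>w' u v. w' \<in> carrier_vec d \<Longrightarrow> u \<in> carrier_vec d \<Longrightarrow> v \<in> carrier_vec d \<Longrightarrow>
      \<bar>curvature w u v - curvature w' u v\<bar> \<le> L * vnorm (w - w') * (vnorm u * vnorm v)"
  shows "e \<bullet> (reg_hessian \<gamma> (A w) *\<^sub>v (w - wo)) - (grad d F w - grad d F wo) \<bullet> e
    \<le> L / 2 * (vnorm (w - wo))\<^sup>2 * vnorm e"
proof -
  define D where "D = w - wo"
  have D: "D \<in> carrier_vec d" using w wo by (auto simp: D_def)
  define K where "K = L * (vnorm D)\<^sup>2 * vnorm e"
  have w1: "wo + 1 \<cdot>\<^sub>v D = w" and w0: "wo + 0 \<cdot>\<^sub>v D = wo"
    using w wo by (intro eq_vecI; auto simp: D_def)+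
  \<comment> \<open>At parameter \<open>t\<close> the distance to \<open>w\<close> is
    \<open>(1 - t) * vnorm D\<close>, so the curvature changes by at most
    \<open>K * (1 - t)\<close>. The derivative of the subtracted square supplies exactly this amount
    and makes \<open>f\<close> nondecreasing; its integral over the unit interval is the source of
    the factor 1/2.\<close>
  define f where "f t = slope (wo + t \<cdot>\<^sub>v D) e - t * curvature w D e - K / 2 * (1 - t)\<^sup>2" for t
  have "f 0 \<le> f 1"
  proof (rule DERIV_nonneg_imp_nondecreasing[where f = f and a = 0 and b = 1])
    fix t :: real assume t: "0 \<le> t" "t \<le> 1"
    have wt: "wo + t \<cdot>\<^sub>v D \<in> carrier_vec d" using wo D by auto
    have "w - (wo + t \<cdot>\<^sub>v D) = (1 - t) \<cdot>\<^sub>v D" using w wo by (intro eq_vecI) (auto simp: D_def algebra_simps)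
    then have vn: "vnorm (w - (wo + t \<cdot>\<^sub>v D)) = (1 - t) * vnorm D" using t by (simp add: vnorm_smult)
    have "\<bar>curvature w D e - curvature (wo + t \<cdot>\<^sub>v D) D e\<bar> \<le> K * (1 - t)"
      using lip[OF wt D e] unfolding vn by (simp add: K_def power2_eq_square mult_ac)
    then have "curvature (wo + t \<cdot>\<^sub>v D) D e - curvature w D e + K * (1 - t) \<ge> 0" by linarith
    moreover have "(f has_real_derivative curvature (wo + t \<cdot>\<^sub>v D) D e - curvature w D e + K * (1 - t)) (at t)"
    proof -
      have "((\<lambda>t. (1 - t)\<^sup>2) has_real_derivative - 2 * (1 - t)) (at t)"
        by (auto intro!: derivative_eq_intros simp: algebra_simps)
      from DERIV_cmult[OF this, of "K / 2"]
      have "((\<lambda>t. K / 2 * (1 - t)\<^sup>2) has_real_derivative K / 2 * (- 2 * (1 - t))) (at t)" .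
      moreover have "((\<lambda>t. t * curvature w D e) has_real_derivative curvature w D e) (at t)"
        by (rule derivative_eq_intros refl | simp)+
      ultimately have "(f has_real_derivative
          curvature (wo + t \<cdot>\<^sub>v D) D e - curvature w D e - K / 2 * (- 2 * (1 - t))) (at t)"
        unfolding f_def by (intro DERIV_diff slope_line_derivative[OF wo D e])
      then show ?thesis by (simp add: algebra_simps)
    qed
    ultimately show "\<exists>y. DERIV f t :> y \<and> y \<ge> 0" by blast
  qed simp
  then have "curvature w D e - (slope w e - slope wo e) \<le> K / 2" unfolding f_def w0 w1 by simp
  moreover have "e \<bullet> (reg_hessian \<gamma> (A w) *\<^sub>v D) = curvature w D e"
    using reg_hessian_curvature[OF e D] e D comm_scalar_prod[OF e D]
    by (simp add: curvature_def mult.commute mult.left_commute)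
  moreover have "(grad d F w - grad d F wo) \<bullet> e = slope w e - slope wo e"
    using grad_scalar_prod[OF w e] grad_scalar_prod[OF wo e] minus_scalar_prod_distrib[OF grad_carrier grad_carrier e] by simp
  ultimately show ?thesis unfolding D_def K_def by simp
qed

end

section \<open>Convergence of the iteration\<close>

context regularized_losses
begin

abbreviation Hess :: "real vec \<Rightarrow> real mat" where "Hess w \<equiv> reg_hessian \<gamma> (A w)"

lemma Hess_facts:
  "Hess w \<in> carrier_mat d d" "psd (Hess w)" "transpose_mat (Hess w) = Hess w" "sigma_min (Hess w) > 0"
proof -
  show c: "Hess w \<in> carrier_mat d d" by (rule reg_hessian_carrier[OF A_carrier])
  show p: "psd (Hess w)" by (rule reg_hessian_psd(1)[OF A_carrier \<gamma>])
  then show s: "transpose_mat (Hess w) = Hess w" by (simp add: psd_def)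
  show "sigma_min (Hess w) > 0"
    by (rule sigma_min_pos[OF c s dpos \<gamma>]) (rule reg_hessian_psd(2)[OF A_carrier \<gamma>])
qed

lemma enorm_bounds:
  assumes v: "v \<in> carrier_vec d"
  shows "sqrt (sigma_min (Hess w)) * vnorm v \<le> enorm (Hess w) v"
    and "enorm (Hess w) v \<le> sqrt (sigma_max (Hess w)) * vnorm v"
  using psd_sigma_bounds[OF Hess_facts(1,2) v, of w]
  unfolding enorm_def vnorm_def real_sqrt_mult[symmetric] by simp_all

text \<open>One statement for both parts: \<open>L = 0\<close> for quadratic losses, the Lipschitz
  constant otherwise. Converting the linearisation error to the energy norm costs one factor
  \<open>1 / sqrt (sigma_min (Hess w))\<close>; returning to the Euclidean norm costs the other,
  whence the quotient \<open>L / sigma_min\<close>.\<close>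

lemma step_in_energy_norm:
  assumes r: "convex_vec d r" and opt: "is_arg_min (\<lambda>w. F w + r w) (\<lambda>w. w \<in> carrier_vec d) wopt"
    and eps: "\<epsilon> \<in> {0<..<1/4}" and e0: "e0 \<in> {0<..<1}" and w: "w \<in> carrier_vec d"
    and Ht: "Ht \<in> carrier_mat d d" "psd Ht"
    and close: "\<And>u v. u \<in> carrier_vec d \<Longrightarrow> v \<in> carrier_vec d \<Longrightarrow>
      \<bar>u \<bullet> (Ht *\<^sub>v v) - u \<bullet> (Hess w *\<^sub>v v)\<bar> \<le> \<epsilon> / 2 * (enorm (Hess w) u * enorm (Hess w) v)"
    and L: "L * vnorm (w - wopt) \<ge> 0"
    and lip: "\<And>w' u v. w' \<in> carrier_vec d \<Longrightarrow> u \<in> carrier_vec d \<Longrightarrow> v \<in> carrier_vec d \<Longrightarrow>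
      \<bar>curvature w u v - curvature w' u v\<bar> \<le> L * vnorm (w - w') * (vnorm u * vnorm v)"
    and upd: "sspn_update d Ht (grad d F w) r e0 w w'"
  shows "w' \<in> carrier_vec d"
    "enorm (Hess w) (w' - wopt) \<le> (\<epsilon> + e0) * enorm (Hess w) (w - wopt)
       + L * (vnorm (w - wopt))\<^sup>2 / sqrt (sigma_min (Hess w))"
proof -
  have wo: "wopt \<in> carrier_vec d" using opt by (simp add: is_arg_min_def)
  define \<sigma> where "\<sigma> = sqrt (sigma_min (Hess w))"
  have s: "\<sigma> > 0" using Hess_facts(4)[of w] by (simp add: \<sigma>_def)
  define b where "b = L / 2 * (vnorm (w - wopt))\<^sup>2 / \<sigma>"
  have L2: "0 \<le> L / 2 * (vnorm (w - wopt))\<^sup>2"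
    using mult_nonneg_nonneg[OF L vnorm_nonneg[of "w - wopt"]] by (simp add: power2_eq_square mult.assoc)
  then have b: "b \<ge> 0" using s by (simp add: b_def)
  have resid: "e \<bullet> (Hess w *\<^sub>v (w - wopt)) - (grad d F w - grad d F wopt) \<bullet> e \<le> b * enorm (Hess w) e"
    if e: "e \<in> carrier_vec d" for e
  proof -
    have "e \<bullet> (Hess w *\<^sub>v (w - wopt)) - (grad d F w - grad d F wopt) \<bullet> e
        \<le> L / 2 * (vnorm (w - wopt))\<^sup>2 * vnorm e"
      by (rule gradient_linearization[OF w wo e lip])
    also have "\<dots> \<le> L / 2 * (vnorm (w - wopt))\<^sup>2 * (enorm (Hess w) e / \<sigma>)"
    proof (rule mult_left_mono[OF _ L2])
      show "vnorm e \<le> enorm (Hess w) e / \<sigma>"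
        using enorm_bounds(1)[OF e, of w] s unfolding \<sigma>_def[symmetric] by (simp add: field_simps)
    qed
    also have "\<dots> = b * enorm (Hess w) e" by (simp add: b_def)
    finally show ?thesis .
  qed
  note step = prox_newton_step[OF Hess_facts(1)[of w] Hess_facts(2) Ht close eps e0 b r w wo
    grad_carrier grad_carrier minimizer_optimality[OF r opt] resid upd]
  show "w' \<in> carrier_vec d" using step(1) by simp
  show "enorm (Hess w) (w' - wopt) \<le> (\<epsilon> + e0) * enorm (Hess w) (w - wopt)
       + L * (vnorm (w - wopt))\<^sup>2 / sqrt (sigma_min (Hess w))"
    using step(2) by (simp add: b_def \<sigma>_def)
qed

text \<open>The quotient of the two comparison constants between energy and Euclidean norm is the
  root of the condition number.\<close>

lemma energy_to_norm:
  assumes u: "u \<in> carrier_vec d" and v: "v \<in> carrier_vec d" and c: "c \<ge> 0"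
    and le: "enorm (Hess w) u \<le> c * enorm (Hess w) v + b / sqrt (sigma_min (Hess w))"
  shows "vnorm u \<le> c * sqrt (sigma_max (Hess w) / sigma_min (Hess w)) * vnorm v + b / sigma_min (Hess w)"
proof -
  define m where "m = sqrt (sigma_min (Hess w))"
  have m: "m > 0" and mm: "sigma_min (Hess w) = m * m" using Hess_facts(4)[of w] by (auto simp: m_def)
  have "m * vnorm u \<le> c * (sqrt (sigma_max (Hess w)) * vnorm v) + b / m"
    using enorm_bounds(1)[OF u, of w] le mult_left_mono[OF enorm_bounds(2)[OF v, of w] c]
    unfolding m_def[symmetric] by linarith
  then have "vnorm u \<le> (c * (sqrt (sigma_max (Hess w)) * vnorm v) + b / m) / m"
    using m by (simp add: pos_le_divide_eq mult.commute)
  also have "\<dots> = c * sqrt (sigma_max (Hess w) / sigma_min (Hess w)) * vnorm v + b / sigma_min (Hess w)"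
    unfolding real_sqrt_divide m_def[symmetric] unfolding mm by (simp add: add_divide_distrib)
  finally show ?thesis .
qed

text \<open>The range condition on the draws holds almost surely. Including it makes the sampled
  Hessian positive semidefinite for every member, so that all later reasoning is
  deterministic.\<close>

abbreviation good_draws :: "real \<Rightarrow> nat \<Rightarrow> nat pmf \<Rightarrow> real vec \<Rightarrow> (nat \<Rightarrow> nat) set" where
  "good_draws \<epsilon> s q w \<equiv> {k. (\<forall>c<s. k c < n) \<and> (\<forall>u \<in> carrier_vec d. \<forall>v \<in> carrier_vec d.
     \<bar>u \<bullet> (sampled_hessian \<gamma> (A w) (sampling_matrix n s q k) *\<^sub>v v) - u \<bullet> (Hess w *\<^sub>v v)\<bar>
       \<le> \<epsilon> / 2 * (enorm (Hess w) u * enorm (Hess w) v))}"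

lemma prob_ge_good_draws:
  assumes "sampling_scheme 200 \<gamma> \<epsilon> \<delta> (A w) s q" "\<epsilon> \<in> {0<..<1/4}" "\<delta> \<in> {0<..<1}"
    and "good_draws \<epsilon> s q w \<subseteq> S"
  shows "measure_pmf.prob (column_draws s q) S \<ge> 1 - \<delta>"
proof -
  have "1 - \<delta> \<le> measure_pmf.prob (column_draws s q) (good_draws \<epsilon> s q w)"
    by (rule sampling_scheme_concentration[OF A_carrier n \<gamma> assms(2,3,1)])
  also have "\<dots> \<le> measure_pmf.prob (column_draws s q) S"
    using assms(4) by (intro measure_pmf.finite_measure_mono) auto
  finally show ?thesis .
qed

lemma lipschitz_step:
  assumes r: "convex_vec d r" and opt: "is_arg_min (\<lambda>w. F w + r w) (\<lambda>w. w \<in> carrier_vec d) wopt"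
    and eps: "\<epsilon> \<in> {0<..<1/4}" and e0: "e0 \<in> {0<..<1}" and w: "w \<in> carrier_vec d"
    and L: "\<And>w w'. w \<in> carrier_vec d \<Longrightarrow> w' \<in> carrier_vec d \<Longrightarrow>
      spectral_norm (hessian d F w - hessian d F w') \<le> L * vnorm (w - w')"
    and k: "k \<in> good_draws \<epsilon> s q w"
    and upd: "sspn_update d (sampled_hessian \<gamma> (A w) (sampling_matrix n s q k)) (grad d F w) r e0 w w'"
  shows "vnorm (w' - wopt) \<le>
    (\<epsilon> + e0) * sqrt (sigma_max (hessian d F w) / sigma_min (hessian d F w)) * vnorm (w - wopt)
      + L / sigma_min (hessian d F w) * (vnorm (w - wopt))\<^sup>2"
proof -
  have wo: "wopt \<in> carrier_vec d" using opt by (simp add: is_arg_min_def)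
  have D: "Hess w - Hess w' \<in> carrier_mat d d" for w' by (rule minus_carrier_mat[OF Hess_facts(1)])
  have sD: "transpose_mat (Hess w - Hess w') = Hess w - Hess w'" for w'
    by (simp add: transpose_minus[OF Hess_facts(1) Hess_facts(1)] Hess_facts(3))
  have lip: "\<bar>curvature w u v - curvature w' u v\<bar> \<le> L * vnorm (w - w') * (vnorm u * vnorm v)"
    if w': "w' \<in> carrier_vec d" and u: "u \<in> carrier_vec d" and v: "v \<in> carrier_vec d" for w' u v
  proof -
    have c: "Hess z *\<^sub>v v \<in> carrier_vec d" for z by (rule mult_mat_vec_carrier[OF Hess_facts(1) v])
    have "curvature w u v - curvature w' u v = u \<bullet> ((Hess w - Hess w') *\<^sub>v v)"
      unfolding minus_mult_distrib_mat_vec[OF Hess_facts(1) Hess_facts(1) v]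
        scalar_prod_minus_distrib[OF u c c] reg_hessian_curvature[OF u v] ..
    then have "\<bar>curvature w u v - curvature w' u v\<bar> \<le> spectral_norm (Hess w - Hess w') * (vnorm u * vnorm v)"
      using spectral_norm_bilinear[OF D sD u v dpos] by simp
    also have "\<dots> \<le> L * vnorm (w - w') * (vnorm u * vnorm v)"
      using L[OF w w'] unfolding hessian_eq[OF w] hessian_eq[OF w'] by (intro mult_right_mono) auto
    finally show ?thesis .
  qed
  have L0: "0 \<le> L * vnorm (w - wopt)"
  proof -
    obtain u lam where "eigenbasis d (Hess w - Hess wopt) u lam" using symmetric_eigenbasis[OF D sD] .
    then have "0 \<le> spectral_norm (Hess w - Hess wopt)"
      using symmetric_sigma_bounds(2)[OF D sD _ dpos] unfolding spectral_norm_def by fastforce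
    then show ?thesis using L[OF w wo] unfolding hessian_eq[OF w] hessian_eq[OF wo] by linarith
  qed
  have Ht: "sampled_hessian \<gamma> (A w) (sampling_matrix n s q k) \<in> carrier_mat d d"
    by (rule sampled_hessian_carrier[OF A_carrier])
  have psd: "psd (sampled_hessian \<gamma> (A w) (sampling_matrix n s q k))"
    using k by (intro sampled_hessian_psd[OF A_carrier \<gamma>]) auto
  have close: "\<bar>u \<bullet> (sampled_hessian \<gamma> (A w) (sampling_matrix n s q k) *\<^sub>v v) - u \<bullet> (Hess w *\<^sub>v v)\<bar>
      \<le> \<epsilon> / 2 * (enorm (Hess w) u * enorm (Hess w) v)"
    if "u \<in> carrier_vec d" "v \<in> carrier_vec d" for u v
    using k that by blast
  note step = step_in_energy_norm[OF r opt eps e0 w Ht psd close L0 lip upd]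
  have "w' - wopt \<in> carrier_vec d" "w - wopt \<in> carrier_vec d" using step(1) w wo by auto
  from energy_to_norm[OF this _ step(2)] eps e0 show ?thesis unfolding hessian_eq[OF w] by simp
qed

text \<open>Constant second derivatives make the weighted data and the Hessian independent of the
  iterate, so that one good sample serves all iterations. The contraction is iterated in this fixed
  energy norm, and the change of norm occurs once, after the induction.\<close>

lemma quadratic_iteration:
  assumes r: "convex_vec d r" and opt: "is_arg_min (\<lambda>w. F w + r w) (\<lambda>w. w \<in> carrier_vec d) wopt"
    and eps: "\<epsilon> \<in> {0<..<1/4}" and e0: "e0 \<in> {0<..<1}" and w0: "w0 \<in> carrier_vec d"
    and quad: "\<And>j. j < n \<Longrightarrow> quadratic (l j)"
    and k: "k \<in> good_draws \<epsilon> s q w0" and W0: "W 0 = w0"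
    and upd: "\<And>t. sspn_update d (sampled_hessian \<gamma> (A (W t)) (sampling_matrix n s q k))
      (grad d F (W t)) r e0 (W t) (W (Suc t))"
  shows "vnorm (W t - wopt) \<le>
    (\<epsilon> + e0) ^ t * sqrt (sigma_max (hessian d F w0) / sigma_min (hessian d F w0)) * vnorm (w0 - wopt)"
proof -
  have wo: "wopt \<in> carrier_vec d" using opt by (simp add: is_arg_min_def)
  have const: "deriv (deriv (l j)) z = deriv (deriv (l j)) z'" if j: "j < n" for j z z'
  proof -
    obtain a b c where l: "\<And>z. l j z = a * z\<^sup>2 + b * z + c" using quad[OF j] unfolding quadratic_def by blast
    have "deriv (l j) = (\<lambda>z. 2 * a * z + b)"
    proof
      fix z
      have "((\<lambda>z. a * z\<^sup>2 + b * z + c) has_real_derivative 2 * a * z + b) (at z)"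
        by (auto intro!: derivative_eq_intros)
      then show "deriv (l j) z = 2 * a * z + b" unfolding l[abs_def] by (rule DERIV_imp_deriv)
    qed
    moreover have "deriv (\<lambda>z. 2 * a * z + b) z = 2 * a" for z
      by (rule DERIV_imp_deriv) (auto intro!: derivative_eq_intros)
    ultimately show ?thesis by simp
  qed
  define c where "c j = deriv (deriv (l j)) 0" for j
  have c: "deriv (deriv (l j)) z = c j" if "j < n" for j z
    unfolding c_def by (rule const[OF that])
  have A: "A w = A w0" for w
    unfolding weighted_data_def by (intro cong_mat refl) (simp add: c)
  have curv: "curvature w u v = curvature w0 u v" for w u v
    unfolding curvature_def by (simp add: c)
  have Ht: "sampled_hessian \<gamma> (A w) (sampling_matrix n s q k) \<in> carrier_mat d d" for w
    by (rule sampled_hessian_carrier[OF A_carrier])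
  have psd: "psd (sampled_hessian \<gamma> (A w) (sampling_matrix n s q k))" for w
    using k by (intro sampled_hessian_psd[OF A_carrier \<gamma>]) auto
  have close: "\<bar>u \<bullet> (sampled_hessian \<gamma> (A w) (sampling_matrix n s q k) *\<^sub>v v) - u \<bullet> (Hess w *\<^sub>v v)\<bar>
      \<le> \<epsilon> / 2 * (enorm (Hess w) u * enorm (Hess w) v)"
    if "u \<in> carrier_vec d" "v \<in> carrier_vec d" for w u v
    unfolding A[of w] using k that by blast
  have "W t \<in> carrier_vec d \<and> enorm (Hess w0) (W t - wopt) \<le> (\<epsilon> + e0) ^ t * enorm (Hess w0) (w0 - wopt)"
  proof (induction t)
    case 0
    then show ?case using w0 by (simp add: W0)
  next
    case (Suc t)
    then have Wt: "W t \<in> carrier_vec d" by simp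
    have lip: "\<bar>curvature (W t) u v - curvature w' u v\<bar> \<le> 0 * vnorm (W t - w') * (vnorm u * vnorm v)" for w' u v
      using curv[of "W t"] curv[of w'] by simp
    note step = step_in_energy_norm[OF r opt eps e0 Wt Ht psd close _ lip upd]
    have "enorm (Hess w0) (W (Suc t) - wopt) \<le> (\<epsilon> + e0) * enorm (Hess w0) (W t - wopt)"
      using step(2) unfolding A[of "W t"] by simp
    also have "\<dots> \<le> (\<epsilon> + e0) * ((\<epsilon> + e0) ^ t * enorm (Hess w0) (w0 - wopt))"
      using Suc eps e0 by (intro mult_left_mono) auto
    finally show ?case using step(1) by (simp add: mult.assoc)
  qed
  then have Wt: "W t \<in> carrier_vec d"
    and le: "enorm (Hess w0) (W t - wopt) \<le> (\<epsilon> + e0) ^ t * enorm (Hess w0) (w0 - wopt) + 0 / sqrt (sigma_min (Hess w0))"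
    by auto
  have "W t - wopt \<in> carrier_vec d" "w0 - wopt \<in> carrier_vec d" using Wt w0 wo by auto
  from energy_to_norm[OF this _ le] eps e0 show ?thesis unfolding hessian_eq[OF w0] by simp
qed

end

theorem corollary9:
  shows "\<exists>C>0. \<forall>(n::nat) (d::nat) (s::nat) (x :: nat \<Rightarrow> real vec) (l :: nat \<Rightarrow> real \<Rightarrow> real)
      (r :: real vec \<Rightarrow> real) (\<gamma>::real) (\<epsilon>::real) (\<epsilon>\<^sub>0::real) (\<delta>::real) (wopt :: real vec).
    let F = smooth_part n x l \<gamma>;
        A = weighted_data n d x l;
        H = hessian d F;
        Ht = (\<lambda>q k w. sampled_hessian \<gamma> (A w) (sampling_matrix n s q k));
        step = (\<lambda>q k w w'. sspn_update d (Ht q k w) (grad d F w) r \<epsilon>\<^sub>0 w w');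
        \<kappa> = (\<lambda>w. sigma_max (H w) / sigma_min (H w))
    in
      0 < n \<longrightarrow> 0 < d \<longrightarrow> (\<forall>j<n. x j \<in> carrier_vec d) \<longrightarrow> \<gamma> > 0 \<longrightarrow>
      (\<forall>j<n. convex_on UNIV (l j) \<and> twice_differentiable (l j)) \<longrightarrow>
      convex_vec d r \<longrightarrow>
      is_arg_min (\<lambda>w. F w + r w) (\<lambda>w. w \<in> carrier_vec d) wopt \<longrightarrow>
      \<epsilon>\<^sub>0 \<in> {0<..<1} \<longrightarrow> \<epsilon> \<in> {0<..<1/4} \<longrightarrow> \<delta> \<in> {0<..<1} \<longrightarrow>
      ((\<forall>j<n. quadratic (l j)) \<longrightarrow>
        (\<forall>w0 \<in> carrier_vec d. \<forall>q. sampling_scheme C \<gamma> \<epsilon> \<delta> (A w0) s q \<longrightarrow>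
          measure_pmf.prob (column_draws s q)
            {k. \<forall>W. W 0 = w0 \<and> (\<forall>t. step q k (W t) (W (Suc t))) \<longrightarrow>
                  (\<forall>t. vnorm (W t - wopt) \<le>
                         (\<epsilon> + \<epsilon>\<^sub>0) ^ t * sqrt (\<kappa> w0) * vnorm (w0 - wopt))}
          \<ge> 1 - \<delta>)) \<and>
      (\<forall>L. (\<forall>w \<in> carrier_vec d. \<forall>w' \<in> carrier_vec d.
              spectral_norm (H w - H w') \<le> L * vnorm (w - w')) \<longrightarrow>
        (\<forall>w \<in> carrier_vec d. \<forall>q. sampling_scheme C \<gamma> \<epsilon> \<delta> (A w) s q \<longrightarrow>
          measure_pmf.prob (column_draws s q)
            {k. \<forall>w'. step q k w w' \<longrightarrow>
                  vnorm (w' - wopt) \<le>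
                    (\<epsilon> + \<epsilon>\<^sub>0) * sqrt (\<kappa> w) * vnorm (w - wopt)
                    + L / sigma_min (H w) * (vnorm (w - wopt))\<^sup>2}
          \<ge> 1 - \<delta>))"
proof (intro exI[of _ 200] conjI allI, goal_cases)
  case 1
  show ?case by simp
next
  case (2 n d s x l r \<gamma> \<epsilon> \<epsilon>\<^sub>0 \<delta> wopt)
  show ?case unfolding Let_def
  proof (intro impI)
    assume n: "0 < n" and d: "0 < d" and x: "\<forall>j<n. x j \<in> carrier_vec d" and \<gamma>: "\<gamma> > 0"
      and l: "\<forall>j<n. convex_on UNIV (l j) \<and> twice_differentiable (l j)"
      and r: "convex_vec d r"
      and opt: "is_arg_min (\<lambda>w. smooth_part n x l \<gamma> w + r w) (\<lambda>w. w \<in> carrier_vec d) wopt"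
      and e0: "\<epsilon>\<^sub>0 \<in> {0<..<1}" and eps: "\<epsilon> \<in> {0<..<1/4}" and del: "\<delta> \<in> {0<..<1}"
    interpret regularized_losses n d x l \<gamma>
      using n d x \<gamma> l by unfold_locales auto
    show "((\<forall>j<n. quadratic (l j)) \<longrightarrow>
        (\<forall>w0 \<in> carrier_vec d. \<forall>q. sampling_scheme 200 \<gamma> \<epsilon> \<delta> (A w0) s q \<longrightarrow>
          measure_pmf.prob (column_draws s q)
            {k. \<forall>W. W 0 = w0 \<and> (\<forall>t. sspn_update d (sampled_hessian \<gamma> (A (W t)) (sampling_matrix n s q k))
                    (grad d F (W t)) r \<epsilon>\<^sub>0 (W t) (W (Suc t))) \<longrightarrow>
                  (\<forall>t. vnorm (W t - wopt) \<le>
                         (\<epsilon> + \<epsilon>\<^sub>0) ^ t * sqrt (sigma_max (hessian d F w0) / sigma_min (hessian d F w0)) *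
                           vnorm (w0 - wopt))}
          \<ge> 1 - \<delta>)) \<and>
      (\<forall>L. (\<forall>w \<in> carrier_vec d. \<forall>w' \<in> carrier_vec d.
              spectral_norm (hessian d F w - hessian d F w') \<le> L * vnorm (w - w')) \<longrightarrow>
        (\<forall>w \<in> carrier_vec d. \<forall>q. sampling_scheme 200 \<gamma> \<epsilon> \<delta> (A w) s q \<longrightarrow>
          measure_pmf.prob (column_draws s q)
            {k. \<forall>w'. sspn_update d (sampled_hessian \<gamma> (A w) (sampling_matrix n s q k))
                    (grad d F w) r \<epsilon>\<^sub>0 w w' \<longrightarrow>
                  vnorm (w' - wopt) \<le>
                    (\<epsilon> + \<epsilon>\<^sub>0) * sqrt (sigma_max (hessian d F w) / sigma_min (hessian d F w)) * vnorm (w - wopt)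
                    + L / sigma_min (hessian d F w) * (vnorm (w - wopt))\<^sup>2}
          \<ge> 1 - \<delta>))"
    \<comment> \<open>In both parts the event in question contains the good draws at the given
      point, since on these the bound holds for all admissible inexact updates
      simultaneously.\<close>
    proof (intro conjI impI allI ballI, goal_cases)
      case (1 w0 q)
      show ?case
        by (rule prob_ge_good_draws[OF 1(3) eps del], rule subsetI, rule CollectI, intro allI impI,
          rule quadratic_iteration[OF r opt eps e0 1(2)]) (use 1(1) in auto)
    next
      case (2 L w q)
      show ?case
        by (rule prob_ge_good_draws[OF 2(3) eps del], rule subsetI, rule CollectI, intro allI impI,
          rule lipschitz_step[OF r opt eps e0 2(2)]) (use 2(1) in auto)
    qed
  qed
qed

end
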